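(* Let $G$ be an inverse semigroup, let $(\beta,\omega)$ be a twisted partial action of $G$ on a $C^*$-algebra $B$, and let $(\tilde\beta,\tilde\omega)$ be the corresponding twisted action of $\mathbf{Pr}(G)$ on $B$. Then $$B\rtimes_{\beta,\omega}G\cong B\rtimes_{\tilde\beta,\tilde\omega}\mathbf{Pr}(G)\quad\text{and}\quad B\rtimes^{\mathrm r}_{\beta,\omega}G\cong B\rtimes^{\mathrm r}_{\tilde\beta,\tilde\omega}\mathbf{Pr}(G).$$
   Context: Expansion. For an inverse semigroup $G$, $s^*$ is the inverse of $s$, $E(G)$ the set of idempotents, $\le$ the natural partial order. $\mathbf{Pr}(G)$ is the universal semigroup with one generator $[s]$ for each $s\in G$ and, for all $s,t\in G$, the relations $[s][t][t^*]=[st][t^*]$, $[s^*][s][t]=[s^*][st]$, $[s][s^*][s]=[s]$; it is an inverse semigroup. Put $\varepsilon_s=[s][s^*]$; these are commuting idempotents. Every $x\in\mathbf{Pr}(G)$ can be written uniquely (up to order and repetition of the $r_i$) in normal form $x=\varepsilon_{r_1}\cdots\varepsilon_{r_n}[r]$ with $r_ir_i^*=rr^*$ for all $i$ and $r,rr^*\in\{r_1,\dots,r_n\}$. Twisted partial action. Ideals are closed and two-sided; $I\cdot J=I\cap J$ for ideals. $\mathcal U\mathcal M(D)$ is the group of unitary multipliers of $D$. A twisted partial action of an inverse semigroup $S$ on $B$ is a pair $(\beta,\omega)$, where $\beta=\{\beta_s\}_{s\in S}$ is a family of $*$-isomorphisms $\beta_s\colon\mathcal D_{s^*}\to\mathcal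 D_s$ between ideals of $B$ and $\omega(s,t)\in\mathcal U\mathcal M(\mathcal D_s\cap\mathcal D_{st})$ for $s,t\in S$, such that the linear span of $\{\mathcal D_s\}_{s\in S}$ is dense in $B$ and for all $r,s,t\in S$, $e,f\in E(S)$: (i) $\beta_r(\mathcal D_{r^*}\cap\mathcal D_s)=\mathcal D_r\cap\mathcal D_{rs}$; (ii) $\beta_r(\beta_s(x))=\omega(r,s)\beta_{rs}(x)\omega(r,s)^*$ for $x\in\mathcal D_{s^*}\cap\mathcal D_{s^*r^*}$; (iii) $\beta_r(x\omega(s,t))\omega(r,st)=\beta_r(x)\omega(r,s)\omega(rs,t)$ for $x\in\mathcal D_{r^*}\cap\mathcal D_s\cap\mathcal D_{st}$; (iv) $\omega(e,f)=1_{ef}$ and $\omega(r,r^*r)=\omega(rr^*,r)=1_r$, where $1_r$ is the unit of the multiplier algebra of $\mathcal D_r$; (v) $\omega(s^*,e)\omega(s^*e,s)x=\omega(s^*,s)x$ for $x\in\mathcal D_{s^*e}$. It is a twisted (global) action if and only if $\mathcal D_s=\mathcal D_{ss^*}$ for all $s\in S$. Corresponding twisted action. Given $(\beta,\omega)$ on $G$ and $x=\varepsilon_{r_1}\cdots\varepsilon_{r_n}[r]$, $y=\varepsilon_{s_1}\cdots\varepsilon_{s_m}[s]$ in normal form, put $\tilde{\mathcal D}_x=\mathcal D_{r_1}\cdots\mathcal D_{r_n}\cdot\mathcal D_r$, $\tilde\beta_x=\beta_{r_1}\beta_{r_1}^{-1}\cdots\beta_{r_n}\beta_{r_n}^{-1}\beta_r\colon\tilde{\mathcal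 D}_{x^*}\to\tilde{\mathcal D}_x$ (composition of partial maps), and let $\tilde\omega(x,y)$ be the restriction of $\omega(r,s)$ to $\tilde{\mathcal D}_{xy}\subseteq\mathcal D_r\cdot\mathcal D_{rs}$. Then $(\tilde\beta,\tilde\omega)$ is a twisted action of $\mathbf{Pr}(G)$ on $B$. Fell bundles. A Fell bundle over an inverse semigroup $S$ is a family $\mathcal A=\{\mathcal A_s\}_{s\in S}$ of Banach spaces with bilinear multiplications $\mathcal A_s\times\mathcal A_t\to\mathcal A_{st}$, conjugate-linear isometric involutions $\mathcal A_s\to\mathcal A_{s^*}$, and linear isometric inclusions $j_{t,s}\colon\mathcal A_s\to\mathcal A_t$ for $s\le t$, such that multiplication is associative, $(ab)^*=b^*a^*$, $a^{**}=a$, $\|ab\|\le\|a\|\|b\|$, $\|a^*a\|=\|a\|^2$, $a^*a\ge0$ in the $C^*$-algebra $\mathcal A_{s^*s}$ for $a\in\mathcal A_s$, $j_{t,r}=j_{t,s}j_{s,r}$ for $r\le s\le t$, and the inclusions are compatible with multiplication and involution. The full cross-sectional $C^*$-algebra $C^*(\mathcal A)$ is the universal $C^*$-algebra for representations of $\mathcal A$, i.e. families of linear maps $\pi_s\colon\mathcal A_s\to C$ into a $C^*$-algebra with $\pi_s(a)\pi_t(b)=\pi_{st}(ab)$, $\pi_s(a)^*=\pi_{s^*}(a^* )$, $\pi_t\circ j_{t,s}=\pi_s$. The fibers over idempotents generate in it $C^*(\mathcal E)$, $\mathcal E$ the restriction of $\mathcal A$ to $E(S)$. For a pure state $\varphi$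 of $C^*(\mathcal E)$ there is a state $\tilde\varphi$ of $C^*(\mathcal A)$ with, for $a\in\mathcal A_s$, $\tilde\varphi(a)=\lim_i\varphi(au_i)$ if there is $e\in E(S)$, $e\le s$, with $\varphi|_{\mathcal A_e}\neq0$ ($(u_i)$ an approximate unit of $\mathcal A_e$), and $\tilde\varphi(a)=0$ otherwise. The reduced cross-sectional $C^*$-algebra $C^*_{\mathrm r}(\mathcal A)$ is the quotient of $C^*(\mathcal A)$ by the intersection of the kernels of the GNS representations of all such $\tilde\varphi$. Crossed products. The Fell bundle of a twisted partial action $(\beta,\omega)$ of $S$ on $B$ has fibers $\mathcal A_s=\mathcal D_s\delta_s=\{a\delta_s:a\in\mathcal D_s\}$ and operations $(a\delta_s)(b\delta_t)=\beta_s(\beta_s^{-1}(a)b)\omega(s,t)\delta_{st}$, $(a\delta_s)^*=\beta_s^{-1}(a^* )\omega(s^*,s)^*\delta_{s^*}$, and $j_{t,s}(a\delta_s)=a\,\omega(t,s^*s)^*\delta_t$ for $s\le t$. The full and reduced crossed products are $B\rtimes_{\beta,\omega}S=C^*(\mathcal A)$ and $B\rtimes^{\mathrm r}_{\beta,\omega}S=C^*_{\mathrm r}(\mathcal A)$ (canonical identifications), and likewise for $(\tilde\beta,\tilde\omega)$ over $\mathbf{Pr}(G)$. *)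

theory Defs
  imports "HOL-Analysis.Analysis"
begin

section \<open>Inverse semigroups and their prefix expansion\<close>

class inverse_semigroup = semigroup_mult +
  assumes ex1_inverse: "\<exists>!y. x * y * x = x \<and> y * x * y = y"

definition sinv :: "'s::inverse_semigroup \<Rightarrow> 's" where
  "sinv x = (THE y. x * y * x = x \<and> y * x * y = y)"

definition idem :: "'s::inverse_semigroup set" where
  "idem = {e. e * e = e}"

text \<open>The natural partial order.\<close>

definition nat_le :: "'s::inverse_semigroup \<Rightarrow> 's \<Rightarrow> bool" where
  "nat_le s t \<longleftrightarrow> (\<exists>e\<in>idem. s = t * e)"

lemma sinv_props:
  fixes x :: "'s::inverse_semigroup"
  shows "x * sinv x * x = x" "sinv x * x * sinv x = sinv x"
  unfolding sinv_def using theI'[OF ex1_inverse[of x]] by blast+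

lemma sinv_absorb:
  fixes x :: "'s::inverse_semigroup"
  shows "x * (sinv x * (x * z)) = x * z" "sinv x * (x * (sinv x * z)) = sinv x * z"
  using sinv_props[of x] by (simp_all add: mult.assoc[symmetric])

lemma sinv_eqI:
  fixes x :: "'s::inverse_semigroup"
  assumes "x * y * x = x" "y * x * y = y"
  shows "sinv x = y"
  unfolding sinv_def using assms ex1_inverse[of x] by (blast intro: the1_equality)

lemma sinv_sinv [simp]: "sinv (sinv x) = (x :: 's::inverse_semigroup)"
  by (rule sinv_eqI) (simp_all add: sinv_props)

lemma sinv_idem:
  fixes e :: "'s::inverse_semigroup"
  assumes "e * e = e" shows "sinv e = e"
  by (rule sinv_eqI) (simp_all add: assms)

lemma idem_commute:
  fixes e f :: "'s::inverse_semigroup"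
  assumes e: "e * e = e" and f: "f * f = f"
  shows "e * f = f * e"
proof -
  have idem_mult: "(e * f) * (e * f) = e * f" if e: "e * e = e" and f: "f * f = f" for e f :: 's
  proof -
    define x where "x = sinv (e * f)"
    have x: "e * f * x * (e * f) = e * f" "x * (e * f) * x = x"
      unfolding x_def by (rule sinv_props)+
    have "e * f * (f * x * e) * (e * f) = e * (f * f) * x * (e * e) * f"
      by (simp only: mult.assoc)
    also have "\<dots> = e * f" using x(1) by (simp add: e f mult.assoc)
    finally have 1: "e * f * (f * x * e) * (e * f) = e * f" .
    have "f * x * e * (e * f) * (f * x * e) = f * (x * ((e * e) * (f * f)) * x) * e"
      by (simp only: mult.assoc)
    also have "\<dots> = f * x * e" by (simp add: e f x(2))
    finally have 2: "f * x * e * (e * f) * (f * x * e) = f * x * e" .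
    have xeq: "x = f * x * e" unfolding x_def by (rule sinv_eqI[OF 1[unfolded x_def] 2[unfolded x_def]])
    have "x * x = f * (x * (e * f) * x) * e" by (subst (1 2) xeq) (simp only: mult.assoc)
    also have "\<dots> = x" by (simp only: x(2) xeq[symmetric])
    finally have xx: "x * x = x" .
    hence "sinv x = x" by (rule sinv_idem)
    moreover have "sinv x = e * f" unfolding x_def by simp
    ultimately show ?thesis using xx by simp
  qed
  have a: "e * f * (e * f) = e * f" by (rule idem_mult[OF e f])
  have b: "f * e * (f * e) = f * e" by (rule idem_mult[OF f e])
  have "e * f * (f * e) * (e * f) = e * (f * f) * (e * e) * f" by (simp only: mult.assoc)
  also have "\<dots> = e * f" using a by (simp add: e f mult.assoc)
  finally have 1: "e * f * (f * e) * (e * f) = e * f" .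
  have "f * e * (e * f) * (f * e) = f * (e * e) * (f * f) * e" by (simp only: mult.assoc)
  also have "\<dots> = f * e" using b by (simp add: e f mult.assoc)
  finally have 2: "f * e * (e * f) * (f * e) = f * e" .
  have "sinv (e * f) = f * e" by (rule sinv_eqI[OF 1 2])
  moreover have "sinv (e * f) = e * f" by (rule sinv_idem[OF a])
  ultimately show ?thesis by simp
qed

lemma sinv_idems:
  fixes s :: "'s::inverse_semigroup"
  shows "(s * sinv s) * (s * sinv s) = s * sinv s" "(sinv s * s) * (sinv s * s) = sinv s * s"
  using sinv_props[of s] by (simp_all add: mult.assoc[symmetric])

lemma sinv_mult:
  fixes s t :: "'s::inverse_semigroup"
  shows "sinv (s * t) = sinv t * sinv s"
proof (rule sinv_eqI)
  have c: "(sinv s * s) * (t * sinv t) = (t * sinv t) * (sinv s * s)"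
    by (rule idem_commute) (rule sinv_idems)+
  have "s * t * (sinv t * sinv s) * (s * t) = s * ((t * sinv t) * (sinv s * s)) * t"
    by (simp only: mult.assoc)
  also have "\<dots> = (s * sinv s * s) * (t * sinv t * t)" unfolding c[symmetric] by (simp only: mult.assoc)
  also have "\<dots> = s * t" by (simp only: sinv_props)
  finally show "s * t * (sinv t * sinv s) * (s * t) = s * t" .
  have "sinv t * sinv s * (s * t) * (sinv t * sinv s) = sinv t * ((sinv s * s) * (t * sinv t)) * sinv s"
    by (simp only: mult.assoc)
  also have "\<dots> = (sinv t * t * sinv t) * (sinv s * s * sinv s)" unfolding c by (simp only: mult.assoc)
  also have "\<dots> = sinv t * sinv s" by (simp only: sinv_props)
  finally show "sinv t * sinv s * (s * t) * (sinv t * sinv s) = sinv t * sinv s" .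
qed

text \<open>The semigroup given by generators and relations is the quotient of the term algebra over one
  binary operation by the least congruence containing associativity and the defining relations.\<close>

datatype 'g pr_word = Gen 'g | Mul "'g pr_word" "'g pr_word"

inductive pr_eq :: "'g::inverse_semigroup pr_word \<Rightarrow> 'g pr_word \<Rightarrow> bool" where
  pr_refl: "pr_eq u u"
| pr_sym: "pr_eq u v \<Longrightarrow> pr_eq v u"
| pr_trans: "pr_eq u v \<Longrightarrow> pr_eq v w \<Longrightarrow> pr_eq u w"
| pr_cong: "pr_eq u u' \<Longrightarrow> pr_eq v v' \<Longrightarrow> pr_eq (Mul u v) (Mul u' v')"
| pr_assoc: "pr_eq (Mul (Mul u v) w) (Mul u (Mul v w))"
| pr_rel1: "pr_eq (Mul (Mul (Gen s) (Gen t)) (Gen (sinv t))) (Mul (Gen (s * t)) (Gen (sinv t)))"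
| pr_rel2: "pr_eq (Mul (Mul (Gen (sinv s)) (Gen s)) (Gen t)) (Mul (Gen (sinv s)) (Gen (s * t)))"
| pr_rel3: "pr_eq (Mul (Mul (Gen s) (Gen (sinv s))) (Gen s)) (Gen s)"

quotient_type (overloaded) 'g pr = "'g::inverse_semigroup pr_word" / pr_eq
  by (intro equivpI reflpI sympI transpI) (blast intro: pr_refl pr_sym pr_trans)+

lift_definition pgen :: "'g::inverse_semigroup \<Rightarrow> 'g pr" is Gen .

instantiation pr :: (inverse_semigroup) semigroup_mult
begin
lift_definition times_pr :: "'a pr \<Rightarrow> 'a pr \<Rightarrow> 'a pr" is Mul
  by (rule pr_cong)
instance by standard (transfer, rule pr_assoc)
end

definition eps :: "'g::inverse_semigroup \<Rightarrow> 'g pr" where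
  "eps s = pgen s * pgen (sinv s)"


lemma pgen_rels:
  fixes s t :: "'g::inverse_semigroup"
  shows "pgen s * pgen t * pgen (sinv t) = pgen (s * t) * pgen (sinv t)"
    and "pgen (sinv s) * pgen s * pgen t = pgen (sinv s) * pgen (s * t)"
    and "pgen s * pgen (sinv s) * pgen s = pgen s"
  by (transfer, rule pr_rel1 pr_rel2 pr_rel3)+

lemma pgen_rel2':
  fixes s t :: "'g::inverse_semigroup"
  shows "pgen s * pgen (sinv s) * pgen t = pgen s * pgen (sinv s * t)"
  using pgen_rels(2)[of "sinv s" t] by simp

text \<open>An anti-automorphism of the expansion, used only to show that it is an inverse semigroup.\<close>

primrec word_star :: "'g::inverse_semigroup pr_word \<Rightarrow> 'g pr_word" where
  "word_star (Gen s) = Gen (sinv s)"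
| "word_star (Mul u v) = Mul (word_star v) (word_star u)"

lift_definition pr_star :: "'g::inverse_semigroup pr \<Rightarrow> 'g pr" is word_star
proof -
  fix u v :: "'g pr_word"
  assume "pr_eq u v"
  thus "pr_eq (word_star u) (word_star v)"
  proof induction
    case (pr_rel1 s t)
    have "pr_eq (Mul (Gen t) (Mul (Gen (sinv t)) (Gen (sinv s))))
        (Mul (Mul (Gen t) (Gen (sinv t))) (Gen (sinv s)))"
      by (rule pr_eq.pr_sym[OF pr_eq.pr_assoc])
    also have "pr_eq \<dots> (Mul (Gen t) (Gen (sinv t * sinv s)))"
      using pr_eq.pr_rel2[of "sinv t" "sinv s"] by simp
    finally (pr_eq.pr_trans) show ?case by (simp add: sinv_mult)
  next
    case (pr_rel2 s t)
    have "pr_eq (Mul (Gen (sinv t)) (Mul (Gen (sinv s)) (Gen s)))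
        (Mul (Mul (Gen (sinv t)) (Gen (sinv s))) (Gen s))"
      by (rule pr_eq.pr_sym[OF pr_eq.pr_assoc])
    also have "pr_eq \<dots> (Mul (Gen (sinv t * sinv s)) (Gen s))"
      using pr_eq.pr_rel1[of "sinv t" "sinv s"] by simp
    finally (pr_eq.pr_trans) show ?case by (simp add: sinv_mult)
  next
    case (pr_rel3 s)
    have "pr_eq (Mul (Gen (sinv s)) (Mul (Gen s) (Gen (sinv s))))
        (Mul (Mul (Gen (sinv s)) (Gen s)) (Gen (sinv s)))"
      by (rule pr_eq.pr_sym[OF pr_eq.pr_assoc])
    also have "pr_eq \<dots> (Gen (sinv s))"
      using pr_eq.pr_rel3[of "sinv s"] by simp
    finally (pr_eq.pr_trans) show ?case by simp
  qed (auto intro: pr_eq.intros)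
qed

lemma pr_star_simps:
  fixes s :: "'g::inverse_semigroup" and x y :: "'g pr"
  shows "pr_star (pgen s) = pgen (sinv s)" "pr_star (x * y) = pr_star y * pr_star x"
  by (transfer, simp add: pr_refl)+

lemma pr_star_eps: "pr_star (eps s) = eps (s :: 'g::inverse_semigroup)"
  by (simp add: eps_def pr_star_simps)

lemma eps_idem: "eps s * eps s = eps (s :: 'g::inverse_semigroup)"
  unfolding eps_def using pgen_rels(3)[of s] by (simp add: mult.assoc[symmetric])

lemma eps_pgen: "eps s * pgen s = pgen (s :: 'g::inverse_semigroup)"
  unfolding eps_def by (rule pgen_rels(3))

lemma pgen_eps:
  fixes t r :: "'g::inverse_semigroup"
  shows "pgen t * eps r = eps (t * r) * pgen t"
proof -
  have "pgen t * eps r = pgen (t * r) * pgen (sinv r)"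
    unfolding eps_def by (simp only: mult.assoc[symmetric] pgen_rels(1))
  also have "\<dots> = pgen (t * r) * (pgen (sinv (t * r)) * pgen (t * r) * pgen (sinv r))"
    by (simp only: mult.assoc[symmetric] pgen_rels(3))
  also have "\<dots> = pgen (t * r) * pgen (sinv (t * r)) * pgen (t * r * sinv r)"
    by (simp only: pgen_rels(2) mult.assoc[symmetric])
  also have "\<dots> = pgen (t * r) * pgen (sinv (t * r) * (t * r * sinv r))"
    by (rule pgen_rel2')
  also have "sinv (t * r) * (t * r * sinv r) = sinv r * ((sinv t * t) * (r * sinv r))"
    by (simp only: sinv_mult mult.assoc)
  also have "(sinv t * t) * (r * sinv r) = (r * sinv r) * (sinv t * t)"
    by (rule idem_commute) (rule sinv_idems)+
  also have "sinv r * ((r * sinv r) * (sinv t * t)) = sinv r * r * sinv r * (sinv t * t)"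
    by (simp only: mult.assoc)
  also have "\<dots> = sinv (t * r) * t" by (simp only: sinv_absorb sinv_mult mult.assoc)
  also have "pgen (t * r) * pgen (sinv (t * r) * t) = eps (t * r) * pgen t"
    unfolding eps_def by (rule pgen_rel2'[symmetric])
  finally show ?thesis .
qed

lemma eps_commute:
  fixes r s :: "'g::inverse_semigroup"
  shows "eps r * eps s = eps s * eps r"
proof -
  have A: "eps r * eps s = pgen (r * sinv r) * (eps s * eps r)" for r s :: 'g
  proof -
    have "eps r * eps s = pgen r * (pgen (sinv r) * eps s)" by (simp only: eps_def[of r] mult.assoc)
    also have "\<dots> = (pgen r * eps (sinv r * s)) * pgen (sinv r)"
      by (simp only: pgen_eps[of "sinv r"] mult.assoc)
    also have "\<dots> = eps (r * sinv r * s) * eps r" unfolding pgen_eps by (simp only: eps_def[of r] mult.assoc)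
    also have "\<dots> = pgen (r * sinv r * s) * pgen (sinv (r * sinv r * s)) * pgen r * pgen (sinv r)"
      by (simp only: eps_def mult.assoc)
    also have "\<dots> = pgen (r * sinv r * s) * pgen (sinv (r * sinv r * s) * r) * pgen (sinv r)"
      by (simp only: pgen_rel2')
    also have "sinv (r * sinv r * s) * r = sinv s * (r * sinv r * r)"
      by (simp add: sinv_mult mult.assoc)
    also have "pgen (r * sinv r * s) * pgen (sinv s * (r * sinv r * r)) * pgen (sinv r)
        = pgen (r * sinv r * s) * (pgen (sinv s * r) * pgen (sinv r))"
      unfolding sinv_props by (simp only: mult.assoc)
    also have "\<dots> = pgen (r * sinv r * s) * pgen (sinv s) * eps r"
      by (simp only: pgen_rels(1)[symmetric] eps_def mult.assoc)
    also have "\<dots> = pgen (r * sinv r) * (eps s * eps r)"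
      unfolding pgen_rels(1)[of "r * sinv r" s, symmetric] by (simp only: eps_def mult.assoc)
    finally show ?thesis .
  qed
  have B: "eps s * eps r = eps r * eps s * pgen (r * sinv r)" for r s :: 'g
    using arg_cong[OF A[of r s], of pr_star]
    by (simp add: pr_star_simps pr_star_eps sinv_mult)
  have C: "eps r * eps s = eps s * (eps r * eps s)" for r s :: 'g
  proof -
    have "eps s * (eps r * eps s) = eps s * (eps s * eps r * pgen (s * sinv s))" by (subst B) simp
    also have "\<dots> = eps s * eps s * eps r * pgen (s * sinv s)" by (simp only: mult.assoc)
    also have "\<dots> = eps r * eps s" by (simp only: eps_idem B[of r s, symmetric])
    finally show ?thesis by simp
  qed
  have D: "eps s * eps r = eps s * (eps r * eps s)"
    using arg_cong[OF C[of r s], of pr_star]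
    by (simp add: pr_star_simps pr_star_eps mult.assoc)
  show ?thesis using C[of r s] D by simp
qed

lemma pgen_idem:
  fixes e :: "'g::inverse_semigroup"
  assumes "e * e = e" shows "pgen e = eps e"
proof -
  have s: "sinv e = e" using assms by (rule sinv_idem)
  have "pgen e = pgen e * pgen e * pgen e" using pgen_rels(3)[of e] by (simp add: s)
  also have "\<dots> = pgen e * pgen e" using pgen_rels(1)[of e e] by (simp add: s assms)
  finally show ?thesis by (simp add: eps_def s)
qed

inductive_set eps_prods :: "'g::inverse_semigroup pr set" where
  "eps s \<in> eps_prods"
| "a \<in> eps_prods \<Longrightarrow> eps s * a \<in> eps_prods"

lemma eps_prods_eps: "a \<in> eps_prods \<Longrightarrow> a * eps s = eps s * a"
proof (induction rule: eps_prods.induct)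
  case (2 a r)
  have "eps r * a * eps s = eps r * (eps s * a)" by (simp only: 2(2) mult.assoc)
  also have "\<dots> = eps s * (eps r * a)" by (simp only: mult.assoc[symmetric] eps_commute[of r s])
  finally show ?case .
qed (rule eps_commute)

lemma eps_prods_commute: "a \<in> eps_prods \<Longrightarrow> b \<in> eps_prods \<Longrightarrow> a * b = b * a"
proof (induction a rule: eps_prods.induct)
  case (2 a r)
  have "eps r * a * b = eps r * b * a" by (simp only: 2(2)[OF 2(3)] mult.assoc)
  also have "\<dots> = b * (eps r * a)" by (simp only: eps_prods_eps[OF 2(3), symmetric] mult.assoc)
  finally show ?case .
qed (simp add: eps_prods_eps)

lemma eps_prods_mult: "a \<in> eps_prods \<Longrightarrow> b \<in> eps_prods \<Longrightarrow> a * b \<in> eps_prods"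
  by (induction a rule: eps_prods.induct) (auto simp: mult.assoc intro: eps_prods.intros)

lemma eps_prods_idem: "a \<in> eps_prods \<Longrightarrow> a * a = a"
proof (induction rule: eps_prods.induct)
  case (2 a r)
  have "eps r * a * (eps r * a) = eps r * (a * eps r) * a" by (simp only: mult.assoc)
  also have "\<dots> = (eps r * eps r) * (a * a)" by (simp only: eps_prods_eps[OF 2(1)] mult.assoc)
  finally show ?case by (simp only: eps_idem 2(2))
qed (rule eps_idem)

lemma pgen_eps_prods: "a \<in> eps_prods \<Longrightarrow> \<exists>b\<in>eps_prods. pgen t * a = b * pgen t"
proof (induction rule: eps_prods.induct)
  case (1 s)
  show ?case using pgen_eps[of t s] eps_prods.intros(1) by blast
next
  case (2 a s)
  then obtain b where b: "b \<in> eps_prods" "pgen t * a = b * pgen t" by blast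
  have "pgen t * (eps s * a) = eps (t * s) * b * pgen t"
    unfolding mult.assoc[of "eps (t * s)"] b(2)[symmetric] by (simp only: mult.assoc[symmetric] pgen_eps)
  thus ?case using b(1) eps_prods.intros(2) by blast
qed

lemma pr_decomp: "\<exists>a\<in>eps_prods. \<exists>r. x = a * pgen r"
proof (induction x rule: pr.abs_induct)
  fix w :: "'a pr_word"
  show "\<exists>a\<in>eps_prods. \<exists>r. abs_pr w = a * pgen r"
  proof (induction w)
    case (Gen r)
    have "abs_pr (Gen r) = eps r * pgen r" by (simp only: eps_pgen pgen.abs_eq[symmetric])
    thus ?case using eps_prods.intros(1) by blast
  next
    case (Mul u v)
    then obtain a r b s where ab: "a \<in> eps_prods" "abs_pr u = a * pgen r"
      "b \<in> eps_prods" "abs_pr v = b * pgen s" by blast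
    obtain c where c: "c \<in> eps_prods" "pgen r * b = c * pgen r"
      using pgen_eps_prods[OF ab(3)] by blast
    have "pgen r * pgen s = pgen r * pgen (sinv r) * pgen r * pgen s" by (simp only: pgen_rels)
    also have "\<dots> = pgen r * (pgen (sinv r) * pgen r * pgen s)" by (simp only: mult.assoc)
    also have "\<dots> = eps r * pgen (r * s)" unfolding pgen_rels(2) by (simp only: eps_def mult.assoc)
    finally have rs: "pgen r * pgen s = eps r * pgen (r * s)" .
    have "abs_pr (Mul u v) = a * (pgen r * b) * pgen s"
      by (simp only: times_pr.abs_eq[symmetric] ab mult.assoc)
    also have "\<dots> = (a * c) * (eps r * pgen (r * s))" by (simp only: c rs mult.assoc)
    also have "\<dots> = (a * c * eps r) * pgen (r * s)" by (simp only: mult.assoc)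
    finally show ?case
      using eps_prods_mult[OF eps_prods_mult[OF ab(1) c(1)] eps_prods.intros(1)] by blast
  qed
qed

text \<open>The canonical homomorphism onto the given inverse semigroup.\<close>

primrec word_deg :: "'g::inverse_semigroup pr_word \<Rightarrow> 'g" where
  "word_deg (Gen s) = s"
| "word_deg (Mul u v) = word_deg u * word_deg v"

lift_definition pr_deg :: "'g::inverse_semigroup pr \<Rightarrow> 'g" is word_deg
proof -
  fix u v :: "'g pr_word"
  assume "pr_eq u v"
  thus "word_deg u = word_deg v"
    by induction (simp_all add: mult.assoc sinv_props[unfolded mult.assoc])
qed

lemma pr_deg_simps [simp]:
  "pr_deg (pgen s) = s" "pr_deg (x * y) = pr_deg x * pr_deg y"
  by (transfer, simp)+

lemma eps_prods_pgen: "a \<in> eps_prods \<Longrightarrow> a * pgen r = a * pgen (pr_deg a * r)"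
proof (induction arbitrary: r rule: eps_prods.induct)
  case (1 s)
  show ?case unfolding eps_def pr_deg_simps pgen_rel2' by (simp only: sinv_absorb mult.assoc)
next
  case (2 a s)
  have e: "eps s * pgen r = eps s * pgen (pr_deg (eps s) * r)" for r
    unfolding eps_def pr_deg_simps pgen_rel2' by (simp only: sinv_absorb mult.assoc)
  have "eps s * a * pgen r = eps s * a * pgen (pr_deg a * r)"
    using "2.IH"[of r] by (simp only: mult.assoc)
  also have "\<dots> = a * (eps s * pgen (pr_deg a * r))"
    by (simp only: eps_prods_eps[OF 2(1), symmetric] mult.assoc)
  also have "\<dots> = a * (eps s * pgen (pr_deg (eps s * a) * r))"
    by (subst e) (simp only: pr_deg_simps mult.assoc)
  also have "\<dots> = eps s * a * pgen (pr_deg (eps s * a) * r)"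
    by (simp only: eps_prods_eps[OF 2(1), symmetric] mult.assoc)
  finally show ?case .
qed

lemma pr_idem_eps_prods:
  assumes "x * x = x" shows "x \<in> eps_prods"
proof -
  obtain a r where a: "a \<in> eps_prods" and x: "x = a * pgen r" using pr_decomp by blast
  have "x = a * pgen (pr_deg x)" unfolding x pr_deg_simps by (rule eps_prods_pgen[OF a])
  moreover have "pr_deg x * pr_deg x = pr_deg x" using arg_cong[OF assms, of pr_deg] by simp
  ultimately have "x = a * eps (pr_deg x)" by (metis pgen_idem)
  thus ?thesis using a by (metis eps_prods_mult eps_prods.intros(1))
qed

instance pr :: (inverse_semigroup) inverse_semigroup
proof
  fix x :: "'a pr"
  obtain a r where a: "a \<in> eps_prods" and x: "x = a * pgen r" using pr_decomp by blast
  have aa: "a * (a * z) = a * z" for z using eps_prods_idem[OF a] by (metis mult.assoc)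
  have ae: "a * (eps r * z) = eps r * (a * z)" for z
    using eps_prods_eps[OF a, of r] by (metis mult.assoc)
  have rr: "pgen r * (pgen (sinv r) * z) = eps r * z" for z by (simp add: eps_def mult.assoc)
  have r': "pgen (sinv r) * (eps r * z) = pgen (sinv r) * z" for z
    using pgen_rels(3)[of "sinv r"] by (simp add: eps_def mult.assoc[symmetric])
  have ee: "eps r * (eps r * z) = eps r * z" for z using eps_idem by (metis mult.assoc)
  have 1: "x * (pgen (sinv r) * a) * x = x"
    by (simp add: x mult.assoc aa rr ae[symmetric] eps_pgen)
  have 2: "(pgen (sinv r) * a) * x * (pgen (sinv r) * a) = pgen (sinv r) * a"
    by (simp add: x mult.assoc aa rr ae r' eps_prods_idem[OF a])
  show "\<exists>!y. x * y * x = x \<and> y * x * y = y"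
  proof (rule ex1I, rule conjI[OF 1 2])
    fix y assume y: "x * y * x = x \<and> y * x * y = y"
    define z where "z = pgen (sinv r) * a"
    have z: "x * z * x = x" "z * x * z = z" using 1 2 by (simp_all add: z_def)
    have I: "y * x \<in> eps_prods" "z * x \<in> eps_prods" "x * y \<in> eps_prods" "x * z \<in> eps_prods"
      using y z by (auto intro!: pr_idem_eps_prods simp: mult.assoc[symmetric])
    have "y = (y * x) * (z * x) * y" using y z(1) by (metis mult.assoc)
    also have "\<dots> = (z * x) * (y * x) * y" using eps_prods_commute[OF I(1,2)] by simp
    also have "\<dots> = z * x * y" using y by (metis mult.assoc)
    also have "\<dots> = z * (x * z) * (x * y)" using z by (metis mult.assoc)
    also have "\<dots> = z * (x * y) * (x * z)" using eps_prods_commute[OF I(3,4)] by (metis mult.assoc)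
    also have "\<dots> = z" using y z by (metis mult.assoc)
    finally show "y = z" .
  qed
qed


text \<open>The normal form \<open>\<epsilon>\<^bsub>r1\<^esub> \<cdots> \<epsilon>\<^bsub>rn\<^esub> [r]\<close> of an element of the expansion, with \<open>rs = [r1, \<dots>, rn]\<close>. It exists, and
  it is unique up to order and repetition in \<open>rs\<close>; nothing below depends on the choice.\<close>

definition is_normal_form :: "'g::inverse_semigroup list \<Rightarrow> 'g \<Rightarrow> 'g pr \<Rightarrow> bool" where
  "is_normal_form rs r x \<longleftrightarrow>
     x = foldr (\<lambda>s y. eps s * y) rs (pgen r) \<and>
     (\<forall>s\<in>set rs. s * sinv s = r * sinv r) \<and> r \<in> set rs \<and> r * sinv r \<in> set rs"

definition normal_form :: "'g::inverse_semigroup pr \<Rightarrow> 'g list \<times> 'g" where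
  "normal_form x = (SOME (rs, r). is_normal_form rs r x)"


section \<open>Banach spaces and \<open>C\<^sup>*\<close>-algebras with explicit carriers\<close>

text \<open>Crossed products depend on a twisted partial action, that is, on a term, so all algebras are
  records with a carrier set.\<close>

record 'a normed_sp =
  car :: "'a set"
  zer :: 'a (\<open>\<zero>\<index>\<close>)
  add :: "'a \<Rightarrow> 'a \<Rightarrow> 'a" (infixl \<open>\<oplus>\<index>\<close> 65)
  scal :: "complex \<Rightarrow> 'a \<Rightarrow> 'a" (infixr \<open>\<odot>\<index>\<close> 75)
  nrm :: "'a \<Rightarrow> real" (\<open>\<parallel>_\<parallel>\<index>\<close>)

record 'a cstar = "'a normed_sp" +
  mul :: "'a \<Rightarrow> 'a \<Rightarrow> 'a" (infixl \<open>\<otimes>\<index>\<close> 70)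
  adj :: "'a \<Rightarrow> 'a" (\<open>_\<^sup>\<star>\<index>\<close> [1000] 999)

definition vdist :: "('a, 'm) normed_sp_scheme \<Rightarrow> 'a \<Rightarrow> 'a \<Rightarrow> real" where
  "vdist V x y = \<parallel>x \<oplus>\<^bsub>V\<^esub> (- 1) \<odot>\<^bsub>V\<^esub> y\<parallel>\<^bsub>V\<^esub>"

locale complex_banach =
  fixes V :: "('a, 'm) normed_sp_scheme" (structure)
  assumes zero_closed: "\<zero> \<in> car V"
    and add_closed: "\<lbrakk>x \<in> car V; y \<in> car V\<rbrakk> \<Longrightarrow> x \<oplus> y \<in> car V"
    and scal_closed: "x \<in> car V \<Longrightarrow> c \<odot> x \<in> car V"
    and add_assoc: "\<lbrakk>x \<in> car V; y \<in> car V; z \<in> car V\<rbrakk> \<Longrightarrow> (x \<oplus> y) \<oplus> z = x \<oplus> (y \<oplus> z)"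
    and add_commute: "\<lbrakk>x \<in> car V; y \<in> car V\<rbrakk> \<Longrightarrow> x \<oplus> y = y \<oplus> x"
    and add_zero: "x \<in> car V \<Longrightarrow> x \<oplus> \<zero> = x"
    and add_neg: "x \<in> car V \<Longrightarrow> x \<oplus> (- 1) \<odot> x = \<zero>"
    and scal_add_right: "\<lbrakk>x \<in> car V; y \<in> car V\<rbrakk> \<Longrightarrow> c \<odot> (x \<oplus> y) = c \<odot> x \<oplus> c \<odot> y"
    and scal_add_left: "x \<in> car V \<Longrightarrow> (c + d) \<odot> x = c \<odot> x \<oplus> d \<odot> x"
    and scal_scal: "x \<in> car V \<Longrightarrow> c \<odot> d \<odot> x = (c * d) \<odot> x"
    and scal_one: "x \<in> car V \<Longrightarrow> 1 \<odot> x = x"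
    and norm_zero_iff: "x \<in> car V \<Longrightarrow> \<parallel>x\<parallel> = 0 \<longleftrightarrow> x = \<zero>"
    and norm_triangle: "\<lbrakk>x \<in> car V; y \<in> car V\<rbrakk> \<Longrightarrow> \<parallel>x \<oplus> y\<parallel> \<le> \<parallel>x\<parallel> + \<parallel>y\<parallel>"
    and norm_scal: "x \<in> car V \<Longrightarrow> \<parallel>c \<odot> x\<parallel> = cmod c * \<parallel>x\<parallel>"
    and complete: "\<lbrakk>\<And>n. X n \<in> car V;
        \<And>\<epsilon>. \<epsilon> > 0 \<Longrightarrow> \<exists>N::nat. \<forall>m\<ge>N. \<forall>n\<ge>N. vdist V (X m) (X n) < \<epsilon>\<rbrakk>
        \<Longrightarrow> \<exists>x\<in>car V. (\<lambda>n. vdist V (X n) x) \<longlonglongrightarrow> 0"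

locale cstar_algebra = complex_banach C
  for C :: "'a cstar" (structure) +
  assumes mul_closed: "\<lbrakk>x \<in> car C; y \<in> car C\<rbrakk> \<Longrightarrow> x \<otimes> y \<in> car C"
    and adj_closed: "x \<in> car C \<Longrightarrow> x\<^sup>\<star> \<in> car C"
    and mul_assoc: "\<lbrakk>x \<in> car C; y \<in> car C; z \<in> car C\<rbrakk> \<Longrightarrow> (x \<otimes> y) \<otimes> z = x \<otimes> (y \<otimes> z)"
    and mul_add_left: "\<lbrakk>x \<in> car C; y \<in> car C; z \<in> car C\<rbrakk> \<Longrightarrow> (x \<oplus> y) \<otimes> z = x \<otimes> z \<oplus> y \<otimes> z"
    and mul_add_right: "\<lbrakk>x \<in> car C; y \<in> car C; z \<in> car C\<rbrakk> \<Longrightarrow> x \<otimes> (y \<oplus> z) = x \<otimes> y \<oplus> x \<otimes> z"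
    and mul_scal_left: "\<lbrakk>x \<in> car C; y \<in> car C\<rbrakk> \<Longrightarrow> (c \<odot> x) \<otimes> y = c \<odot> (x \<otimes> y)"
    and mul_scal_right: "\<lbrakk>x \<in> car C; y \<in> car C\<rbrakk> \<Longrightarrow> x \<otimes> (c \<odot> y) = c \<odot> (x \<otimes> y)"
    and adj_add: "\<lbrakk>x \<in> car C; y \<in> car C\<rbrakk> \<Longrightarrow> (x \<oplus> y)\<^sup>\<star> = x\<^sup>\<star> \<oplus> y\<^sup>\<star>"
    and adj_scal: "x \<in> car C \<Longrightarrow> (c \<odot> x)\<^sup>\<star> = cnj c \<odot> x\<^sup>\<star>"
    and adj_mul: "\<lbrakk>x \<in> car C; y \<in> car C\<rbrakk> \<Longrightarrow> (x \<otimes> y)\<^sup>\<star> = y\<^sup>\<star> \<otimes> x\<^sup>\<star>"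
    and adj_adj: "x \<in> car C \<Longrightarrow> (x\<^sup>\<star>)\<^sup>\<star> = x"
    and norm_mul: "\<lbrakk>x \<in> car C; y \<in> car C\<rbrakk> \<Longrightarrow> \<parallel>x \<otimes> y\<parallel> \<le> \<parallel>x\<parallel> * \<parallel>y\<parallel>"
    and cstar_identity: "x \<in> car C \<Longrightarrow> \<parallel>x\<^sup>\<star> \<otimes> x\<parallel> = \<parallel>x\<parallel>\<^sup>2"

definition lin_map ::
  "('a, 'm) normed_sp_scheme \<Rightarrow> ('b, 'n) normed_sp_scheme \<Rightarrow> ('a \<Rightarrow> 'b) \<Rightarrow> bool" where
  "lin_map V W f \<longleftrightarrow>
     (\<forall>x\<in>car V. f x \<in> car W) \<and>
     (\<forall>x\<in>car V. \<forall>y\<in>car V. f (x \<oplus>\<^bsub>V\<^esub> y) = f x \<oplus>\<^bsub>W\<^esub> f y) \<and>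
     (\<forall>c. \<forall>x\<in>car V. f (c \<odot>\<^bsub>V\<^esub> x) = c \<odot>\<^bsub>W\<^esub> f x)"

definition star_hom :: "'a cstar \<Rightarrow> 'b cstar \<Rightarrow> ('a \<Rightarrow> 'b) \<Rightarrow> bool" where
  "star_hom C D f \<longleftrightarrow>
     lin_map C D f \<and>
     (\<forall>x\<in>car C. \<forall>y\<in>car C. f (x \<otimes>\<^bsub>C\<^esub> y) = f x \<otimes>\<^bsub>D\<^esub> f y) \<and>
     (\<forall>x\<in>car C. f (x\<^sup>\<star>\<^bsub>C\<^esub>) = (f x)\<^sup>\<star>\<^bsub>D\<^esub>)"

definition star_iso :: "'a cstar \<Rightarrow> 'b cstar \<Rightarrow> ('a \<Rightarrow> 'b) \<Rightarrow> bool" where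
  "star_iso C D f \<longleftrightarrow> star_hom C D f \<and> bij_betw f (car C) (car D)"

definition star_isomorphic :: "'a cstar \<Rightarrow> 'b cstar \<Rightarrow> bool" (infix \<open>\<cong>\<close> 50) where
  "C \<cong> D \<longleftrightarrow> (\<exists>f. star_iso C D f)"

definition lin_subspace :: "('a, 'm) normed_sp_scheme \<Rightarrow> 'a set \<Rightarrow> bool" where
  "lin_subspace V W \<longleftrightarrow>
     W \<subseteq> car V \<and> \<zero>\<^bsub>V\<^esub> \<in> W \<and> (\<forall>x\<in>W. \<forall>y\<in>W. x \<oplus>\<^bsub>V\<^esub> y \<in> W) \<and> (\<forall>c. \<forall>x\<in>W. c \<odot>\<^bsub>V\<^esub> x \<in> W)"

definition lin_span :: "('a, 'm) normed_sp_scheme \<Rightarrow> 'a set \<Rightarrow> 'a set" where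
  "lin_span V X = \<Inter>{W. lin_subspace V W \<and> X \<subseteq> W}"

definition norm_dense :: "('a, 'm) normed_sp_scheme \<Rightarrow> 'a set \<Rightarrow> bool" where
  "norm_dense V X \<longleftrightarrow> (\<forall>x\<in>car V. \<forall>\<epsilon>>0. \<exists>y\<in>X. vdist V x y < \<epsilon>)"

definition norm_closed :: "('a, 'm) normed_sp_scheme \<Rightarrow> 'a set \<Rightarrow> bool" where
  "norm_closed V X \<longleftrightarrow>
     (\<forall>Y. \<forall>x\<in>car V. (\<forall>n::nat. Y n \<in> X) \<and> (\<lambda>n. vdist V (Y n) x) \<longlonglongrightarrow> 0 \<longrightarrow> x \<in> X)"

definition closed_ideal :: "'a cstar \<Rightarrow> 'a set \<Rightarrow> bool" where
  "closed_ideal C I \<longleftrightarrow>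
     lin_subspace C I \<and> norm_closed C I \<and>
     (\<forall>x\<in>car C. \<forall>y\<in>I. x \<otimes>\<^bsub>C\<^esub> y \<in> I \<and> y \<otimes>\<^bsub>C\<^esub> x \<in> I)"

definition cstar_subalgebra :: "'a cstar \<Rightarrow> 'a set \<Rightarrow> bool" where
  "cstar_subalgebra C D \<longleftrightarrow>
     lin_subspace C D \<and> norm_closed C D \<and>
     (\<forall>x\<in>D. \<forall>y\<in>D. x \<otimes>\<^bsub>C\<^esub> y \<in> D) \<and> (\<forall>x\<in>D. x\<^sup>\<star>\<^bsub>C\<^esub> \<in> D)"

definition generated_cstar :: "'a cstar \<Rightarrow> 'a set \<Rightarrow> 'a cstar" where
  "generated_cstar C X = C\<lparr>car := \<Inter>{D. cstar_subalgebra C D \<and> X \<subseteq> D}\<rparr>"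

text \<open>The quotient by a closed ideal, consisting of cosets.\<close>

definition coset :: "'a cstar \<Rightarrow> 'a set \<Rightarrow> 'a \<Rightarrow> 'a set" where
  "coset C J x = (\<lambda>y. x \<oplus>\<^bsub>C\<^esub> y) ` J"

definition cstar_quotient :: "'a cstar \<Rightarrow> 'a set \<Rightarrow> 'a set cstar" where
  "cstar_quotient C J =
     \<lparr>car = coset C J ` car C,
      zer = J,
      add = (\<lambda>X Y. \<Union>x\<in>X. \<Union>y\<in>Y. coset C J (x \<oplus>\<^bsub>C\<^esub> y)),
      scal = (\<lambda>c X. \<Union>x\<in>X. coset C J (c \<odot>\<^bsub>C\<^esub> x)),
      nrm = (\<lambda>X. INF x\<in>X. \<parallel>x\<parallel>\<^bsub>C\<^esub>),
      mul = (\<lambda>X Y. \<Union>x\<in>X. \<Union>y\<in>Y. coset C J (x \<otimes>\<^bsub>C\<^esub> y)),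
      adj = (\<lambda>X. \<Union>x\<in>X. coset C J (x\<^sup>\<star>\<^bsub>C\<^esub>))\<rparr>"


section \<open>Multipliers\<close>

text \<open>Multipliers of a closed ideal \<open>D\<close> of \<open>B\<close> as double centralizers: \<open>(L, R)\<close> consists of left
  multiplication \<open>x \<mapsto> u x\<close> and right multiplication \<open>x \<mapsto> x u\<close>. Both components are extensional
  on \<open>D\<close>, so equality of multipliers of \<open>D\<close> is equality of pairs.\<close>

type_synonym 'b multiplier = "('b \<Rightarrow> 'b) \<times> ('b \<Rightarrow> 'b)"

abbreviation lmult :: "'b multiplier \<Rightarrow> 'b \<Rightarrow> 'b" where "lmult \<equiv> fst"
abbreviation rmult :: "'b multiplier \<Rightarrow> 'b \<Rightarrow> 'b" where "rmult \<equiv> snd"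

definition multipliers :: "'b cstar \<Rightarrow> 'b set \<Rightarrow> 'b multiplier set" where
  "multipliers B D = {(L, R).
     L \<in> extensional D \<and> R \<in> extensional D \<and>
     lin_map (B\<lparr>car := D\<rparr>) (B\<lparr>car := D\<rparr>) L \<and> lin_map (B\<lparr>car := D\<rparr>) (B\<lparr>car := D\<rparr>) R \<and>
     (\<exists>K. \<forall>x\<in>D. \<parallel>L x\<parallel>\<^bsub>B\<^esub> \<le> K * \<parallel>x\<parallel>\<^bsub>B\<^esub> \<and> \<parallel>R x\<parallel>\<^bsub>B\<^esub> \<le> K * \<parallel>x\<parallel>\<^bsub>B\<^esub>) \<and>
     (\<forall>x\<in>D. \<forall>y\<in>D. L (x \<otimes>\<^bsub>B\<^esub> y) = L x \<otimes>\<^bsub>B\<^esub> y \<and> R (x \<otimes>\<^bsub>B\<^esub> y) = x \<otimes>\<^bsub>B\<^esub> R y \<and>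
        R x \<otimes>\<^bsub>B\<^esub> y = x \<otimes>\<^bsub>B\<^esub> L y)}"

definition mult_one :: "'b set \<Rightarrow> 'b multiplier" where
  "mult_one D = (\<lambda>x\<in>D. x, \<lambda>x\<in>D. x)"

definition mult_times :: "'b set \<Rightarrow> 'b multiplier \<Rightarrow> 'b multiplier \<Rightarrow> 'b multiplier" where
  "mult_times D u v = (\<lambda>x\<in>D. lmult u (lmult v x), \<lambda>x\<in>D. rmult v (rmult u x))"

definition mult_adj :: "'b cstar \<Rightarrow> 'b set \<Rightarrow> 'b multiplier \<Rightarrow> 'b multiplier" where
  "mult_adj B D u = (\<lambda>x\<in>D. (rmult u (x\<^sup>\<star>\<^bsub>B\<^esub>))\<^sup>\<star>\<^bsub>B\<^esub>, \<lambda>x\<in>D. (lmult u (x\<^sup>\<star>\<^bsub>B\<^esub>))\<^sup>\<star>\<^bsub>B\<^esub>)"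

definition unitary_multipliers :: "'b cstar \<Rightarrow> 'b set \<Rightarrow> 'b multiplier set" where
  "unitary_multipliers B D = {u \<in> multipliers B D.
     mult_times D (mult_adj B D u) u = mult_one D \<and> mult_times D u (mult_adj B D u) = mult_one D}"

definition mult_restrict :: "'b set \<Rightarrow> 'b multiplier \<Rightarrow> 'b multiplier" where
  "mult_restrict D u = (restrict (lmult u) D, restrict (rmult u) D)"


section \<open>Twisted partial actions\<close>

record ('s, 'b) twisted_data =
  tdom :: "'s \<Rightarrow> 'b set"
  tact :: "'s \<Rightarrow> 'b \<Rightarrow> 'b"
  tcoc :: "'s \<Rightarrow> 's \<Rightarrow> 'b multiplier"

definition coc_adj :: "'b cstar \<Rightarrow> ('s::inverse_semigroup, 'b) twisted_data \<Rightarrow> 's \<Rightarrow> 's \<Rightarrow> 'b multiplier" where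
  "coc_adj B \<alpha> s t = mult_adj B (tdom \<alpha> s \<inter> tdom \<alpha> (s * t)) (tcoc \<alpha> s t)"

locale twisted_partial_action = cstar_algebra B
  for B :: "'b cstar" (structure) +
  fixes \<alpha> :: "('s::inverse_semigroup, 'b) twisted_data"
  assumes ideals: "closed_ideal B (tdom \<alpha> s)"
    and act_iso: "star_iso (B\<lparr>car := tdom \<alpha> (sinv s)\<rparr>) (B\<lparr>car := tdom \<alpha> s\<rparr>) (tact \<alpha> s)"
    and cocycle_unitary: "tcoc \<alpha> s t \<in> unitary_multipliers B (tdom \<alpha> s \<inter> tdom \<alpha> (s * t))"
    and nondegenerate: "norm_dense B (lin_span B (\<Union>s. tdom \<alpha> s))"
    and act_dom: "tact \<alpha> r ` (tdom \<alpha> (sinv r) \<inter> tdom \<alpha> s) = tdom \<alpha> r \<inter> tdom \<alpha> (r * s)"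
    and act_act: "x \<in> tdom \<alpha> (sinv s) \<inter> tdom \<alpha> (sinv s * sinv r) \<Longrightarrow>
        tact \<alpha> r (tact \<alpha> s x) = rmult (coc_adj B \<alpha> r s) (lmult (tcoc \<alpha> r s) (tact \<alpha> (r * s) x))"
    and cocycle: "x \<in> tdom \<alpha> (sinv r) \<inter> tdom \<alpha> s \<inter> tdom \<alpha> (s * t) \<Longrightarrow>
        rmult (tcoc \<alpha> r (s * t)) (tact \<alpha> r (rmult (tcoc \<alpha> s t) x)) =
        rmult (tcoc \<alpha> (r * s) t) (rmult (tcoc \<alpha> r s) (tact \<alpha> r x))"
    and coc_idem: "\<lbrakk>e \<in> idem; f \<in> idem\<rbrakk> \<Longrightarrow> tcoc \<alpha> e f = mult_one (tdom \<alpha> (e * f))"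
    and coc_unit_right: "tcoc \<alpha> r (sinv r * r) = mult_one (tdom \<alpha> r)"
    and coc_unit_left: "tcoc \<alpha> (r * sinv r) r = mult_one (tdom \<alpha> r)"
    and coc_compat: "\<lbrakk>e \<in> idem; x \<in> tdom \<alpha> (sinv s * e)\<rbrakk> \<Longrightarrow>
        lmult (tcoc \<alpha> (sinv s) e) (lmult (tcoc \<alpha> (sinv s * e) s) x) = lmult (tcoc \<alpha> (sinv s) s) x"

text \<open>The twisted action of the expansion induced by a twisted partial action. The isomorphism for
  \<open>x\<close> is the composite of the partial maps \<open>\<beta>\<^bsub>ri\<^esub> \<beta>\<^bsub>ri\<^esub>\<^sup>-\<^sup>1\<close> and \<open>\<beta>\<^bsub>r\<^esub>\<close>; its values outside
  the domain of this composite are irrelevant. Products of ideals are intersections.\<close>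

definition act_pmap :: "('s::inverse_semigroup, 'b) twisted_data \<Rightarrow> 's \<Rightarrow> 'b \<rightharpoonup> 'b" where
  "act_pmap \<alpha> s b = (if b \<in> tdom \<alpha> (sinv s) then Some (tact \<alpha> s b) else None)"

definition act_inv :: "('s::inverse_semigroup, 'b) twisted_data \<Rightarrow> 's \<Rightarrow> 'b \<Rightarrow> 'b" where
  "act_inv \<alpha> s = inv_into (tdom \<alpha> (sinv s)) (tact \<alpha> s)"

definition act_inv_pmap :: "('s::inverse_semigroup, 'b) twisted_data \<Rightarrow> 's \<Rightarrow> 'b \<rightharpoonup> 'b" where
  "act_inv_pmap \<alpha> s b = (if b \<in> tdom \<alpha> s then Some (act_inv \<alpha> s b) else None)"

definition pr_dom :: "('g::inverse_semigroup, 'b) twisted_data \<Rightarrow> 'g pr \<Rightarrow> 'b set" where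
  "pr_dom \<alpha> x = (case normal_form x of (rs, r) \<Rightarrow> (\<Inter>s\<in>set rs. tdom \<alpha> s) \<inter> tdom \<alpha> r)"

definition pr_act_pmap :: "('g::inverse_semigroup, 'b) twisted_data \<Rightarrow> 'g pr \<Rightarrow> 'b \<rightharpoonup> 'b" where
  "pr_act_pmap \<alpha> x = (case normal_form x of (rs, r) \<Rightarrow>
     foldr (\<lambda>s m. act_pmap \<alpha> s \<circ>\<^sub>m act_inv_pmap \<alpha> s \<circ>\<^sub>m m) rs (act_pmap \<alpha> r))"

definition pr_action :: "('g::inverse_semigroup, 'b) twisted_data \<Rightarrow> ('g pr, 'b) twisted_data" where
  "pr_action \<alpha> =
     \<lparr>tdom = pr_dom \<alpha>,
      tact = (\<lambda>x b. the (pr_act_pmap \<alpha> x b)),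
      tcoc = (\<lambda>x y. mult_restrict (pr_dom \<alpha> (x * y))
                (tcoc \<alpha> (snd (normal_form x)) (snd (normal_form y))))\<rparr>"


section \<open>Fell bundles and their cross-sectional algebras\<close>

text \<open>The structure maps carry the indices of the fibers as explicit arguments, so elements of
  different fibers may be represented by the same term; \<open>fincl A t s\<close> is the inclusion
  of the fiber at \<open>s\<close> into the fiber at \<open>t\<close>.\<close>

record ('s, 'a) fell_data =
  fib :: "'s \<Rightarrow> 'a normed_sp"
  fmul :: "'s \<Rightarrow> 's \<Rightarrow> 'a \<Rightarrow> 'a \<Rightarrow> 'a"
  fadj :: "'s \<Rightarrow> 'a \<Rightarrow> 'a"
  fincl :: "'s \<Rightarrow> 's \<Rightarrow> 'a \<Rightarrow> 'a"

abbreviation fcar :: "('s, 'a) fell_data \<Rightarrow> 's \<Rightarrow> 'a set" where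
  "fcar A s \<equiv> car (fib A s)"

text \<open>The axioms on this data. The constructions below are formulated for arbitrary data.\<close>

locale fell_bundle =
  fixes A :: "('s::inverse_semigroup, 'a) fell_data"
  assumes fib_banach: "complex_banach (fib A s)"
    and fmul_linear_right: "a \<in> fcar A s \<Longrightarrow> lin_map (fib A t) (fib A (s * t)) (\<lambda>b. fmul A s t a b)"
    and fmul_linear_left: "b \<in> fcar A t \<Longrightarrow> lin_map (fib A s) (fib A (s * t)) (\<lambda>a. fmul A s t a b)"
    and fadj_closed: "a \<in> fcar A s \<Longrightarrow> fadj A s a \<in> fcar A (sinv s)"
    and fadj_add: "\<lbrakk>a \<in> fcar A s; b \<in> fcar A s\<rbrakk> \<Longrightarrow>
        fadj A s (a \<oplus>\<^bsub>fib A s\<^esub> b) = fadj A s a \<oplus>\<^bsub>fib A (sinv s)\<^esub> fadj A s b"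
    and fadj_scal: "a \<in> fcar A s \<Longrightarrow>
        fadj A s (c \<odot>\<^bsub>fib A s\<^esub> a) = cnj c \<odot>\<^bsub>fib A (sinv s)\<^esub> fadj A s a"
    and fadj_norm: "a \<in> fcar A s \<Longrightarrow> \<parallel>fadj A s a\<parallel>\<^bsub>fib A (sinv s)\<^esub> = \<parallel>a\<parallel>\<^bsub>fib A s\<^esub>"
    and fincl_linear: "nat_le s t \<Longrightarrow> lin_map (fib A s) (fib A t) (fincl A t s)"
    and fincl_norm: "\<lbrakk>nat_le s t; a \<in> fcar A s\<rbrakk> \<Longrightarrow> \<parallel>fincl A t s a\<parallel>\<^bsub>fib A t\<^esub> = \<parallel>a\<parallel>\<^bsub>fib A s\<^esub>"
    and fmul_assoc: "\<lbrakk>a \<in> fcar A r; b \<in> fcar A s; d \<in> fcar A t\<rbrakk> \<Longrightarrow>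
        fmul A (r * s) t (fmul A r s a b) d = fmul A r (s * t) a (fmul A s t b d)"
    and fadj_mul: "\<lbrakk>a \<in> fcar A s; b \<in> fcar A t\<rbrakk> \<Longrightarrow>
        fadj A (s * t) (fmul A s t a b) = fmul A (sinv t) (sinv s) (fadj A t b) (fadj A s a)"
    and fadj_fadj: "a \<in> fcar A s \<Longrightarrow> fadj A (sinv s) (fadj A s a) = a"
    and fmul_norm: "\<lbrakk>a \<in> fcar A s; b \<in> fcar A t\<rbrakk> \<Longrightarrow>
        \<parallel>fmul A s t a b\<parallel>\<^bsub>fib A (s * t)\<^esub> \<le> \<parallel>a\<parallel>\<^bsub>fib A s\<^esub> * \<parallel>b\<parallel>\<^bsub>fib A t\<^esub>"
    and fcstar_identity: "a \<in> fcar A s \<Longrightarrow>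
        \<parallel>fmul A (sinv s) s (fadj A s a) a\<parallel>\<^bsub>fib A (sinv s * s)\<^esub> = \<parallel>a\<parallel>\<^bsub>fib A s\<^esub>\<^sup>2"
    and fpositive: "a \<in> fcar A s \<Longrightarrow> \<exists>b \<in> fcar A (sinv s * s).
        fmul A (sinv s) s (fadj A s a) a =
        fmul A (sinv s * s) (sinv s * s) (fadj A (sinv s * s) b) b"
    and fincl_fincl: "\<lbrakk>nat_le r s; nat_le s t; a \<in> fcar A r\<rbrakk> \<Longrightarrow>
        fincl A t r a = fincl A t s (fincl A s r a)"
    and fincl_mul: "\<lbrakk>nat_le s s'; nat_le t t'; a \<in> fcar A s; b \<in> fcar A t\<rbrakk> \<Longrightarrow>
        fincl A (s' * t') (s * t) (fmul A s t a b) =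
        fmul A s' t' (fincl A s' s a) (fincl A t' t b)"
    and fincl_adj: "\<lbrakk>nat_le s t; a \<in> fcar A s\<rbrakk> \<Longrightarrow>
        fincl A (sinv t) (sinv s) (fadj A s a) = fadj A t (fincl A t s a)"

definition fell_rep ::
  "('s::inverse_semigroup, 'a) fell_data \<Rightarrow> 'c cstar \<Rightarrow> ('s \<Rightarrow> 'a \<Rightarrow> 'c) \<Rightarrow> bool" where
  "fell_rep A C \<pi> \<longleftrightarrow>
     (\<forall>s. lin_map (fib A s) C (\<pi> s)) \<and>
     (\<forall>s t. \<forall>a\<in>fcar A s. \<forall>b\<in>fcar A t. \<pi> s a \<otimes>\<^bsub>C\<^esub> \<pi> t b = \<pi> (s * t) (fmul A s t a b)) \<and>
     (\<forall>s. \<forall>a\<in>fcar A s. (\<pi> s a)\<^sup>\<star>\<^bsub>C\<^esub> = \<pi> (sinv s) (fadj A s a)) \<and>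
     (\<forall>s t. nat_le s t \<longrightarrow> (\<forall>a\<in>fcar A s. \<pi> t (fincl A t s a) = \<pi> s a))"

text \<open>\<open>C\<close>, with the representation \<open>\<iota>\<close>, is the universal \<open>C\<^sup>*\<close>-algebra for representations of \<open>A\<close>.
  The competing algebras \<open>D\<close> have their carriers in the same type \<open>'c\<close> as \<open>C\<close>. A \<open>C\<^sup>*\<close>-algebra
  generated by the image of a representation has at most as many elements as there are sequences
  of finitely supported sections of \<open>A\<close>, so if \<open>'c\<close> has at least this size there is no restriction on \<open>D\<close>, and
  a universal algebra exists.\<close>

definition full_cstar ::
  "('s::inverse_semigroup, 'a) fell_data \<Rightarrow> 'c cstar \<Rightarrow> ('s \<Rightarrow> 'a \<Rightarrow> 'c) \<Rightarrow> bool" where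
  "full_cstar A C \<iota> \<longleftrightarrow>
     cstar_algebra C \<and> fell_rep A C \<iota> \<and>
     (\<forall>(D :: 'c cstar) \<pi>. cstar_algebra D \<and> fell_rep A D \<pi> \<longrightarrow>
        (\<exists>!\<Phi>. \<Phi> \<in> extensional (car C) \<and> star_hom C D \<Phi> \<and>
           (\<forall>s. \<forall>a\<in>fcar A s. \<Phi> (\<iota> s a) = \<pi> s a)))"

definition idem_cstar ::
  "('s::inverse_semigroup, 'a) fell_data \<Rightarrow> 'c cstar \<Rightarrow> ('s \<Rightarrow> 'a \<Rightarrow> 'c) \<Rightarrow> 'c cstar" where
  "idem_cstar A C \<iota> = generated_cstar C (\<Union>e\<in>idem. \<iota> e ` fcar A e)"

definition positive_functional :: "'c cstar \<Rightarrow> ('c \<Rightarrow> complex) \<Rightarrow> bool" where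
  "positive_functional C \<phi> \<longleftrightarrow>
     (\<forall>x\<in>car C. \<forall>y\<in>car C. \<phi> (x \<oplus>\<^bsub>C\<^esub> y) = \<phi> x + \<phi> y) \<and>
     (\<forall>c. \<forall>x\<in>car C. \<phi> (c \<odot>\<^bsub>C\<^esub> x) = c * \<phi> x) \<and>
     (\<forall>x\<in>car C. \<phi> (x\<^sup>\<star>\<^bsub>C\<^esub> \<otimes>\<^bsub>C\<^esub> x) \<in> \<real>\<^sub>\<ge>\<^sub>0)"

text \<open>Positive linear functionals of norm exactly one.\<close>

definition state :: "'c cstar \<Rightarrow> ('c \<Rightarrow> complex) \<Rightarrow> bool" where
  "state C \<phi> \<longleftrightarrow>
     positive_functional C \<phi> \<and>
     (\<forall>x\<in>car C. cmod (\<phi> x) \<le> \<parallel>x\<parallel>\<^bsub>C\<^esub>) \<and>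
     (\<forall>K. (\<forall>x\<in>car C. cmod (\<phi> x) \<le> K * \<parallel>x\<parallel>\<^bsub>C\<^esub>) \<longrightarrow> 1 \<le> K)"

definition pure_state :: "'c cstar \<Rightarrow> ('c \<Rightarrow> complex) \<Rightarrow> bool" where
  "pure_state C \<phi> \<longleftrightarrow>
     state C \<phi> \<and>
     (\<forall>\<rho>. positive_functional C \<rho> \<and> positive_functional C (\<lambda>x. \<phi> x - \<rho> x) \<longrightarrow>
        (\<exists>t\<in>{0..1::real}. \<forall>x\<in>car C. \<rho> x = of_real t * \<phi> x))"

text \<open>A contractive two-sided approximate unit of the fiber at the idempotent \<open>e\<close>. A net
  \<open>(u\<^sub>i)\<close> in the fiber enters through the filter of its tails, and limits along the net
  are limits along this filter.\<close>

definition approximate_unit ::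
  "('s::inverse_semigroup, 'a) fell_data \<Rightarrow> 's \<Rightarrow> 'a filter \<Rightarrow> bool" where
  "approximate_unit A e F \<longleftrightarrow>
     F \<noteq> bot \<and> (\<forall>\<^sub>F u in F. u \<in> fcar A e \<and> \<parallel>u\<parallel>\<^bsub>fib A e\<^esub> \<le> 1) \<and>
     (\<forall>a\<in>fcar A e. ((\<lambda>u. vdist (fib A e) (fmul A e e a u) a) \<longlongrightarrow> 0) F \<and>
                  ((\<lambda>u. vdist (fib A e) (fmul A e e u a) a) \<longlongrightarrow> 0) F)"

text \<open>\<open>\<psi>\<close> is the state \<open>\<phi>~\<close> of the cross-sectional algebra determined by the pure state \<open>\<phi>\<close> of the
  subalgebra generated by the fibers over idempotents. Here \<open>s * e = e\<close>, as \<open>e \<le> s\<close>.\<close>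

definition nonzero_on_fiber ::
  "('s::inverse_semigroup, 'a) fell_data \<Rightarrow> ('s \<Rightarrow> 'a \<Rightarrow> 'c) \<Rightarrow> ('c \<Rightarrow> complex) \<Rightarrow> 's \<Rightarrow> bool" where
  "nonzero_on_fiber A \<iota> \<phi> e \<longleftrightarrow> (\<exists>b\<in>fcar A e. \<phi> (\<iota> e b) \<noteq> 0)"

definition tilde_state :: "('s::inverse_semigroup, 'a) fell_data \<Rightarrow> 'c cstar \<Rightarrow>
    ('s \<Rightarrow> 'a \<Rightarrow> 'c) \<Rightarrow> ('c \<Rightarrow> complex) \<Rightarrow> ('c \<Rightarrow> complex) \<Rightarrow> bool" where
  "tilde_state A C \<iota> \<phi> \<psi> \<longleftrightarrow>
     state C \<psi> \<and>
     (\<forall>s. \<forall>a\<in>fcar A s.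
        (\<forall>e\<in>idem. \<forall>F. nat_le e s \<and> nonzero_on_fiber A \<iota> \<phi> e \<and> approximate_unit A e F \<longrightarrow>
           ((\<lambda>u. \<phi> (\<iota> (s * e) (fmul A s e a u))) \<longlongrightarrow> \<psi> (\<iota> s a)) F) \<and>
        ((\<nexists>e. e \<in> idem \<and> nat_le e s \<and> nonzero_on_fiber A \<iota> \<phi> e) \<longrightarrow> \<psi> (\<iota> s a) = 0))"

text \<open>The GNS representation of \<open>\<psi>\<close> acts on the completion of \<open>C / gns_null C \<psi>\<close>, the operator
  of \<open>x\<close> being induced by \<open>y \<mapsto> x y\<close>; it vanishes if and only if it vanishes on the classes
  of all \<open>y\<close> in \<open>C\<close>, which are dense.\<close>

definition gns_null :: "'c cstar \<Rightarrow> ('c \<Rightarrow> complex) \<Rightarrow> 'c set" where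
  "gns_null C \<psi> = {y \<in> car C. \<psi> (y\<^sup>\<star>\<^bsub>C\<^esub> \<otimes>\<^bsub>C\<^esub> y) = 0}"

definition gns_kernel :: "'c cstar \<Rightarrow> ('c \<Rightarrow> complex) \<Rightarrow> 'c set" where
  "gns_kernel C \<psi> = {x \<in> car C. \<forall>y\<in>car C. x \<otimes>\<^bsub>C\<^esub> y \<in> gns_null C \<psi>}"

definition reduced_cstar ::
  "('s::inverse_semigroup, 'a) fell_data \<Rightarrow> 'c cstar \<Rightarrow> ('s \<Rightarrow> 'a \<Rightarrow> 'c) \<Rightarrow> 'c set cstar" where
  "reduced_cstar A C \<iota> = cstar_quotient C
     {x \<in> car C. \<forall>\<phi> \<psi>. pure_state (idem_cstar A C \<iota>) \<phi> \<and> tilde_state A C \<iota> \<phi> \<psi> \<longrightarrow>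
        x \<in> gns_kernel C \<psi>}"


section \<open>Crossed products\<close>

text \<open>The Fell bundle of a twisted partial action, \<open>a \<delta>\<^sub>s\<close> being represented by \<open>a\<close> in the fiber
  at \<open>s\<close>.\<close>

definition twisted_bundle ::
  "'b cstar \<Rightarrow> ('s::inverse_semigroup, 'b) twisted_data \<Rightarrow> ('s, 'b) fell_data" where
  "twisted_bundle B \<alpha> =
     \<lparr>fib = (\<lambda>s. \<lparr>car = tdom \<alpha> s, zer = zer B, add = add B, scal = scal B, nrm = nrm B\<rparr>),
      fmul = (\<lambda>s t a b. rmult (tcoc \<alpha> s t) (tact \<alpha> s (act_inv \<alpha> s a \<otimes>\<^bsub>B\<^esub> b))),
      fadj = (\<lambda>s a. rmult (coc_adj B \<alpha> (sinv s) s) (act_inv \<alpha> s (a\<^sup>\<star>\<^bsub>B\<^esub>))),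
      fincl = (\<lambda>t s a. rmult (coc_adj B \<alpha> t (sinv s * s)) a)\<rparr>"

definition full_crossed_product ::
  "'b cstar \<Rightarrow> ('s::inverse_semigroup, 'b) twisted_data \<Rightarrow> 'c cstar \<Rightarrow> ('s \<Rightarrow> 'b \<Rightarrow> 'c) \<Rightarrow> bool" where
  "full_crossed_product B \<alpha> C \<iota> \<longleftrightarrow> full_cstar (twisted_bundle B \<alpha>) C \<iota>"

definition reduced_crossed_product ::
  "'b cstar \<Rightarrow> ('s::inverse_semigroup, 'b) twisted_data \<Rightarrow> 'c cstar \<Rightarrow> ('s \<Rightarrow> 'b \<Rightarrow> 'c) \<Rightarrow> 'c set cstar" where
  "reduced_crossed_product B \<alpha> C \<iota> = reduced_cstar (twisted_bundle B \<alpha>) C \<iota>"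

end

theory Submission
  imports Defs
begin

text \<open>The homomorphism \<open>pr_deg\<close> from the expansion to \<open>G\<close> sends \<open>\<epsilon>\<^bsub>r1\<^esub> \<cdots> \<epsilon>\<^bsub>rn\<^esub> [r]\<close> to \<open>r\<close>, and \<open>x\<close> lies below
  \<open>[pr_deg x]\<close> for every \<open>x\<close>. The twisted action of the expansion is a restriction of the given twisted
  partial action along \<open>pr_deg\<close>: the fiber of its Fell bundle \<open>A'\<close> over \<open>x\<close> is a closed ideal of \<open>B\<close> inside the
  fiber of \<open>A\<close> over \<open>pr_deg x\<close>, and the multiplication, the involution and the inclusions of \<open>A'\<close> are
  restrictions of those of \<open>A\<close> (\<open>fmul_restrict\<close>, \<open>fadj_restrict\<close>, \<open>fincl_restrict\<close>). So a representation
  \<open>\<pi>\<close> of \<open>A\<close> gives the representation \<open>x \<mapsto> \<pi> (pr_deg x)\<close> of \<open>A'\<close>. Conversely, a representation \<open>\<pi>'\<close> of \<open>A'\<close>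
  gives the representation \<open>s \<mapsto> \<pi>' [s]\<close> of \<open>A\<close>, because the fiber over \<open>[s]\<close> is all of \<open>D s\<close> and because \<open>\<pi>' x\<close>
  agrees with \<open>\<pi>' [pr_deg x]\<close> on the fiber over \<open>x\<close>. These two assignments are inverse to each
  other, and the universal properties turn them into inverse isomorphisms of the full crossed
  products (\<open>full_equivalence\<close>).

  The isomorphism matches the subalgebras generated by the fibers over idempotents. The reduced
  crossed products are quotients by ideals that are defined through extensions of pure states of
  these subalgebras. It remains to see that the two Fell bundles extend a pure state \<open>\<phi>\<close> in the same
  way. For \<open>G\<close> the extension is a limit along approximate units of the fibers \<open>D e\<close>, for the
  expansion it is a limit along approximate units of ideals of \<open>D e\<close>. The key fact is
  \<open>pure_ideal_unit\<close>: if \<open>\<phi>\<close> is pure and does not vanish on an ideal, then \<open>\<phi> (x v)\<close> tends to \<open>\<phi> x\<close> along every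
  contractive approximate unit \<open>v\<close> of the ideal, uniformly for bounded \<open>x\<close>. Hence both limits agree
  (\<open>tilde_limit\<close>). In the other direction, an idempotent \<open>e\<close> below \<open>s\<close> lifts to the idempotent \<open>[s] [e]\<close> below
  \<open>[s]\<close>, whose fiber is all of \<open>D e\<close> (\<open>tilde_state_descend\<close>).

  The facts about \<open>C\<^sup>*\<close>-algebras that enter are that \<open>*\<close>-homomorphisms are contractive, that contractive
  approximate units exist, and that closed ideals are self-adjoint and stable under multipliers of
  larger ideals. They are derived without spectral theory, from the observation that a self-adjoint
  \<open>h\<close> of norm less than one is the real part of the unitary \<open>h + \<i> \<surd>(1 - h\<^sup>2)\<close> (\<open>norm_unitary_op\<close>), where the
  square root comes from a fixed point iteration (\<open>sqrt_witness\<close>).\<close>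

section \<open>Calculus in normed spaces with explicit carriers\<close>

context complex_banach
begin

definition vsub :: "'a \<Rightarrow> 'a \<Rightarrow> 'a" (infixl \<open>\<ominus>\<close> 65) where
  "x \<ominus> y = x \<oplus> (- 1) \<odot> y"

lemma zero_scal: "x \<in> car V \<Longrightarrow> 0 \<odot> x = \<zero>"
  using norm_scal[of x 0] norm_zero_iff[of "0 \<odot> x"] scal_closed by simp

lemma scal_zero: "c \<odot> \<zero> = \<zero>"
  using norm_scal[of \<zero> c] norm_zero_iff[of "c \<odot> \<zero>"] norm_zero_iff[of \<zero>] scal_closed zero_closed
  by simp

lemma norm_zero: "\<parallel>\<zero>\<parallel> = 0"
  using norm_zero_iff zero_closed by simp

lemma vsub_closed: "\<lbrakk>x \<in> car V; y \<in> car V\<rbrakk> \<Longrightarrow> x \<ominus> y \<in> car V"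
  by (simp add: vsub_def add_closed scal_closed)

lemma vdist_vsub: "vdist V x y = \<parallel>x \<ominus> y\<parallel>"
  by (simp add: vdist_def vsub_def)

lemma norm_nonneg: assumes "x \<in> car V" shows "0 \<le> \<parallel>x\<parallel>"
proof -
  have "\<parallel>\<zero>\<parallel> \<le> \<parallel>x\<parallel> + \<parallel>(- 1) \<odot> x\<parallel>"
    using norm_triangle[OF assms scal_closed[OF assms, of "- 1"]] add_neg[OF assms] by simp
  thus ?thesis using norm_scal[OF assms, of "- 1"] by (simp add: norm_zero)
qed

lemmas closeds = add_closed scal_closed zero_closed vsub_closed

lemma add_left_commute:
  "\<lbrakk>x \<in> car V; y \<in> car V; z \<in> car V\<rbrakk> \<Longrightarrow> x \<oplus> (y \<oplus> z) = y \<oplus> (x \<oplus> z)"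
  by (metis add_assoc add_commute)

text \<open>A linear identity between finitely many elements follows from the identities between the
  coefficients. The map \<open>e\<close> replaces the elements by coordinates, on which the simplifier can compute.\<close>

lemma coordinates:
  assumes "x \<in> car V" "y \<in> car V" "z \<in> car V" "w \<in> car V" "v \<in> car V"
  obtains e where
    "\<And>a b c d f a' b' c' d' f'. e a b c d f \<oplus> e a' b' c' d' f' = e (a + a') (b + b') (c + c') (d + d') (f + f')"
    "\<And>k a b c d f. k \<odot> e a b c d f = e (k * a) (k * b) (k * c) (k * d) (k * f)"
    "x = e 1 0 0 0 0" "y = e 0 1 0 0 0" "z = e 0 0 1 0 0" "w = e 0 0 0 1 0" "v = e 0 0 0 0 1" "\<zero> = e 0 0 0 0 0"
proof -
  define e where "e a b c d f = a \<odot> x \<oplus> (b \<odot> y \<oplus> (c \<odot> z \<oplus> (d \<odot> w \<oplus> f \<odot> v)))" for a b c d f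
  have z1: "\<zero> \<oplus> u = u" if "u \<in> car V" for u using that add_zero add_commute zero_closed by metis
  show thesis
  proof (rule that[of e])
    show "e a b c d f \<oplus> e a' b' c' d' f' = e (a + a') (b + b') (c + c') (d + d') (f + f')" for a b c d f a' b' c' d' f'
      by (simp add: e_def scal_add_left assms closeds add_assoc add_commute add_left_commute)
    show "k \<odot> e a b c d f = e (k * a) (k * b) (k * c) (k * d) (k * f)" for k a b c d f
      by (simp add: e_def scal_add_right assms closeds scal_scal)
    show "x = e 1 0 0 0 0" "y = e 0 1 0 0 0" "z = e 0 0 1 0 0" "w = e 0 0 0 1 0" "v = e 0 0 0 0 1" "\<zero> = e 0 0 0 0 0"
      by (simp_all add: e_def zero_scal scal_one add_zero z1 assms closeds)
  qed
qed

lemma vsub_eq_zero_iff: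
  assumes "x \<in> car V" "y \<in> car V"
  shows "x \<ominus> y = \<zero> \<longleftrightarrow> x = y"
proof
  assume 0: "x \<ominus> y = \<zero>"
  have "x = (x \<ominus> y) \<oplus> y"
    by (rule coordinates[OF assms assms assms(1)]) (simp add: vsub_def)
  also have "\<dots> = \<zero> \<oplus> y" by (simp only: 0)
  also have "\<dots> = y" using assms add_commute add_zero zero_closed by metis
  finally show "x = y" .
qed (simp add: vsub_def add_neg assms)

lemma norm_vsub_commute:
  assumes "x \<in> car V" "y \<in> car V"
  shows "\<parallel>x \<ominus> y\<parallel> = \<parallel>y \<ominus> x\<parallel>"
proof -
  have "x \<ominus> y = (- 1) \<odot> (y \<ominus> x)"
    by (rule coordinates[OF assms assms assms(1)]) (simp add: vsub_def)
  thus ?thesis using norm_scal[OF vsub_closed[OF assms(2,1)], of "- 1"] by simp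
qed

lemma norm_vsub_triangle:
  assumes "x \<in> car V" "y \<in> car V" "z \<in> car V"
  shows "\<parallel>x \<ominus> z\<parallel> \<le> \<parallel>x \<ominus> y\<parallel> + \<parallel>y \<ominus> z\<parallel>"
proof -
  have "x \<ominus> z = (x \<ominus> y) \<oplus> (y \<ominus> z)"
    by (rule coordinates[OF assms assms(1,2)]) (simp add: vsub_def)
  thus ?thesis using norm_triangle[of "x \<ominus> y" "y \<ominus> z"] assms vsub_closed by simp
qed

lemma norm_vsub_le:
  assumes "x \<in> car V" "y \<in> car V"
  shows "\<parallel>x \<ominus> y\<parallel> \<le> \<parallel>x\<parallel> + \<parallel>y\<parallel>"
  using norm_triangle[OF assms(1) scal_closed[OF assms(2), of "- 1"]] norm_scal[OF assms(2), of "- 1"]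
  by (simp add: vsub_def)

lemma eq_if_norm_small:
  assumes "x \<in> car V" "y \<in> car V" "\<And>\<epsilon>. \<epsilon> > 0 \<Longrightarrow> \<parallel>x \<ominus> y\<parallel> \<le> \<epsilon>"
  shows "x = y"
proof -
  have "\<parallel>x \<ominus> y\<parallel> \<le> 0" by (rule field_le_epsilon) (simp add: assms(3))
  hence "\<parallel>x \<ominus> y\<parallel> = 0" using norm_nonneg[OF vsub_closed[OF assms(1,2)]] by simp
  thus ?thesis using vsub_eq_zero_iff[OF assms(1,2)] norm_zero_iff[OF vsub_closed[OF assms(1,2)]] by simp
qed

lemma geometric_convergence:
  assumes X: "\<And>n. X n \<in> car V" and \<rho>: "0 \<le> \<rho>" "\<rho> < 1"
    and step: "\<And>n. \<parallel>X (Suc n) \<ominus> X n\<parallel> \<le> \<rho> ^ n"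
  shows "\<exists>x\<in>car V. (\<lambda>n. \<parallel>X n \<ominus> x\<parallel>) \<longlonglongrightarrow> 0"
proof -
  have 1: "\<parallel>X (n + k) \<ominus> X n\<parallel> \<le> \<rho> ^ n * (1 - \<rho> ^ k) / (1 - \<rho>)" for n k
  proof (induction k)
    case 0
    show ?case using vsub_eq_zero_iff[OF X X, of n n] by (simp add: norm_zero)
  next
    case (Suc k)
    have "\<parallel>X (n + Suc k) \<ominus> X n\<parallel> \<le> \<parallel>X (Suc (n + k)) \<ominus> X (n + k)\<parallel> + \<parallel>X (n + k) \<ominus> X n\<parallel>"
      using norm_vsub_triangle X by simp
    also have "\<dots> \<le> \<rho> ^ (n + k) + \<rho> ^ n * (1 - \<rho> ^ k) / (1 - \<rho>)" using step Suc by (rule add_mono)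
    also have "\<dots> = \<rho> ^ n * (1 - \<rho> ^ Suc k) / (1 - \<rho>)"
      using \<rho> by (simp add: field_simps power_add)
    finally show ?case .
  qed
  have 2: "\<parallel>X (n + k) \<ominus> X n\<parallel> \<le> \<rho> ^ n / (1 - \<rho>)" for n k
  proof -
    have "\<rho> ^ n * (1 - \<rho> ^ k) \<le> \<rho> ^ n" using \<rho> by (simp add: mult_left_le)
    hence "\<rho> ^ n * (1 - \<rho> ^ k) / (1 - \<rho>) \<le> \<rho> ^ n / (1 - \<rho>)" using \<rho> by (simp add: divide_right_mono)
    thus ?thesis using 1 order_trans by blast
  qed
  have "\<exists>N. \<forall>m\<ge>N. \<forall>n\<ge>N. vdist V (X m) (X n) < \<epsilon>" if "\<epsilon> > 0" for \<epsilon>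
  proof -
    have "(\<lambda>n. \<rho> ^ n / (1 - \<rho>)) \<longlonglongrightarrow> 0"
      using LIMSEQ_power_zero[of \<rho>] \<rho> by (auto intro: tendsto_divide_zero)
    hence "\<forall>\<^sub>F n in sequentially. \<rho> ^ n / (1 - \<rho>) < \<epsilon> / 2"
      using that by (intro order_tendstoD(2)) auto
    then obtain N where N: "\<rho> ^ N / (1 - \<rho>) < \<epsilon> / 2" by (auto simp: eventually_sequentially)
    have 3: "\<parallel>X m \<ominus> X N\<parallel> < \<epsilon> / 2" if "m \<ge> N" for m
      using order_le_less_trans[OF 2[of N "m - N"] N] that by simp
    have "vdist V (X m) (X n) < \<epsilon>" if "m \<ge> N" "n \<ge> N" for m n
      using 3[OF that(1)] 3[OF that(2)] norm_vsub_triangle[OF X[of m] X[of N] X[of n]] norm_vsub_commute[OF X[of N] X[of n]]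
      by (simp add: vdist_vsub)
    thus ?thesis by blast
  qed
  hence "\<exists>x\<in>car V. (\<lambda>n. vdist V (X n) x) \<longlonglongrightarrow> 0" by (intro complete X)
  thus ?thesis by (simp add: vdist_vsub)
qed

lemma limit_unique:
  assumes "F \<noteq> bot" "\<forall>\<^sub>F u in F. X u \<in> car V" "x \<in> car V" "y \<in> car V"
    "((\<lambda>u. \<parallel>X u \<ominus> x\<parallel>) \<longlongrightarrow> 0) F" "((\<lambda>u. \<parallel>X u \<ominus> y\<parallel>) \<longlongrightarrow> 0) F"
  shows "x = y"
proof (rule eq_if_norm_small[OF assms(3,4)])
  fix \<epsilon> :: real assume "\<epsilon> > 0"
  hence "\<forall>\<^sub>F u in F. X u \<in> car V \<and> \<parallel>X u \<ominus> x\<parallel> < \<epsilon> / 2 \<and> \<parallel>X u \<ominus> y\<parallel> < \<epsilon> / 2"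
    using order_tendstoD(2)[OF assms(5), of "\<epsilon>/2"] order_tendstoD(2)[OF assms(6), of "\<epsilon>/2"] assms(2)
    by (simp add: eventually_conj)
  then obtain u where "X u \<in> car V" "\<parallel>X u \<ominus> x\<parallel> < \<epsilon> / 2" "\<parallel>X u \<ominus> y\<parallel> < \<epsilon> / 2"
    using assms(1) eventually_happens by blast
  thus "\<parallel>x \<ominus> y\<parallel> \<le> \<epsilon>"
    using norm_vsub_triangle[OF assms(3) _ assms(4), of "X u"] norm_vsub_commute[of "X u" x] assms(3) by simp
qed

end

section \<open>Square roots and unitaries in \<open>C\<^sup>*\<close>-algebras\<close>

context cstar_algebra
begin

notation vsub (infixl \<open>\<ominus>\<close> 65)

lemmas ccloseds = closeds mul_closed adj_closed

lemma mul_zero: assumes "x \<in> car C" shows "x \<otimes> \<zero> = \<zero>" "\<zero> \<otimes> x = \<zero>"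
  using mul_scal_right[OF assms zero_closed, of 0] mul_scal_left[OF zero_closed assms, of 0] assms
  by (simp_all add: zero_scal ccloseds)

lemma mul_vsub:
  assumes "x \<in> car C" "y \<in> car C" "z \<in> car C"
  shows "x \<otimes> (y \<ominus> z) = x \<otimes> y \<ominus> x \<otimes> z" "(x \<ominus> y) \<otimes> z = x \<otimes> z \<ominus> y \<otimes> z"
  using assms by (simp_all add: vsub_def mul_add_right mul_add_left mul_scal_right mul_scal_left ccloseds)

lemma adj_vsub: "\<lbrakk>x \<in> car C; y \<in> car C\<rbrakk> \<Longrightarrow> (x \<ominus> y)\<^sup>\<star> = x\<^sup>\<star> \<ominus> y\<^sup>\<star>"
  by (simp add: vsub_def adj_add adj_scal ccloseds)

lemma norm_adj: assumes "x \<in> car C" shows "\<parallel>x\<^sup>\<star>\<parallel> = \<parallel>x\<parallel>"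
proof -
  have le: "\<parallel>x\<parallel> \<le> \<parallel>x\<^sup>\<star>\<parallel>" if x: "x \<in> car C" for x
  proof (cases "\<parallel>x\<parallel> = 0")
    case False
    have "\<parallel>x\<parallel> * \<parallel>x\<parallel> \<le> \<parallel>x\<^sup>\<star>\<parallel> * \<parallel>x\<parallel>"
      using cstar_identity[OF x] norm_mul[of "x\<^sup>\<star>" x] x adj_closed by (simp add: power2_eq_square)
    thus ?thesis using False norm_nonneg[OF x] by simp
  qed (simp add: norm_nonneg adj_closed x)
  show ?thesis using le[OF assms] le[OF adj_closed[OF assms]] adj_adj[OF assms] by simp
qed

lemma norm_mul_adj: "x \<in> car C \<Longrightarrow> \<parallel>x \<otimes> x\<^sup>\<star>\<parallel> = \<parallel>x\<parallel>\<^sup>2"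
  using cstar_identity[of "x\<^sup>\<star>"] by (simp add: adj_closed adj_adj norm_adj)

text \<open>Testing on \<open>z = x\<^sup>\<star>\<close> shows that an element has the norm of the left multiplication by it.\<close>

lemma norm_le_if_mul_le:
  assumes x: "x \<in> car C" and "\<And>z. z \<in> car C \<Longrightarrow> \<parallel>x \<otimes> z\<parallel> \<le> c * \<parallel>z\<parallel>" and "0 \<le> c"
  shows "\<parallel>x\<parallel> \<le> c"
proof (cases "\<parallel>x\<parallel> = 0")
  case False
  have "\<parallel>x\<parallel> * \<parallel>x\<parallel> \<le> c * \<parallel>x\<parallel>"
    using assms(2)[OF adj_closed[OF x]] norm_mul_adj[OF x] by (simp add: norm_adj x power2_eq_square)
  thus ?thesis using False norm_nonneg[OF x] by simp
qed (simp add: assms)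

lemma limit_mul:
  assumes "\<forall>\<^sub>F u in F. X u \<in> car C" "x \<in> car C" "y \<in> car C" "((\<lambda>u. \<parallel>X u \<ominus> x\<parallel>) \<longlongrightarrow> 0) F"
  shows "((\<lambda>u. \<parallel>y \<otimes> X u \<ominus> y \<otimes> x\<parallel>) \<longlongrightarrow> 0) F" "((\<lambda>u. \<parallel>X u \<otimes> y \<ominus> x \<otimes> y\<parallel>) \<longlongrightarrow> 0) F"
proof -
  have 1: "((\<lambda>u. \<parallel>y\<parallel> * \<parallel>X u \<ominus> x\<parallel>) \<longlongrightarrow> 0) F" "((\<lambda>u. \<parallel>X u \<ominus> x\<parallel> * \<parallel>y\<parallel>) \<longlongrightarrow> 0) F"
    using assms(4) by (auto intro: tendsto_mult_right_zero tendsto_mult_left_zero)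
  show "((\<lambda>u. \<parallel>y \<otimes> X u \<ominus> y \<otimes> x\<parallel>) \<longlongrightarrow> 0) F"
    by (rule tendsto_sandwich[OF _ _ tendsto_const 1(1)])
      (use assms(1) in \<open>eventually_elim, use assms(2,3) norm_mul[of y] in
        \<open>simp add: mul_vsub[symmetric] norm_nonneg ccloseds\<close>\<close>)+
  show "((\<lambda>u. \<parallel>X u \<otimes> y \<ominus> x \<otimes> y\<parallel>) \<longlongrightarrow> 0) F"
    by (rule tendsto_sandwich[OF _ _ tendsto_const 1(2)])
      (use assms(1) in \<open>eventually_elim, use assms(2,3) norm_mul[of _ y] in
        \<open>simp add: mul_vsub[symmetric] norm_nonneg ccloseds\<close>\<close>)+
qed

definition selfadj :: "'a \<Rightarrow> bool" where
  "selfadj x \<longleftrightarrow> x \<in> car C \<and> x\<^sup>\<star> = x"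

lemma selfadj_mul_adj: "x \<in> car C \<Longrightarrow> selfadj (x \<otimes> x\<^sup>\<star>)" "x \<in> car C \<Longrightarrow> selfadj (x\<^sup>\<star> \<otimes> x)"
  by (simp_all add: selfadj_def adj_mul adj_adj ccloseds)

lemma selfadj_scal: "selfadj x \<Longrightarrow> selfadj (complex_of_real t \<odot> x)"
  by (simp add: selfadj_def adj_scal ccloseds)

lemma selfadj_square: "selfadj x \<Longrightarrow> selfadj (x \<otimes> x)"
  by (simp add: selfadj_def adj_mul ccloseds)


end

context cstar_algebra
begin
lemma norm_square_diff:
  assumes "x \<in> car C" "y \<in> car C"
  shows "\<parallel>y \<otimes> y \<ominus> x \<otimes> x\<parallel> \<le> (\<parallel>y\<parallel> + \<parallel>x\<parallel>) * \<parallel>y \<ominus> x\<parallel>"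
proof -
  have "y \<otimes> y \<ominus> x \<otimes> x = y \<otimes> (y \<ominus> x) \<oplus> (y \<ominus> x) \<otimes> x"
    unfolding mul_vsub[OF assms(2,2,1)] mul_vsub[OF assms(2,1,1)]
    by (rule coordinates[of "y \<otimes> y" "x \<otimes> x" "y \<otimes> x" "y \<otimes> x" "y \<otimes> x"])
      (use assms in \<open>simp_all add: ccloseds vsub_def\<close>)
  also have "\<parallel>\<dots>\<parallel> \<le> \<parallel>y\<parallel> * \<parallel>y \<ominus> x\<parallel> + \<parallel>y \<ominus> x\<parallel> * \<parallel>x\<parallel>"
    using assms norm_triangle[of "y \<otimes> (y \<ominus> x)" "(y \<ominus> x) \<otimes> x"] norm_mul[of y "y \<ominus> x"] norm_mul[of "y \<ominus> x" x]
    by (simp add: ccloseds)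
  finally show ?thesis by (simp add: algebra_simps)
qed

text \<open>The element \<open>m\<close> stands for \<open>1 - \<surd>(1 - b)\<close>, which makes sense without a unit: the equation says
  \<open>(1 - m)\<^sup>2 = 1 - b\<close>. The map \<open>m \<mapsto> (b + m\<^sup>2) / 2\<close> contracts the ball of radius \<open>\<parallel>b\<parallel> < 1\<close>, and its iterates on
  \<open>0\<close> are polynomials in \<open>b\<close>, so their limit is self-adjoint and commutes with whatever commutes with \<open>b\<close>.\<close>

lemma sqrt_witness:
  assumes b: "selfadj b" "\<parallel>b\<parallel> < 1"
  obtains m where "selfadj m" "2 \<odot> m = b \<oplus> m \<otimes> m"
    "\<And>h. \<lbrakk>h \<in> car C; h \<otimes> b = b \<otimes> h\<rbrakk> \<Longrightarrow> h \<otimes> m = m \<otimes> h"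
proof -
  define X where "X = rec_nat \<zero> (\<lambda>_ y. (1/2) \<odot> (b \<oplus> y \<otimes> y))"
  have X0: "X 0 = \<zero>" and XS: "X (Suc n) = (1/2) \<odot> (b \<oplus> X n \<otimes> X n)" for n
    by (simp_all add: X_def)
  have bC: "b \<in> car C" using b by (simp add: selfadj_def)
  have XC: "X n \<in> car C" for n by (induction n) (simp_all add: X0 XS ccloseds bC)
  have zs: "selfadj \<zero>" using adj_scal[OF zero_closed, of 0] zero_scal[OF adj_closed[OF zero_closed]]
    by (simp add: selfadj_def ccloseds scal_zero)
  have Xs: "selfadj (X n)" for n
    by (induction n) (use b zs in \<open>simp_all add: X0 XS selfadj_def ccloseds adj_scal adj_add adj_mul\<close>)
  define \<rho> where "\<rho> = \<parallel>b\<parallel>"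
  have \<rho>: "0 \<le> \<rho>" "\<rho> < 1" using b norm_nonneg[OF bC] by (simp_all add: \<rho>_def)
  have Xn: "\<parallel>X n\<parallel> \<le> \<rho>" for n
  proof (induction n)
    case (Suc n)
    have "\<parallel>X n\<parallel> * \<parallel>X n\<parallel> \<le> \<rho> * 1" using Suc norm_nonneg[OF XC[of n]] \<rho> by (intro mult_mono) auto
    moreover have "\<parallel>b \<oplus> X n \<otimes> X n\<parallel> \<le> \<rho> + \<parallel>X n\<parallel> * \<parallel>X n\<parallel>"
      using norm_triangle[OF bC mul_closed[OF XC XC], of n n] norm_mul[OF XC XC, of n n] by (simp add: \<rho>_def)
    ultimately show ?case by (simp add: XS norm_scal ccloseds XC bC)
  qed (simp add: X0 norm_zero \<rho>)
  have step: "\<parallel>X (Suc n) \<ominus> X n\<parallel> \<le> \<rho> ^ n" for n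
  proof (induction n)
    case 0
    show ?case using norm_vsub_le[OF XC XC, of 1 0] Xn[of 1] \<rho> by (simp add: X0 norm_zero)
  next
    case (Suc n)
    have "X (Suc (Suc n)) \<ominus> X (Suc n) =
        (1/2) \<odot> (b \<oplus> X (Suc n) \<otimes> X (Suc n)) \<ominus> (1/2) \<odot> (b \<oplus> X n \<otimes> X n)"
      by (simp only: XS)
    also have "\<dots> = (1/2) \<odot> (X (Suc n) \<otimes> X (Suc n) \<ominus> X n \<otimes> X n)"
      by (rule coordinates[of "X (Suc n) \<otimes> X (Suc n)" "X n \<otimes> X n" b b b])
        (simp_all add: ccloseds XC bC vsub_def)
    finally have "X (Suc (Suc n)) \<ominus> X (Suc n) = (1/2) \<odot> (X (Suc n) \<otimes> X (Suc n) \<ominus> X n \<otimes> X n)" .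
    hence "\<parallel>X (Suc (Suc n)) \<ominus> X (Suc n)\<parallel> \<le> 1/2 * ((\<parallel>X (Suc n)\<parallel> + \<parallel>X n\<parallel>) * \<parallel>X (Suc n) \<ominus> X n\<parallel>)"
      using norm_square_diff[OF XC XC, of "Suc n" n] by (simp add: norm_scal ccloseds XC)
    also have "\<dots> \<le> 1/2 * ((\<rho> + \<rho>) * \<rho> ^ n)"
      using Xn Suc norm_nonneg XC \<rho> by (intro mult_left_mono mult_mono add_mono) (auto simp: ccloseds)
    finally show ?case by simp
  qed
  obtain m where m: "m \<in> car C" and lim: "(\<lambda>n. \<parallel>X n \<ominus> m\<parallel>) \<longlonglongrightarrow> 0"
    using geometric_convergence[OF XC \<rho> step] by blast
  have lim': "(\<lambda>n. \<parallel>X (Suc n) \<ominus> m\<parallel>) \<longlonglongrightarrow> 0" using lim by (rule LIMSEQ_Suc)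
  have ms: "m\<^sup>\<star> = m"
  proof (rule limit_unique[OF _ _ _ m _ lim])
    have "\<parallel>X n \<ominus> m\<^sup>\<star>\<parallel> = \<parallel>X n \<ominus> m\<parallel>" for n
      using norm_adj[OF vsub_closed[OF XC m], of n] Xs[of n] by (simp add: adj_vsub XC m selfadj_def)
    thus "(\<lambda>n. \<parallel>X n \<ominus> m\<^sup>\<star>\<parallel>) \<longlonglongrightarrow> 0" using lim by simp
  qed (use m XC in \<open>auto simp: ccloseds\<close>)
  have me: "m = (1/2) \<odot> (b \<oplus> m \<otimes> m)"
  proof (rule limit_unique[OF _ _ m _ lim'])
    have "\<parallel>X (Suc n) \<ominus> (1/2) \<odot> (b \<oplus> m \<otimes> m)\<parallel> \<le> (\<rho> + \<parallel>m\<parallel>) * \<parallel>X n \<ominus> m\<parallel>" for n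
    proof -
      have "X (Suc n) \<ominus> (1/2) \<odot> (b \<oplus> m \<otimes> m) = (1/2) \<odot> (X n \<otimes> X n \<ominus> m \<otimes> m)"
        unfolding XS by (rule coordinates[of "X n \<otimes> X n" "m \<otimes> m" b b b])
          (simp_all add: ccloseds XC bC m vsub_def)
      hence "\<parallel>X (Suc n) \<ominus> (1/2) \<odot> (b \<oplus> m \<otimes> m)\<parallel> \<le> (\<parallel>X n\<parallel> + \<parallel>m\<parallel>) * \<parallel>X n \<ominus> m\<parallel>"
        using norm_square_diff[OF m XC, of n] norm_nonneg[OF vsub_closed[OF mul_closed[OF XC XC] mul_closed[OF m m]], of n n]
        by (simp add: norm_scal ccloseds XC m)
      also have "\<dots> \<le> (\<rho> + \<parallel>m\<parallel>) * \<parallel>X n \<ominus> m\<parallel>"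
        using Xn[of n] by (intro mult_right_mono norm_nonneg vsub_closed XC m) simp
      finally show ?thesis .
    qed
    moreover have "(\<lambda>n. (\<rho> + \<parallel>m\<parallel>) * \<parallel>X n \<ominus> m\<parallel>) \<longlonglongrightarrow> 0" using lim by (rule tendsto_mult_right_zero)
    ultimately show "(\<lambda>n. \<parallel>X (Suc n) \<ominus> (1/2) \<odot> (b \<oplus> m \<otimes> m)\<parallel>) \<longlonglongrightarrow> 0"
      by (intro Lim_null_comparison[of "\<lambda>n. \<parallel>X (Suc n) \<ominus> (1/2) \<odot> (b \<oplus> m \<otimes> m)\<parallel>"])
        (auto intro!: always_eventually simp: norm_nonneg ccloseds XC m bC)
  qed (use m XC bC in \<open>auto simp: ccloseds\<close>)
  have mc: "h \<otimes> m = m \<otimes> h" if h: "h \<in> car C" "h \<otimes> b = b \<otimes> h" for h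
  proof -
    have hX: "h \<otimes> X n = X n \<otimes> h" for n
    proof (induction n)
      case (Suc n)
      have "h \<otimes> (X n \<otimes> X n) = (X n \<otimes> X n) \<otimes> h"
        by (metis Suc XC h(1) mul_assoc)
      thus ?case
        by (simp add: XS mul_scal_right mul_scal_left mul_add_right mul_add_left h ccloseds XC bC)
    qed (simp add: X0 mul_zero h)
    show ?thesis
      by (rule limit_unique[OF _ _ _ _ limit_mul(1)[OF _ m h(1) lim] limit_mul(2)[OF _ m h(1) lim, folded hX]])
        (simp_all add: XC m h ccloseds)
  qed
  show thesis
  proof (rule that[of m])
    show "2 \<odot> m = b \<oplus> m \<otimes> m"
      by (subst me) (simp add: scal_scal scal_one ccloseds bC m)
  qed (use m ms mc in \<open>simp_all add: selfadj_def\<close>)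
qed

end

context cstar_algebra
begin

text \<open>For \<open>\<sigma> = \<plusminus> \<i>\<close> and \<open>1 - m = \<surd>(1 - h\<^sup>2)\<close> this is left multiplication by the unitary \<open>h + \<sigma> \<surd>(1 - h\<^sup>2)\<close>. It is an operator
  on the algebra because there need not be a unit.\<close>

definition unitary_op :: "'a \<Rightarrow> 'a \<Rightarrow> complex \<Rightarrow> 'a \<Rightarrow> 'a" where
  "unitary_op h m \<sigma> z = h \<otimes> z \<oplus> \<sigma> \<odot> (z \<ominus> m \<otimes> z)"

context
  fixes h m
  assumes h: "selfadj h" and m: "selfadj m" and comm: "h \<otimes> m = m \<otimes> h"
    and sq: "2 \<odot> m = h \<otimes> h \<oplus> m \<otimes> m"
begin

lemma hm_closed: "h \<in> car C" "m \<in> car C"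
  using h m by (simp_all add: selfadj_def)

lemma comm': "z \<in> car C \<Longrightarrow> m \<otimes> (h \<otimes> z) = h \<otimes> (m \<otimes> z)"
  using comm hm_closed by (simp add: mul_assoc[symmetric])

lemma sq': assumes z: "z \<in> car C" shows "h \<otimes> (h \<otimes> z) = 2 \<odot> (m \<otimes> z) \<ominus> m \<otimes> (m \<otimes> z)"
proof -
  have eq: "2 \<odot> (m \<otimes> z) = h \<otimes> (h \<otimes> z) \<oplus> m \<otimes> (m \<otimes> z)"
    using arg_cong[OF sq, of "\<lambda>u. u \<otimes> z"] hm_closed z
    by (simp add: mul_scal_left mul_add_left mul_assoc ccloseds)
  show ?thesis
    unfolding eq
    by (rule coordinates[of "h \<otimes> (h \<otimes> z)" "m \<otimes> (m \<otimes> z)" "h \<otimes> z" "h \<otimes> z" "h \<otimes> z"])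
      (use hm_closed z in \<open>simp_all add: ccloseds vsub_def\<close>)
qed

lemma unitary_op_closed: "z \<in> car C \<Longrightarrow> unitary_op h m \<sigma> z \<in> car C"
  by (simp add: unitary_op_def ccloseds hm_closed)

text \<open>With \<open>k = 1 - m\<close>, which commutes with \<open>h\<close>, the cross terms of \<open>(h - \<sigma> k) (h + \<sigma> k)\<close> cancel and \<open>h\<^sup>2 + k\<^sup>2 = 1\<close>
  remains.\<close>

lemma norm_unitary_op:
  assumes \<sigma>: "\<sigma> = \<i> \<or> \<sigma> = - \<i>" and z: "z \<in> car C"
  shows "\<parallel>unitary_op h m \<sigma> z\<parallel> = \<parallel>z\<parallel>"
proof -
  have \<sigma>': "cnj \<sigma> = - \<sigma>" "\<sigma> * \<sigma> = - 1" "\<And>x. \<sigma> * (\<sigma> * x) = - x" using \<sigma> by auto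
  have hm': "h\<^sup>\<star> = h" "m\<^sup>\<star> = m" using h m by (simp_all add: selfadj_def)
  have "(unitary_op h m \<sigma> z)\<^sup>\<star> \<otimes> unitary_op h m \<sigma> z = z\<^sup>\<star> \<otimes> z"
    unfolding unitary_op_def
    by (rule coordinates[of "z\<^sup>\<star> \<otimes> (h \<otimes> z)" "z\<^sup>\<star> \<otimes> (h \<otimes> (m \<otimes> z))" "z\<^sup>\<star> \<otimes> z" "z\<^sup>\<star> \<otimes> (m \<otimes> z)" "z\<^sup>\<star> \<otimes> (m \<otimes> (m \<otimes> z))"])
     (simp_all add: ccloseds hm_closed z adj_add adj_vsub adj_scal adj_mul hm' mul_add_left mul_add_right
       mul_vsub mul_scal_left mul_scal_right mul_assoc comm' sq' vsub_def \<sigma>' algebra_simps)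
  hence "\<parallel>unitary_op h m \<sigma> z\<parallel>\<^sup>2 = \<parallel>z\<parallel>\<^sup>2"
    using cstar_identity[OF unitary_op_closed[OF z]] cstar_identity[OF z] by metis
  thus ?thesis using norm_nonneg z unitary_op_closed by (simp add: power2_eq_iff_nonneg)
qed

lemma unitary_op_square:
  assumes \<sigma>: "\<sigma> = \<i> \<or> \<sigma> = - \<i>" and z: "z \<in> car C"
  shows "unitary_op h m \<sigma> (unitary_op h m \<sigma> z) = 2 \<odot> (h \<otimes> unitary_op h m \<sigma> z) \<ominus> z"
proof -
  have \<sigma>': "\<sigma> * \<sigma> = - 1" "\<And>x. \<sigma> * (\<sigma> * x) = - x" using \<sigma> by auto
  show ?thesis
    unfolding unitary_op_def
    by (simp add: ccloseds hm_closed z mul_add_right mul_vsub mul_scal_right comm' sq',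
        rule coordinates[of z "h \<otimes> z" "m \<otimes> z" "h \<otimes> (m \<otimes> z)" "m \<otimes> (m \<otimes> z)"])
      (simp_all add: ccloseds hm_closed z vsub_def \<sigma>' algebra_simps)
qed

lemma unitary_op_sum:
  assumes z: "z \<in> car C"
  shows "unitary_op h m (- \<i>) z = 2 \<odot> (h \<otimes> z) \<ominus> unitary_op h m \<i> z"
  unfolding unitary_op_def
  by (rule coordinates[of z "h \<otimes> z" "m \<otimes> z" z z])
    (simp_all add: ccloseds hm_closed z vsub_def algebra_simps)

text \<open>If \<open>U = h + \<i> k\<close> and \<open>V = h - \<i> k\<close>, then the Chebyshev polynomials \<open>h\<close>, \<open>2 h\<^sup>2 - 1\<close> and \<open>4 h\<^sup>3 - 3 h\<close> are the means of \<open>U\<^sup>n\<close>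
  and \<open>V\<^sup>n\<close> for \<open>n = 1, 2, 3\<close>, hence contractions; and \<open>1 - h\<^sup>2\<close> is the mean of \<open>1\<close> and \<open>- (2 h\<^sup>2 - 1)\<close>.\<close>

lemma chebyshev_bounds:
  assumes z: "z \<in> car C"
  shows "\<parallel>h \<otimes> z\<parallel> \<le> \<parallel>z\<parallel>" "\<parallel>z \<ominus> h \<otimes> (h \<otimes> z)\<parallel> \<le> \<parallel>z\<parallel>"
    "\<parallel>3 \<odot> (h \<otimes> z) \<ominus> 4 \<odot> (h \<otimes> (h \<otimes> (h \<otimes> z)))\<parallel> \<le> \<parallel>z\<parallel>"
proof -
  define U where "U = unitary_op h m \<i>"
  define V where "V = unitary_op h m (- \<i>)"
  have c: "U x \<in> car C" "V x \<in> car C" "\<parallel>U x\<parallel> = \<parallel>x\<parallel>" "\<parallel>V x\<parallel> = \<parallel>x\<parallel>"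
    "U (U x) = 2 \<odot> (h \<otimes> U x) \<ominus> x" "V (V x) = 2 \<odot> (h \<otimes> V x) \<ominus> x" "V x = 2 \<odot> (h \<otimes> x) \<ominus> U x"
    if "x \<in> car C" for x
    unfolding U_def V_def using that
    by (auto intro!: unitary_op_closed norm_unitary_op unitary_op_square unitary_op_sum)
  have half: "\<parallel>(t / 2) \<odot> (x \<oplus> y)\<parallel> \<le> \<parallel>z\<parallel>"
    if "x \<in> car C" "y \<in> car C" "\<parallel>x\<parallel> = \<parallel>z\<parallel>" "\<parallel>y\<parallel> = \<parallel>z\<parallel>" "cmod t = 1" for x y t
    using norm_triangle[OF that(1,2)] that by (simp add: norm_scal ccloseds norm_divide)
  have "h \<otimes> z = (1 / 2) \<odot> (U z \<oplus> V z)"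
    unfolding c(7)[OF z]
    by (rule coordinates[of "h \<otimes> z" "U z" z z z]) (simp_all add: c ccloseds hm_closed z vsub_def)
  thus "\<parallel>h \<otimes> z\<parallel> \<le> \<parallel>z\<parallel>" using half[of "U z" "V z" 1] c z by simp
  have hV: "h \<otimes> V z = 2 \<odot> (h \<otimes> (h \<otimes> z)) \<ominus> h \<otimes> U z"
    by (simp add: c(7)[OF z] mul_vsub mul_scal_right ccloseds hm_closed z c(1))
  have 2: "(- 1 / 2) \<odot> (U (U z) \<oplus> V (V z)) = z \<ominus> 2 \<odot> (h \<otimes> (h \<otimes> z))"
    unfolding c(5,6)[OF z] hV
    by (rule coordinates[of "h \<otimes> U z" "h \<otimes> (h \<otimes> z)" z z z])
      (simp_all add: c ccloseds hm_closed z vsub_def)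
  have "\<parallel>z \<ominus> 2 \<odot> (h \<otimes> (h \<otimes> z))\<parallel> \<le> \<parallel>z\<parallel>"
    unfolding 2[symmetric] using half[of "U (U z)" "V (V z)" "-1"] c(1-4) z by simp
  moreover have "z \<ominus> h \<otimes> (h \<otimes> z) = (1 / 2) \<odot> (z \<oplus> (z \<ominus> 2 \<odot> (h \<otimes> (h \<otimes> z))))"
    by (rule coordinates[of z "h \<otimes> (h \<otimes> z)" z z z]) (simp_all add: ccloseds hm_closed z vsub_def)
  ultimately show "\<parallel>z \<ominus> h \<otimes> (h \<otimes> z)\<parallel> \<le> \<parallel>z\<parallel>"
    using norm_triangle[of z "z \<ominus> 2 \<odot> (h \<otimes> (h \<otimes> z))"]
    by (simp add: norm_scal ccloseds hm_closed z)
  have hUU: "h \<otimes> U (U z) = 2 \<odot> (h \<otimes> (h \<otimes> U z)) \<ominus> h \<otimes> z"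
    by (simp add: c(5)[OF z] mul_vsub mul_scal_right ccloseds hm_closed z c(1))
  have hVV: "h \<otimes> V (V z) = 4 \<odot> (h \<otimes> (h \<otimes> (h \<otimes> z))) \<ominus> 2 \<odot> (h \<otimes> (h \<otimes> U z)) \<ominus> h \<otimes> z"
    by (simp add: c(6)[OF z] hV mul_vsub mul_scal_right scal_scal ccloseds hm_closed z c(1),
        rule coordinates[of "h \<otimes> z" "h \<otimes> (h \<otimes> U z)" "h \<otimes> (h \<otimes> (h \<otimes> z))" z z])
      (simp_all add: c(1) ccloseds hm_closed z vsub_def)
  have "(- 1 / 2) \<odot> (U (U (U z)) \<oplus> V (V (V z))) = 3 \<odot> (h \<otimes> z) \<ominus> 4 \<odot> (h \<otimes> (h \<otimes> (h \<otimes> z)))"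
    unfolding c(5)[OF c(1)[OF z]] c(6)[OF c(2)[OF z]] unfolding hUU hVV unfolding c(7)[OF z]
    by (rule coordinates[of "h \<otimes> z" "U z" "h \<otimes> (h \<otimes> U z)" "h \<otimes> (h \<otimes> (h \<otimes> z))" "h \<otimes> z"])
      (simp_all add: c(1) ccloseds hm_closed z vsub_def)
  thus "\<parallel>3 \<odot> (h \<otimes> z) \<ominus> 4 \<odot> (h \<otimes> (h \<otimes> (h \<otimes> z)))\<parallel> \<le> \<parallel>z\<parallel>"
    using half[of "U (U (U z))" "V (V (V z))" "-1"] c(1-4) z by simp
qed

end

lemma contraction_bounds:
  assumes h: "selfadj h" "\<parallel>h\<parallel> < 1" and z: "z \<in> car C"
  shows "\<parallel>z \<ominus> h \<otimes> (h \<otimes> z)\<parallel> \<le> \<parallel>z\<parallel>"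
    "\<parallel>3 \<odot> (h \<otimes> z) \<ominus> 4 \<odot> (h \<otimes> (h \<otimes> (h \<otimes> z)))\<parallel> \<le> \<parallel>z\<parallel>"
proof -
  have hC: "h \<in> car C" using h by (simp add: selfadj_def)
  have "\<parallel>h \<otimes> h\<parallel> < 1"
    using cstar_identity[OF hC] h norm_nonneg[OF hC] by (simp add: selfadj_def abs_square_less_1)
  then obtain m where "selfadj m" "2 \<odot> m = h \<otimes> h \<oplus> m \<otimes> m" "h \<otimes> m = m \<otimes> h"
    using sqrt_witness[OF selfadj_square[OF h(1)]] mul_assoc[OF hC hC hC] hC by metis
  thus "\<parallel>z \<ominus> h \<otimes> (h \<otimes> z)\<parallel> \<le> \<parallel>z\<parallel>"
    "\<parallel>3 \<odot> (h \<otimes> z) \<ominus> 4 \<odot> (h \<otimes> (h \<otimes> (h \<otimes> z)))\<parallel> \<le> \<parallel>z\<parallel>"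
    using chebyshev_bounds h z by blast+
qed

text \<open>For \<open>\<parallel>h\<parallel> = 1\<close> the bound follows by letting \<open>\<rho>\<close> tend to \<open>1\<close> in the bound for \<open>\<rho> h\<close>.\<close>

lemma chebyshev_contraction:
  assumes h: "selfadj h" "\<parallel>h\<parallel> \<le> 1"
  shows "\<parallel>3 \<odot> h \<ominus> 4 \<odot> (h \<otimes> (h \<otimes> h))\<parallel> \<le> 1"
proof (rule norm_le_if_mul_le)
  have hC: "h \<in> car C" using h by (simp add: selfadj_def)
  show "3 \<odot> h \<ominus> 4 \<odot> (h \<otimes> (h \<otimes> h)) \<in> car C" by (simp add: hC ccloseds)
  fix z assume z: "z \<in> car C"
  define x where "x = h \<otimes> z"
  define y where "y = h \<otimes> (h \<otimes> (h \<otimes> z))"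
  have xy: "x \<in> car C" "y \<in> car C" by (simp_all add: x_def y_def ccloseds hC z)
  have le: "\<parallel>3 \<odot> x \<ominus> 4 \<odot> y\<parallel> \<le> \<parallel>z\<parallel> + (1 - \<rho>) * (3 * \<parallel>x\<parallel>) + (1 - \<rho> ^ 3) * (4 * \<parallel>y\<parallel>)"
    if \<rho>: "\<rho> \<in> {0<..<1}" for \<rho>
  proof -
    define w where "w = (3 * of_real \<rho>) \<odot> x \<ominus> (4 * of_real (\<rho> ^ 3)) \<odot> y"
    define g where "g = complex_of_real \<rho> \<odot> h"
    have wC: "w \<in> car C" by (simp add: w_def ccloseds xy)
    have gC: "g \<in> car C" by (simp add: g_def ccloseds hC)
    have "w = 3 \<odot> (g \<otimes> z) \<ominus> 4 \<odot> (g \<otimes> (g \<otimes> (g \<otimes> z)))"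
      by (simp add: w_def g_def x_def y_def mul_scal_left mul_scal_right scal_scal ccloseds hC z power3_eq_cube mult.assoc)
    moreover have "\<parallel>g\<parallel> < 1"
    proof -
      have "\<rho> * \<parallel>h\<parallel> \<le> \<rho> * 1" using \<rho> h by (intro mult_left_mono) auto
      also have "\<dots> < 1" using \<rho> by simp
      finally have "\<rho> * \<parallel>h\<parallel> < 1" .
        thus ?thesis using \<rho> by (simp add: g_def norm_scal hC)
    qed
    ultimately have 1: "\<parallel>w\<parallel> \<le> \<parallel>z\<parallel>"
      using contraction_bounds(2)[OF selfadj_scal[OF h(1)] _ z] by (simp add: g_def)
    have "3 \<odot> x \<ominus> 4 \<odot> y = w \<oplus> (of_real ((1 - \<rho>) * 3) \<odot> x \<ominus> of_real ((1 - \<rho> ^ 3) * 4) \<odot> y)"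
      unfolding w_def
      by (rule coordinates[of x y z z z]) (simp_all add: xy z vsub_def algebra_simps)
    also have "\<parallel>\<dots>\<parallel> \<le> \<parallel>w\<parallel> + (\<parallel>of_real ((1 - \<rho>) * 3) \<odot> x\<parallel> + \<parallel>of_real ((1 - \<rho> ^ 3) * 4) \<odot> y\<parallel>)"
      by (rule order_trans[OF norm_triangle add_left_mono[OF norm_vsub_le]]) (simp_all only: ccloseds xy wC)
    also have "\<parallel>of_real ((1 - \<rho>) * 3) \<odot> x\<parallel> = (1 - \<rho>) * (3 * \<parallel>x\<parallel>)"
      unfolding norm_scal[OF xy(1)] norm_of_real using \<rho> by (simp add: abs_mult)
    also have "\<parallel>of_real ((1 - \<rho> ^ 3) * 4) \<odot> y\<parallel> = (1 - \<rho> ^ 3) * (4 * \<parallel>y\<parallel>)"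
      unfolding norm_scal[OF xy(2)] norm_of_real using \<rho> power_le_one[of \<rho> 3] by (simp add: abs_mult)
    finally show ?thesis using 1 by simp
  qed
  have "((\<lambda>\<rho>. \<parallel>z\<parallel> + (1 - \<rho>) * (3 * \<parallel>x\<parallel>) + (1 - \<rho> ^ 3) * (4 * \<parallel>y\<parallel>)) \<longlongrightarrow>
      \<parallel>z\<parallel> + (1 - 1) * (3 * \<parallel>x\<parallel>) + (1 - 1 ^ 3) * (4 * \<parallel>y\<parallel>)) (at_left (1::real))"
    by (intro tendsto_intros)
  hence "\<parallel>3 \<odot> x \<ominus> 4 \<odot> y\<parallel> \<le> \<parallel>z\<parallel> + (1 - 1) * (3 * \<parallel>x\<parallel>) + (1 - 1 ^ 3) * (4 * \<parallel>y\<parallel>)"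
    by (rule tendsto_lowerbound)
      (use eventually_at_left_real[of 0 "1::real"] le in \<open>auto elim!: eventually_mono\<close>)
  thus "\<parallel>(3 \<odot> h \<ominus> 4 \<odot> (h \<otimes> (h \<otimes> h))) \<otimes> z\<parallel> \<le> 1 * \<parallel>z\<parallel>"
    by (simp add: x_def y_def mul_vsub mul_scal_left mul_assoc ccloseds hC z)
qed simp

end

text \<open>If \<open>h\<close> is self-adjoint with \<open>\<parallel>h\<parallel> < 1\<close>, the identity \<open>h\<^sup>2 + (1 - m)\<^sup>2 = 1\<close> has a solution \<open>m\<close> in \<open>C\<close>. The
  homomorphism preserves this algebraic identity, and in \<open>D\<close> the identity forces \<open>\<parallel>f h\<parallel> \<le> 1\<close>. The general
  case follows with \<open>h = x\<^sup>\<star> x / c\<^sup>2\<close> for \<open>c > \<parallel>x\<parallel>\<close>.\<close>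

lemma star_hom_contractive:
  assumes C: "cstar_algebra C" and D: "cstar_algebra D" and f: "star_hom C D f" and x: "x \<in> car C"
  shows "\<parallel>f x\<parallel>\<^bsub>D\<^esub> \<le> \<parallel>x\<parallel>\<^bsub>C\<^esub>"
proof (rule ccontr)
  interpret C: cstar_algebra C by (rule C)
  interpret D: cstar_algebra D by (rule D)
  have fl: "y \<in> car C \<Longrightarrow> f y \<in> car D" "\<lbrakk>y \<in> car C; z \<in> car C\<rbrakk> \<Longrightarrow> f (y \<oplus>\<^bsub>C\<^esub> z) = f y \<oplus>\<^bsub>D\<^esub> f z"
    "y \<in> car C \<Longrightarrow> f (c \<odot>\<^bsub>C\<^esub> y) = c \<odot>\<^bsub>D\<^esub> f y"
    "\<lbrakk>y \<in> car C; z \<in> car C\<rbrakk> \<Longrightarrow> f (y \<otimes>\<^bsub>C\<^esub> z) = f y \<otimes>\<^bsub>D\<^esub> f z"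
    "y \<in> car C \<Longrightarrow> f (y\<^sup>\<star>\<^bsub>C\<^esub>) = (f y)\<^sup>\<star>\<^bsub>D\<^esub>" for y z c
    using f by (auto simp: star_hom_def lin_map_def)
  have sa: "D.selfadj (f y)" if "C.selfadj y" for y
    using that fl(1,5)[of y] by (simp add: C.selfadj_def D.selfadj_def)
  assume "\<not> ?thesis"
  hence "\<parallel>x\<parallel>\<^bsub>C\<^esub> < \<parallel>f x\<parallel>\<^bsub>D\<^esub>" by simp
  then obtain c where c: "\<parallel>x\<parallel>\<^bsub>C\<^esub> < c" "c < \<parallel>f x\<parallel>\<^bsub>D\<^esub>" using dense[of "\<parallel>x\<parallel>\<^bsub>C\<^esub>"] by blast
  have c0: "0 < c" using c C.norm_nonneg[OF x] by simp
  define h where "h = complex_of_real (1 / c\<^sup>2) \<odot>\<^bsub>C\<^esub> (x\<^sup>\<star>\<^bsub>C\<^esub> \<otimes>\<^bsub>C\<^esub> x)"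
  have h: "C.selfadj h" by (simp only: h_def C.selfadj_scal C.selfadj_mul_adj x)
  have hC: "h \<in> car C" using h by (simp add: C.selfadj_def)
  have "\<parallel>x\<parallel>\<^bsub>C\<^esub>\<^sup>2 < c\<^sup>2" using c C.norm_nonneg[OF x] by (intro power_strict_mono) auto
  hence hn: "\<parallel>h\<parallel>\<^bsub>C\<^esub> < 1"
    using c0 by (simp add: h_def C.norm_scal C.ccloseds x C.cstar_identity norm_divide norm_power)
  have "\<parallel>h \<otimes>\<^bsub>C\<^esub> h\<parallel>\<^bsub>C\<^esub> < 1"
    using C.cstar_identity[OF hC] h hn C.norm_nonneg[OF hC]
    by (simp add: C.selfadj_def abs_square_less_1)
  then obtain m where m: "C.selfadj m" "2 \<odot>\<^bsub>C\<^esub> m = h \<otimes>\<^bsub>C\<^esub> h \<oplus>\<^bsub>C\<^esub> m \<otimes>\<^bsub>C\<^esub> m" "h \<otimes>\<^bsub>C\<^esub> m = m \<otimes>\<^bsub>C\<^esub> h"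
    using C.sqrt_witness[OF C.selfadj_square[OF h]] C.mul_assoc[OF hC hC hC] hC by metis
  have mC: "m \<in> car C" using m by (simp add: C.selfadj_def)
  have "\<parallel>f h\<parallel>\<^bsub>D\<^esub> \<le> 1"
  proof (rule D.norm_le_if_mul_le)
    fix z assume "z \<in> car D"
    thus "\<parallel>f h \<otimes>\<^bsub>D\<^esub> z\<parallel>\<^bsub>D\<^esub> \<le> 1 * \<parallel>z\<parallel>\<^bsub>D\<^esub>"
      using D.chebyshev_bounds(1)[OF sa[OF h] sa[OF m(1)]] arg_cong[OF m(2), of f] arg_cong[OF m(3), of f]
      by (simp add: fl C.ccloseds hC mC)
  qed (simp_all add: fl hC)
  moreover have "\<parallel>f h\<parallel>\<^bsub>D\<^esub> = \<parallel>f x\<parallel>\<^bsub>D\<^esub>\<^sup>2 / c\<^sup>2"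
    using c0 by (simp add: h_def fl C.ccloseds x D.norm_scal D.ccloseds D.cstar_identity norm_divide norm_power)
  moreover have "c\<^sup>2 < \<parallel>f x\<parallel>\<^bsub>D\<^esub>\<^sup>2" using c c0 by (intro power_strict_mono) auto
  ultimately show False using c0 by (simp add: field_simps)
qed

section \<open>Approximate units\<close>

context cstar_algebra
begin

text \<open>The self-adjoint contractions of the form \<open>z \<mapsto> (1 - v) z\<close> with \<open>v \<in> I\<close>. An operator of this kind that is
  small on given elements replaces \<open>1 - v\<close> for an approximate unit \<open>v\<close>. The set \<open>I\<close> is kept variable in
  order to find \<open>v\<close> inside a given ideal.\<close>

definition damping :: "'a set \<Rightarrow> ('a \<Rightarrow> 'a) \<Rightarrow> bool" where
  "damping I T \<longleftrightarrow>
     (\<exists>v\<in>I. \<forall>z\<in>car C. T z = z \<ominus> v \<otimes> z) \<and>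
     (\<forall>x\<in>car C. \<forall>y\<in>car C. (T x)\<^sup>\<star> \<otimes> y = x\<^sup>\<star> \<otimes> T y) \<and>
     (\<forall>z\<in>car C. \<parallel>T z\<parallel> \<le> \<parallel>z\<parallel>)"

definition right_ideal :: "'a set \<Rightarrow> bool" where
  "right_ideal I \<longleftrightarrow> lin_subspace C I \<and> (\<forall>v\<in>I. \<forall>x\<in>car C. v \<otimes> x \<in> I)"

lemma right_idealD:
  assumes "right_ideal I"
  shows "x \<in> I \<Longrightarrow> x \<in> car C" "\<zero> \<in> I" "\<lbrakk>x \<in> I; y \<in> I\<rbrakk> \<Longrightarrow> x \<oplus> y \<in> I" "x \<in> I \<Longrightarrow> c \<odot> x \<in> I"
    "\<lbrakk>x \<in> I; y \<in> I\<rbrakk> \<Longrightarrow> x \<ominus> y \<in> I" "\<lbrakk>x \<in> I; y \<in> car C\<rbrakk> \<Longrightarrow> x \<otimes> y \<in> I"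
  using assms by (auto simp: right_ideal_def lin_subspace_def vsub_def)

lemma right_ideal_car: "right_ideal (car C)"
  by (simp add: right_ideal_def lin_subspace_def ccloseds)

context
  fixes I assumes I: "right_ideal I"
begin

lemma dampingD:
  assumes "damping I T" "z \<in> car C"
  shows "T z \<in> car C" "\<parallel>T z\<parallel> \<le> \<parallel>z\<parallel>" "y \<in> car C \<Longrightarrow> T (z \<otimes> y) = T z \<otimes> y"
    "y \<in> car C \<Longrightarrow> T (z \<ominus> y) = T z \<ominus> T y" "T (c \<odot> z) = c \<odot> T z"
    "y \<in> car C \<Longrightarrow> (T z)\<^sup>\<star> \<otimes> y = z\<^sup>\<star> \<otimes> T y"
proof -
  obtain v where v: "v \<in> car C" "\<And>z. z \<in> car C \<Longrightarrow> T z = z \<ominus> v \<otimes> z"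
    using assms(1) right_idealD(1)[OF I] by (auto simp: damping_def)
  show "T z \<in> car C" using v assms(2) by (simp add: ccloseds)
  show "\<parallel>T z\<parallel> \<le> \<parallel>z\<parallel>" "y \<in> car C \<Longrightarrow> (T z)\<^sup>\<star> \<otimes> y = z\<^sup>\<star> \<otimes> T y"
    using assms by (auto simp: damping_def)
  show "T (z \<otimes> y) = T z \<otimes> y" if "y \<in> car C"
    using v assms(2) that by (simp add: ccloseds mul_vsub mul_assoc)
  show "T (z \<ominus> y) = T z \<ominus> T y" if "y \<in> car C"
    by (simp add: v assms(2) that ccloseds mul_vsub, rule coordinates[of z y "v \<otimes> z" "v \<otimes> y" "v \<otimes> z"])
      (simp_all add: v assms(2) that ccloseds vsub_def)
  show "T (c \<odot> z) = c \<odot> T z"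
    using v assms(2) by (simp add: ccloseds vsub_def mul_scal_right scal_add_right scal_scal mult.commute)
qed

lemma damping_id: "damping I (\<lambda>z. z)"
  unfolding damping_def
  by (intro conjI bexI[of _ \<zero>]) (auto simp: right_idealD(2)[OF I] mul_zero vsub_def scal_zero add_zero)

lemma damping_formula_comp:
  assumes "damping I q" and T: "\<exists>v\<in>I. \<forall>z\<in>car C. T z = z \<ominus> v \<otimes> z"
  shows "\<exists>v\<in>I. \<forall>z\<in>car C. q (T z) = z \<ominus> v \<otimes> z"
proof -
  obtain v where v: "v \<in> I" "\<And>z. z \<in> car C \<Longrightarrow> q z = z \<ominus> v \<otimes> z"
    using assms(1) by (auto simp: damping_def)
  obtain w where w: "w \<in> I" "\<And>z. z \<in> car C \<Longrightarrow> T z = z \<ominus> w \<otimes> z" using T by blast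
  have c: "v \<in> car C" "w \<in> car C" using v w right_idealD(1)[OF I] by blast+
  have "q (T z) = z \<ominus> (w \<oplus> (v \<ominus> v \<otimes> w)) \<otimes> z" if z: "z \<in> car C" for z
  proof -
    have "q (T z) = (z \<ominus> w \<otimes> z) \<ominus> (v \<otimes> z \<ominus> v \<otimes> (w \<otimes> z))"
      by (simp add: v w c z ccloseds mul_vsub)
    also have "\<dots> = z \<ominus> (w \<otimes> z \<oplus> (v \<otimes> z \<ominus> v \<otimes> (w \<otimes> z)))"
      by (rule coordinates[of z "w \<otimes> z" "v \<otimes> z" "v \<otimes> (w \<otimes> z)" "v \<otimes> z"])
        (simp_all add: ccloseds z c vsub_def)
    finally show ?thesis by (simp add: mul_vsub mul_add_left mul_assoc ccloseds z c)
  qed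
  moreover have "w \<oplus> (v \<ominus> v \<otimes> w) \<in> I" by (intro right_idealD[OF I] v w c)
  ultimately show ?thesis by blast
qed

text \<open>The product of two such operators need not be self-adjoint, but \<open>q T q\<close> is.\<close>

lemma damping_sandwich:
  assumes q: "damping I q" and T: "damping I T"
  shows "damping I (\<lambda>z. q (T (q z)))"
proof -
  have "\<exists>v\<in>I. \<forall>z\<in>car C. q z = z \<ominus> v \<otimes> z" using q by (simp add: damping_def)
  from damping_formula_comp[OF q damping_formula_comp[OF T this]]
  have 1: "\<exists>v\<in>I. \<forall>z\<in>car C. q (T (q z)) = z \<ominus> v \<otimes> z" .
  have 2: "\<parallel>q (T (q z))\<parallel> \<le> \<parallel>z\<parallel>" if "z \<in> car C" for z
    using dampingD(1,2)[OF q] dampingD(1,2)[OF T] that order_trans by meson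
  show ?thesis
    using 1 2 dampingD(6)[OF q] dampingD(6)[OF T] dampingD(1)[OF q] dampingD(1)[OF T]
    by (simp add: damping_def)
qed

lemma damping_funpow: "damping I q \<Longrightarrow> damping I (q ^^ n)"
proof (induction n)
  case 0
  show ?case using damping_id by (simp add: id_def)
next
  case (Suc n)
  have "(q ^^ n) (q z) = q ((q ^^ n) z)" for z by (simp add: funpow_swap1)
  moreover have "\<exists>v\<in>I. \<forall>z\<in>car C. q ((q ^^ n) z) = z \<ominus> v \<otimes> z"
    using Suc by (intro damping_formula_comp[OF Suc(2)]) (simp add: damping_def)
  moreover have "\<parallel>q ((q ^^ n) z)\<parallel> \<le> \<parallel>z\<parallel>" if "z \<in> car C" for z
    using dampingD(1,2)[OF Suc(2)] dampingD(1,2)[OF Suc(1)[OF Suc(2)]] that order_trans by meson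
  ultimately show ?case
    using dampingD(1,6)[OF Suc(2)] dampingD(1,6)[OF Suc(1)[OF Suc(2)]]
    by (simp add: damping_def)
qed

text \<open>The mean \<open>T = (1 / N) (1 + q + \<cdots> + q\<^bsup>N-1\<^esup>)\<close> makes \<open>T (1 - q) = (1 - q\<^sup>N) / N\<close> small.\<close>

lemma cesaro_damping:
  assumes q: "damping I q" and N: "N > 0"
  obtains T where "damping I T" "\<And>z. z \<in> car C \<Longrightarrow> \<parallel>T (z \<ominus> q z)\<parallel> \<le> 2 / real N * \<parallel>z\<parallel>"
proof -
  define S where "S = rec_nat (\<lambda>z. \<zero>) (\<lambda>n f z. f z \<oplus> (q ^^ n) z)"
  have S0: "S 0 z = \<zero>" and SS: "S (Suc n) z = S n z \<oplus> (q ^^ n) z" for n z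
    by (simp_all add: S_def)
  note qn = dampingD[OF damping_funpow[OF q]]
  have SC: "S n z \<in> car C" if "z \<in> car C" for n z
    using that by (induction n) (simp_all add: S0 SS ccloseds qn)
  have Sn: "\<parallel>S n z\<parallel> \<le> real n * \<parallel>z\<parallel>" if z: "z \<in> car C" for n z
  proof (induction n)
    case (Suc n)
    thus ?case using norm_triangle[OF SC[OF z] qn(1)[OF z], of n n] qn(2)[OF z, of n]
      by (simp add: SS algebra_simps)
  qed (simp add: S0 norm_zero)
  have Sv: "\<exists>v\<in>I. \<forall>z\<in>car C. S n z = of_nat n \<odot> z \<ominus> v \<otimes> z" for n
  proof (induction n)
    case 0
    show ?case by (intro bexI[of _ \<zero>])
      (auto simp: S0 zero_scal mul_zero vsub_def scal_zero add_zero ccloseds right_idealD(2)[OF I])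
  next
    case (Suc n)
    then obtain v where v: "v \<in> I" "\<And>z. z \<in> car C \<Longrightarrow> S n z = of_nat n \<odot> z \<ominus> v \<otimes> z" by blast
    obtain w where w: "w \<in> I" "\<And>z. z \<in> car C \<Longrightarrow> (q ^^ n) z = z \<ominus> w \<otimes> z"
      using damping_funpow[OF q, of n] unfolding damping_def by blast
    have c: "v \<in> car C" "w \<in> car C" using v w right_idealD(1)[OF I] by blast+
    have "S (Suc n) z = of_nat (Suc n) \<odot> z \<ominus> (v \<oplus> w) \<otimes> z" if z: "z \<in> car C" for z
      by (simp add: SS v w z c mul_add_left, rule coordinates[of z "v \<otimes> z" "w \<otimes> z" z z])
        (simp_all add: ccloseds z c vsub_def add.commute)
    thus ?case using right_idealD(3)[OF I v(1) w(1)] by blast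
  qed
  have Sa: "(S n x)\<^sup>\<star> \<otimes> y = x\<^sup>\<star> \<otimes> S n y" if "x \<in> car C" "y \<in> car C" for n x y
  proof (induction n)
    case 0
    have "\<zero>\<^sup>\<star> = \<zero>" using adj_scal[OF zero_closed, of 0] by (simp add: zero_scal ccloseds)
    thus ?case by (simp add: S0 mul_zero that ccloseds)
  qed (simp add: SS adj_add mul_add_left mul_add_right SC qn that ccloseds)
  have tel: "S n (z \<ominus> q z) = z \<ominus> (q ^^ n) z" if z: "z \<in> car C" for n z
  proof (induction n)
    case 0
    show ?case using vsub_eq_zero_iff[OF z z] by (simp add: S0)
  next
    case (Suc n)
    have qz: "q z \<in> car C" using qn(1)[OF z, of 1] by simp
    have "S (Suc n) (z \<ominus> q z) = (z \<ominus> (q ^^ n) z) \<oplus> ((q ^^ n) z \<ominus> (q ^^ Suc n) z)"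
      using Suc qz by (simp add: SS qn(4) z funpow_swap1)
    also have "\<dots> = z \<ominus> (q ^^ Suc n) z"
      by (rule coordinates[of z "(q ^^ n) z" "(q ^^ Suc n) z" z z])
        (use qn(1)[OF z, of "Suc n"] in \<open>simp_all add: qn z vsub_def del: funpow.simps\<close>)
    finally show ?case .
  qed
  define T where "T z = (1 / of_nat N) \<odot> S N z" for z
  have "damping I T"
    unfolding damping_def
  proof (intro conjI ballI)
    obtain v where v: "v \<in> I" "\<And>z. z \<in> car C \<Longrightarrow> S N z = of_nat N \<odot> z \<ominus> v \<otimes> z" using Sv by blast
    have "v \<in> car C" using v right_idealD(1)[OF I] by blast
    hence "T z = z \<ominus> ((1 / of_nat N) \<odot> v) \<otimes> z" if "z \<in> car C" for z
      using N that
      by (simp add: T_def v vsub_def ccloseds scal_add_right scal_scal scal_one mul_scal_left)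
    thus "\<exists>v\<in>I. \<forall>z\<in>car C. T z = z \<ominus> v \<otimes> z" using right_idealD(4)[OF I v(1)] by blast
    fix x assume x: "x \<in> car C"
    show "\<parallel>T x\<parallel> \<le> \<parallel>x\<parallel>" using Sn[OF x, of N] N
      by (simp add: T_def norm_scal SC x norm_divide field_simps)
    fix y assume y: "y \<in> car C"
    show "(T x)\<^sup>\<star> \<otimes> y = x\<^sup>\<star> \<otimes> T y"
      by (simp add: T_def adj_scal mul_scal_left mul_scal_right SC x y ccloseds Sa)
  qed
  moreover have "\<parallel>T (z \<ominus> q z)\<parallel> \<le> 2 / real N * \<parallel>z\<parallel>" if z: "z \<in> car C" for z
  proof -
    have "\<parallel>T (z \<ominus> q z)\<parallel> = \<parallel>z \<ominus> (q ^^ N) z\<parallel> / real N"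
      using N by (simp add: T_def tel z norm_scal ccloseds qn norm_divide)
    also have "\<dots> \<le> (\<parallel>z\<parallel> + \<parallel>z\<parallel>) / real N"
      using norm_vsub_le[OF z qn(1)[OF z], of N] qn(2)[OF z, of N] by (intro divide_right_mono) auto
    finally show ?thesis by (simp add: field_simps)
  qed
  ultimately show thesis by (rule that)
qed

text \<open>This is \<open>\<parallel>T c\<parallel>\<^sup>2 = \<parallel>T c c\<^sup>\<star> T\<parallel> \<le> \<parallel>T c c\<^sup>\<star>\<parallel>\<close>; the right factor \<open>T\<close> is handled by taking adjoints.\<close>

lemma damping_square:
  assumes T: "damping I T" and c: "c \<in> car C"
  shows "\<parallel>T c\<parallel>\<^sup>2 \<le> \<parallel>T (c \<otimes> c\<^sup>\<star>)\<parallel>"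
proof -
  have Tc: "T c \<in> car C" using dampingD(1)[OF T c] .
  have "\<parallel>T c\<parallel>\<^sup>2 = \<parallel>T (c \<otimes> (T c)\<^sup>\<star>)\<parallel>"
    using dampingD(3)[OF T c adj_closed[OF Tc]] norm_mul_adj[OF Tc] by simp
  also have "c \<otimes> (T c)\<^sup>\<star> = (T c \<otimes> c\<^sup>\<star>)\<^sup>\<star>" by (simp add: adj_mul adj_adj c Tc ccloseds)
  also have "\<parallel>T \<dots>\<parallel> \<le> \<parallel>\<dots>\<parallel>" by (rule dampingD(2)[OF T]) (simp add: c Tc ccloseds)
  also have "\<dots> = \<parallel>T (c \<otimes> c\<^sup>\<star>)\<parallel>" using dampingD(3)[OF T c adj_closed[OF c]] by (simp add: norm_adj c Tc ccloseds)
  finally show ?thesis .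
qed

text \<open>Let \<open>k = c c\<^sup>\<star>\<close> and let \<open>h\<close> be a multiple of \<open>k\<close> with \<open>\<parallel>h\<parallel> < 1\<close>. Then \<open>q = 1 - h\<^sup>2\<close> is a contraction, and a Cesaro
  mean \<open>T\<close> of its powers is small on \<open>h\<^sup>2 z\<close> for all \<open>z\<close>, in particular on \<open>k\<^sup>4\<close>. Three applications of
  \<open>damping_square\<close> lead from \<open>k\<^sup>4\<close> back to \<open>c\<close>, which accounts for the eighth power.\<close>

lemma damping_small:
  assumes c: "c \<in> car C" "c \<otimes> c\<^sup>\<star> \<in> I" and \<epsilon>: "\<epsilon> > 0"
  obtains T where "damping I T" "\<parallel>T c\<parallel> < \<epsilon>"
proof -
  define k where "k = c \<otimes> c\<^sup>\<star>"
  have k: "k \<in> I" "k \<in> car C" "selfadj k" using c selfadj_mul_adj(1)[OF c(1)] by (auto simp: k_def ccloseds)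
  have ka: "k\<^sup>\<star> = k" using k by (simp add: selfadj_def)
  define s where "s = 1 / (\<parallel>k\<parallel> + 1)"
  have s: "s > 0" using norm_nonneg[OF k(2)] by (simp add: s_def)
  define h where "h = complex_of_real s \<odot> k"
  have h: "h \<in> I" "selfadj h" "h \<in> car C"
    using k right_idealD(4)[OF I k(1)] selfadj_scal[OF k(3)] by (simp_all add: h_def ccloseds)
  have hn: "\<parallel>h\<parallel> < 1" 
    unfolding h_def norm_scal[OF k(2)] norm_of_real using norm_nonneg[OF k(2)] by (simp add: s_def)
  define q where "q z = z \<ominus> h \<otimes> (h \<otimes> z)" for z
  have q: "damping I q"
    unfolding damping_def
  proof (intro conjI ballI)
    show "\<exists>v\<in>I. \<forall>z\<in>car C. q z = z \<ominus> v \<otimes> z"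
      by (intro bexI[of _ "h \<otimes> h"] ballI) (simp_all add: q_def mul_assoc h right_idealD(6)[OF I])
  qed (use h hn contraction_bounds(1) in \<open>simp_all add: q_def adj_vsub adj_mul mul_vsub mul_assoc ccloseds selfadj_def\<close>)
  define B where "B = 2 * \<parallel>k \<otimes> k\<parallel> / s\<^sup>2"
  obtain N where N: "N > 0" "B / real N < \<epsilon> ^ 8"
  proof -
    obtain N where "B / \<epsilon> ^ 8 < real N" using reals_Archimedean2 by blast
    hence "B / \<epsilon> ^ 8 < real (Suc N)" by simp
    hence "B / real (Suc N) < \<epsilon> ^ 8" using \<epsilon> by (simp add: field_simps del: of_nat_Suc)
    thus thesis using that[of "Suc N"] by simp
  qed
  obtain T where T: "damping I T" and small: "\<And>z. z \<in> car C \<Longrightarrow> \<parallel>T (z \<ominus> q z)\<parallel> \<le> 2 / real N * \<parallel>z\<parallel>"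
    using cesaro_damping[OF q N(1)] by blast
  have 1: "\<parallel>T (k \<otimes> (k \<otimes> (k \<otimes> k)))\<parallel> \<le> B / real N"
  proof -
    have kk: "k \<otimes> k \<in> car C" by (simp add: k ccloseds)
    have "k \<otimes> k \<ominus> q (k \<otimes> k) = complex_of_real (s\<^sup>2) \<odot> (k \<otimes> (k \<otimes> (k \<otimes> k)))"
      unfolding q_def h_def
      by (simp add: mul_scal_left mul_scal_right scal_scal k ccloseds,
          rule coordinates[of "k \<otimes> k" "k \<otimes> (k \<otimes> (k \<otimes> k))" k k k])
        (simp_all add: k ccloseds vsub_def power2_eq_square)
    hence "\<parallel>T (k \<otimes> k \<ominus> q (k \<otimes> k))\<parallel> = s\<^sup>2 * \<parallel>T (k \<otimes> (k \<otimes> (k \<otimes> k)))\<parallel>"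
      using s by (simp add: dampingD(1,5)[OF T] norm_scal k ccloseds norm_power)
    hence "\<parallel>T (k \<otimes> (k \<otimes> (k \<otimes> k)))\<parallel> = \<parallel>T (k \<otimes> k \<ominus> q (k \<otimes> k))\<parallel> / s\<^sup>2" using s by simp
    also have "\<dots> \<le> (2 / real N * \<parallel>k \<otimes> k\<parallel>) / s\<^sup>2"
      using small[OF kk] by (intro divide_right_mono) auto
    finally show ?thesis by (simp add: B_def field_simps)
  qed
  have 2: "\<parallel>T c\<parallel>\<^sup>2 \<le> \<parallel>T k\<parallel>" using damping_square[OF T c(1)] by (simp add: k_def)
  have 3: "\<parallel>T k\<parallel>\<^sup>2 \<le> \<parallel>T (k \<otimes> k)\<parallel>" using damping_square[OF T k(2)] by (simp add: ka)
  have 4: "\<parallel>T (k \<otimes> k)\<parallel>\<^sup>2 \<le> \<parallel>T (k \<otimes> (k \<otimes> (k \<otimes> k)))\<parallel>"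
    using damping_square[OF T mul_closed[OF k(2,2)]] by (simp add: adj_mul ka k mul_assoc ccloseds)
  note nn = norm_nonneg[OF dampingD(1)[OF T]]
  have "\<parallel>T c\<parallel> ^ 8 = ((\<parallel>T c\<parallel>\<^sup>2)\<^sup>2)\<^sup>2" by (simp add: power_mult[symmetric])
  also have "\<dots> \<le> (\<parallel>T k\<parallel>\<^sup>2)\<^sup>2" using 2 by (intro power_mono) auto
  also have "\<dots> \<le> \<parallel>T (k \<otimes> k)\<parallel>\<^sup>2" using 3 by (intro power_mono) auto
  also have "\<dots> < \<epsilon> ^ 8" using 1 4 N by linarith
  finally have "\<parallel>T c\<parallel> < \<epsilon>" using \<epsilon> by (simp add: power_less_imp_less_base)
  thus thesis using that T by blast
qed

end

text \<open>If \<open>q\<close> is small on \<open>S\<close> and \<open>T\<close> is small on \<open>q a\<close>, then \<open>q T q\<close> is small on \<open>S\<close> and on \<open>a\<close>.\<close>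

lemma damping_finite:
  assumes "finite S" "S \<subseteq> car C" "\<epsilon> > 0"
  shows "\<exists>T. damping (car C) T \<and> (\<forall>a\<in>S. \<parallel>T a\<parallel> < \<epsilon>)"
  using assms(1,2)
proof (induction S)
  case empty
  show ?case using damping_id[OF right_ideal_car] by blast
next
  case (insert a S)
  note R = right_ideal_car
  obtain q where q: "damping (car C) q" "\<forall>b\<in>S. \<parallel>q b\<parallel> < \<epsilon>" using insert by auto
  have a: "a \<in> car C" using insert by simp
  have qa: "q a \<in> car C" using dampingD(1)[OF R q(1) a] .
  obtain T where T: "damping (car C) T" "\<parallel>T (q a)\<parallel> < \<epsilon>"
    using damping_small[OF R qa _ assms(3)] by (metis mul_closed adj_closed qa)
  have "\<parallel>q (T (q b))\<parallel> < \<epsilon>" if "b \<in> insert a S" for b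
  proof -
    have b: "b \<in> car C" using that insert by auto
    note D = dampingD(1,2)[OF R q(1)] dampingD(1,2)[OF R T(1)]
    have "\<parallel>q (T (q b))\<parallel> \<le> \<parallel>T (q b)\<parallel>" using D b by blast
    moreover have "\<parallel>T (q b)\<parallel> \<le> \<parallel>q b\<parallel>" using D b by blast
    ultimately show ?thesis using that T(2) q(2) by force
  qed
  thus ?case using damping_sandwich[OF R q(1) T(1)] by blast
qed

text \<open>If \<open>T = 1 - p\<close> is small on \<open>S\<close>, then \<open>p\<close> is nearly a unit for \<open>S\<close>, but only \<open>\<parallel>p\<parallel> \<le> 2\<close> is known. With \<open>h = p / 2\<close> the
  element \<open>u = 3 h - 4 h\<^sup>3 = (3 p - p\<^sup>3) / 2\<close> is minus the third Chebyshev polynomial, so \<open>\<parallel>u\<parallel> \<le> 1\<close>, and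
  \<open>1 - u = (3 T\<^sup>2 - T\<^sup>3) / 2\<close> is still small on \<open>S\<close>. Including the adjoints of \<open>S\<close> gives the bound on the other
  side, as \<open>u\<close> is self-adjoint.\<close>

lemma approximate_unit_finite:
  assumes S: "finite S" "S \<subseteq> car C" and \<epsilon>: "\<epsilon> > 0"
  shows "\<exists>u\<in>car C. \<parallel>u\<parallel> \<le> 1 \<and> (\<forall>a\<in>S. \<parallel>u \<otimes> a \<ominus> a\<parallel> < \<epsilon> \<and> \<parallel>a \<otimes> u \<ominus> a\<parallel> < \<epsilon>)"
proof -
  note R = right_ideal_car
  have "finite (S \<union> adj C ` S)" "S \<union> adj C ` S \<subseteq> car C" "\<epsilon> / 2 > 0"
    using S \<epsilon> adj_closed by auto
  from damping_finite[OF this] obtain T where T: "damping (car C) T"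
    and TS: "\<forall>a\<in>S \<union> adj C ` S. \<parallel>T a\<parallel> < \<epsilon> / 2" by blast
  obtain p where p: "p \<in> car C" "\<And>z. z \<in> car C \<Longrightarrow> T z = z \<ominus> p \<otimes> z"
    using T by (auto simp: damping_def)
  note D = dampingD[OF R T]
  have pz: "p \<otimes> z = z \<ominus> T z" if z: "z \<in> car C" for z
    unfolding p(2)[OF z] by (rule coordinates[of "p \<otimes> z" z z z z]) (simp_all add: p(1) z ccloseds vsub_def)
  \<comment> \<open>The symmetry of \<open>T\<close> says \<open>x\<^sup>\<star> (p\<^sup>\<star> - p) y = 0\<close> for all \<open>x\<close> and \<open>y\<close>.\<close>
  have pa: "p\<^sup>\<star> = p"
  proof -
    have "(p \<otimes> x)\<^sup>\<star> \<otimes> y = x\<^sup>\<star> \<otimes> (p \<otimes> y)" if "x \<in> car C" "y \<in> car C" for x y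
      using that D(6)[of x y] by (simp add: pz adj_vsub mul_vsub D ccloseds)
    hence e: "x\<^sup>\<star> \<otimes> ((p\<^sup>\<star> \<ominus> p) \<otimes> y) = \<zero>" if "x \<in> car C" "y \<in> car C" for x y
      using that vsub_eq_zero_iff[of "x\<^sup>\<star> \<otimes> (p\<^sup>\<star> \<otimes> y)" "x\<^sup>\<star> \<otimes> (p \<otimes> y)"]
      by (simp add: adj_mul mul_vsub mul_assoc p(1) ccloseds)
    have le0: "\<parallel>(p\<^sup>\<star> \<ominus> p) \<otimes> y\<parallel> \<le> 0 * \<parallel>y\<parallel>" if y: "y \<in> car C" for y
    proof -
      have w: "(p\<^sup>\<star> \<ominus> p) \<otimes> y \<in> car C" by (simp add: p(1) y ccloseds)
      show ?thesis using cstar_identity[OF w] unfolding e[OF w y] by (simp add: norm_zero)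
    qed
    have "\<parallel>p\<^sup>\<star> \<ominus> p\<parallel> \<le> 0" by (rule norm_le_if_mul_le[OF _ le0]) (simp_all add: p(1) ccloseds)
    hence "\<parallel>p\<^sup>\<star> \<ominus> p\<parallel> = 0" using norm_nonneg[of "p\<^sup>\<star> \<ominus> p"] by (simp add: p(1) ccloseds)
    thus ?thesis by (simp add: norm_zero_iff vsub_eq_zero_iff p(1) ccloseds)
  qed
  define h where "h = (1/2) \<odot> p"
  have h: "h \<in> car C" "selfadj h" using pa by (simp_all add: h_def selfadj_def adj_scal p(1) ccloseds)
  have hz: "h \<otimes> z = (1/2) \<odot> (z \<ominus> T z)" if "z \<in> car C" for z
    using that by (simp add: h_def mul_scal_left p(1) pz)
  have "\<parallel>h\<parallel> \<le> 1"
  proof (rule norm_le_if_mul_le)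
    fix z assume z: "z \<in> car C"
    have "\<parallel>z \<ominus> T z\<parallel> \<le> \<parallel>z\<parallel> + \<parallel>z\<parallel>" using norm_vsub_le[OF z D(1)[OF z]] D(2)[OF z] by simp
    thus "\<parallel>h \<otimes> z\<parallel> \<le> 1 * \<parallel>z\<parallel>" using z by (simp add: hz norm_scal ccloseds D)
  qed (simp_all add: h)
  define u where "u = 3 \<odot> h \<ominus> 4 \<odot> (h \<otimes> (h \<otimes> h))"
  have u: "u \<in> car C" "\<parallel>u\<parallel> \<le> 1" "u\<^sup>\<star> = u"
    using chebyshev_contraction[OF h(2) \<open>\<parallel>h\<parallel> \<le> 1\<close>] h
    by (simp_all add: u_def ccloseds selfadj_def adj_vsub adj_scal adj_mul mul_assoc)
  have uz: "\<parallel>u \<otimes> z \<ominus> z\<parallel> \<le> 2 * \<parallel>T z\<parallel>" if z: "z \<in> car C" for z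
  proof -
    have hhh: "h \<otimes> (h \<otimes> (h \<otimes> z)) = (1/8) \<odot> (z \<ominus> 3 \<odot> T z \<oplus> 3 \<odot> T (T z) \<ominus> T (T (T z)))"
      by (simp add: hz D z ccloseds mul_scal_right mul_vsub,
          rule coordinates[of z "T z" "T (T z)" "T (T (T z))" z])
        (simp_all add: z D ccloseds vsub_def)
    have uz: "u \<otimes> z = 3 \<odot> (h \<otimes> z) \<ominus> 4 \<odot> (h \<otimes> (h \<otimes> (h \<otimes> z)))"
      by (simp add: u_def mul_vsub mul_scal_left mul_assoc ccloseds h z)
    have "u \<otimes> z \<ominus> z = (1/2) \<odot> T (T (T z)) \<ominus> (3/2) \<odot> T (T z)"
      unfolding uz unfolding hhh unfolding hz[OF z]
      by (rule coordinates[of "T z" "T (T z)" "T (T (T z))" "p \<otimes> z" z])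
        (simp_all add: z D p(1) ccloseds vsub_def)
    also have "\<parallel>\<dots>\<parallel> \<le> 1/2 * \<parallel>T (T (T z))\<parallel> + 3/2 * \<parallel>T (T z)\<parallel>"
      using norm_vsub_le[of "(1/2) \<odot> T (T (T z))" "(3/2) \<odot> T (T z)"] by (simp add: D z norm_scal ccloseds)
    also have "\<dots> \<le> 2 * \<parallel>T z\<parallel>" using D(2)[OF D(1)[OF z]] D(2)[OF D(1)[OF D(1)[OF z]]] by simp
    finally show ?thesis .
  qed
  have "\<parallel>u \<otimes> a \<ominus> a\<parallel> < \<epsilon> \<and> \<parallel>a \<otimes> u \<ominus> a\<parallel> < \<epsilon>" if "a \<in> S" for a
  proof -
    have a: "a \<in> car C" using that S by blast
    have "\<parallel>a \<otimes> u \<ominus> a\<parallel> = \<parallel>(u \<otimes> a\<^sup>\<star> \<ominus> a\<^sup>\<star>)\<^sup>\<star>\<parallel>" by (simp add: adj_vsub adj_mul adj_adj u a ccloseds)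
    also have "\<dots> = \<parallel>u \<otimes> a\<^sup>\<star> \<ominus> a\<^sup>\<star>\<parallel>" by (rule norm_adj) (simp add: u a ccloseds)
    finally have 1: "\<parallel>a \<otimes> u \<ominus> a\<parallel> = \<parallel>u \<otimes> a\<^sup>\<star> \<ominus> a\<^sup>\<star>\<parallel>" .
    have "\<parallel>T a\<parallel> < \<epsilon> / 2" "\<parallel>T (a\<^sup>\<star>)\<parallel> < \<epsilon> / 2" using TS that by blast+
    thus ?thesis using 1 uz[OF a] uz[OF adj_closed[OF a]] by linarith
  qed
  thus ?thesis using u by blast
qed

lemma approximate_unit_filter:
  obtains F where "F \<noteq> bot" "\<forall>\<^sub>F u in F. u \<in> car C \<and> \<parallel>u\<parallel> \<le> 1"
    "\<And>a. a \<in> car C \<Longrightarrow> ((\<lambda>u. \<parallel>a \<otimes> u \<ominus> a\<parallel>) \<longlongrightarrow> 0) F"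
    "\<And>a. a \<in> car C \<Longrightarrow> ((\<lambda>u. \<parallel>u \<otimes> a \<ominus> a\<parallel>) \<longlongrightarrow> 0) F"
proof -
  define P where "P = (\<lambda>(a, \<epsilon>). {u \<in> car C. \<parallel>u\<parallel> \<le> 1 \<and> \<parallel>u \<otimes> a \<ominus> a\<parallel> < \<epsilon> \<and> \<parallel>a \<otimes> u \<ominus> a\<parallel> < \<epsilon>})"
  define J where "J = {(a, \<epsilon>). a \<in> car C \<and> (\<epsilon>::real) > 0}"
  define F where "F = (INF j\<in>J. principal (P j))"
  have P: "\<forall>\<^sub>F u in F. u \<in> P j" if "j \<in> J" for j
    unfolding F_def by (rule eventually_INF1[OF that]) (simp add: eventually_principal)
  have "F \<noteq> bot"
    unfolding F_def
  proof (rule INF_filter_not_bot)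
    fix X assume X: "X \<subseteq> J" "finite X"
    define \<epsilon> where "\<epsilon> = Min (insert 1 (snd ` X))"
    have "\<epsilon> > 0" using X by (auto simp: \<epsilon>_def J_def)
    moreover have "finite (fst ` X)" "fst ` X \<subseteq> car C" using X by (auto simp: J_def)
    ultimately obtain u where u: "u \<in> car C" "\<parallel>u\<parallel> \<le> 1" "\<forall>a\<in>fst ` X. \<parallel>u \<otimes> a \<ominus> a\<parallel> < \<epsilon> \<and> \<parallel>a \<otimes> u \<ominus> a\<parallel> < \<epsilon>"
      using approximate_unit_finite[of "fst ` X" \<epsilon>] by blast
    have "u \<in> P (a, \<delta>)" if "(a, \<delta>) \<in> X" for a \<delta>
    proof -
      have "\<epsilon> \<le> \<delta>" unfolding \<epsilon>_def using X that by (intro Min_le) force+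
      moreover have "a \<in> fst ` X" using that by force
      ultimately show ?thesis using u by (force simp: P_def)
    qed
    hence "u \<in> (\<Inter>j\<in>X. P j)" by auto
    thus "(INF j\<in>X. principal (P j)) \<noteq> bot"
      using X by (auto simp: INF_principal_finite principal_eq_bot_iff)
  qed
  moreover have "\<forall>\<^sub>F u in F. u \<in> car C \<and> \<parallel>u\<parallel> \<le> 1"
    using P[of "(\<zero>, 1)"] by (auto simp: J_def P_def ccloseds elim: eventually_mono)
  moreover have "((\<lambda>u. \<parallel>a \<otimes> u \<ominus> a\<parallel>) \<longlongrightarrow> 0) F" "((\<lambda>u. \<parallel>u \<otimes> a \<ominus> a\<parallel>) \<longlongrightarrow> 0) F" if a: "a \<in> car C" for a
  proof -
    have "\<forall>\<^sub>F u in F. dist \<parallel>a \<otimes> u \<ominus> a\<parallel> 0 < \<epsilon> \<and> dist \<parallel>u \<otimes> a \<ominus> a\<parallel> 0 < \<epsilon>" if "\<epsilon> > 0" for \<epsilon>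
      using P[of "(a, \<epsilon>)"] that a
      by (auto simp: J_def P_def ccloseds norm_nonneg elim!: eventually_mono)
    thus "((\<lambda>u. \<parallel>a \<otimes> u \<ominus> a\<parallel>) \<longlongrightarrow> 0) F" "((\<lambda>u. \<parallel>u \<otimes> a \<ominus> a\<parallel>) \<longlongrightarrow> 0) F"
      unfolding tendsto_iff eventually_conj_iff by blast+
  qed
  ultimately show thesis by (rule that)
qed

text \<open>For \<open>c = x\<^sup>\<star>\<close> the element \<open>c c\<^sup>\<star> = x\<^sup>\<star> x\<close> belongs to \<open>I\<close>, so \<open>x\<^sup>\<star>\<close> is a limit of elements \<open>v x\<^sup>\<star>\<close> with \<open>v \<in> I\<close>.\<close>

lemma closed_ideal_adj:
  assumes I: "closed_ideal C I" and x: "x \<in> I"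
  shows "x\<^sup>\<star> \<in> I"
proof -
  have R: "right_ideal I" using I by (auto simp: closed_ideal_def right_ideal_def)
  have xC: "x \<in> car C" using right_idealD(1)[OF R x] .
  have k: "x\<^sup>\<star> \<otimes> (x\<^sup>\<star>)\<^sup>\<star> \<in> I" using I x xC by (simp add: closed_ideal_def adj_adj adj_closed)
  have "\<exists>y\<in>I. \<parallel>y \<ominus> x\<^sup>\<star>\<parallel> < inverse (real (Suc n))" for n
  proof -
    obtain T where T: "damping I T" "\<parallel>T (x\<^sup>\<star>)\<parallel> < inverse (real (Suc n))"
      using damping_small[OF R adj_closed[OF xC] k, of "inverse (real (Suc n))"] by auto
    then obtain v where v: "v \<in> I" "T (x\<^sup>\<star>) = x\<^sup>\<star> \<ominus> v \<otimes> x\<^sup>\<star>" using xC by (auto simp: damping_def adj_closed)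
    have "v \<otimes> x\<^sup>\<star> \<in> I" using right_idealD(6)[OF R v(1)] xC by (simp add: adj_closed)
    moreover from this have "\<parallel>v \<otimes> x\<^sup>\<star> \<ominus> x\<^sup>\<star>\<parallel> = \<parallel>T (x\<^sup>\<star>)\<parallel>"
      using norm_vsub_commute[of "v \<otimes> x\<^sup>\<star>" "x\<^sup>\<star>"] right_idealD(1)[OF R] xC by (simp add: v adj_closed)
    ultimately show ?thesis using T by (intro bexI[of _ "v \<otimes> x\<^sup>\<star>"]) auto
  qed
  then obtain Y where Y: "\<And>n. Y n \<in> I" "\<And>n. \<parallel>Y n \<ominus> x\<^sup>\<star>\<parallel> < inverse (real (Suc n))" by metis
  have "(\<lambda>n. vdist C (Y n) (x\<^sup>\<star>)) \<longlonglongrightarrow> 0"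
    unfolding vdist_vsub
    by (rule Lim_null_comparison[OF _ LIMSEQ_inverse_real_of_nat])
      (use Y(2) norm_nonneg[OF vsub_closed[OF right_idealD(1)[OF R Y(1)] adj_closed[OF xC]]]
        in \<open>auto intro!: always_eventually less_imp_le\<close>)
  thus ?thesis using I Y(1) xC unfolding closed_ideal_def norm_closed_def by (blast intro: adj_closed)
qed

lemma closed_ideal_subalgebra: "closed_ideal C I \<Longrightarrow> cstar_subalgebra C I"
  using closed_ideal_adj unfolding closed_ideal_def cstar_subalgebra_def lin_subspace_def by blast

lemma subalgebra_cstar:
  assumes "cstar_subalgebra C D" shows "cstar_algebra (C\<lparr>car := D\<rparr>)"
proof -
  have sub: "x \<in> D \<Longrightarrow> x \<in> car C" for x using assms by (auto simp: cstar_subalgebra_def lin_subspace_def)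
  have D: "\<zero> \<in> D" "\<lbrakk>x \<in> D; y \<in> D\<rbrakk> \<Longrightarrow> x \<oplus> y \<in> D" "x \<in> D \<Longrightarrow> c \<odot> x \<in> D" "\<lbrakk>x \<in> D; y \<in> D\<rbrakk> \<Longrightarrow> x \<otimes> y \<in> D"
    "x \<in> D \<Longrightarrow> x\<^sup>\<star> \<in> D" for x y c
    using assms by (auto simp: cstar_subalgebra_def lin_subspace_def)
  have vd: "vdist (C\<lparr>car := D\<rparr>) = vdist C" by (simp add: vdist_def fun_eq_iff)
  show ?thesis
  proof (unfold_locales, goal_cases)
    case (15 X)
    have "\<exists>x\<in>car C. (\<lambda>n. vdist C (X n) x) \<longlonglongrightarrow> 0"
      using 15 sub by (intro complete) (auto simp: vd)
    then obtain x where x: "x \<in> car C" "(\<lambda>n. vdist C (X n) x) \<longlonglongrightarrow> 0" by blast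
    moreover have "x \<in> D" using x 15(1) assms by (auto simp: cstar_subalgebra_def norm_closed_def)
    ultimately show ?case by (auto simp: vd)
  qed (auto simp: sub D add_assoc add_commute add_left_commute add_zero add_neg scal_add_right scal_add_left scal_scal scal_one
      norm_zero_iff norm_triangle norm_scal mul_assoc mul_add_left mul_add_right mul_scal_left mul_scal_right
      adj_add adj_scal adj_mul adj_adj norm_mul cstar_identity)
qed

end

section \<open>Pure states and ideals\<close>

context cstar_algebra
begin

context
  fixes \<phi> :: "'a \<Rightarrow> complex"
  assumes pos: "positive_functional C \<phi>"
begin

lemma pf_add: "\<lbrakk>x \<in> car C; y \<in> car C\<rbrakk> \<Longrightarrow> \<phi> (x \<oplus> y) = \<phi> x + \<phi> y"
  and pf_scal: "x \<in> car C \<Longrightarrow> \<phi> (c \<odot> x) = c * \<phi> x"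
  using pos by (auto simp: positive_functional_def)

lemma pf_vsub: "\<lbrakk>x \<in> car C; y \<in> car C\<rbrakk> \<Longrightarrow> \<phi> (x \<ominus> y) = \<phi> x - \<phi> y"
  by (simp add: vsub_def pf_add pf_scal ccloseds)

text \<open>The square of the seminorm of the GNS representation.\<close>

definition gns_sq :: "'a \<Rightarrow> real" where
  "gns_sq x = Re (\<phi> (x\<^sup>\<star> \<otimes> x))"

lemma gns_sq:
  assumes "x \<in> car C"
  shows "\<phi> (x\<^sup>\<star> \<otimes> x) = of_real (gns_sq x)" "0 \<le> gns_sq x"
proof -
  have "\<phi> (x\<^sup>\<star> \<otimes> x) \<in> \<real>\<^sub>\<ge>\<^sub>0" using pos assms by (simp add: positive_functional_def)
  thus "\<phi> (x\<^sup>\<star> \<otimes> x) = of_real (gns_sq x)" "0 \<le> gns_sq x"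
    by (auto simp: gns_sq_def nonneg_Reals_def)
qed

lemma pf_expand:
  assumes "x \<in> car C" "y \<in> car C"
  shows "\<phi> ((x \<oplus> t \<odot> y)\<^sup>\<star> \<otimes> (x \<oplus> t \<odot> y)) =
    of_real (gns_sq x) + t * \<phi> (x\<^sup>\<star> \<otimes> y) + cnj t * \<phi> (y\<^sup>\<star> \<otimes> x) + of_real ((cmod t)\<^sup>2 * gns_sq y)"
proof -
  have "cnj t * t = of_real ((cmod t)\<^sup>2)" using complex_norm_square[of t] by (simp add: mult.commute)
  thus ?thesis
    using assms
    by (simp add: adj_add adj_scal mul_add_left mul_add_right mul_scal_left mul_scal_right pf_add pf_scal ccloseds
        gns_sq(1) algebra_simps)
qed

lemma pf_hermitian:
  assumes "x \<in> car C" "y \<in> car C"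
  shows "\<phi> (y\<^sup>\<star> \<otimes> x) = cnj (\<phi> (x\<^sup>\<star> \<otimes> y))"
proof -
  have r: "Im (t * \<phi> (x\<^sup>\<star> \<otimes> y) + cnj t * \<phi> (y\<^sup>\<star> \<otimes> x)) = 0" for t
  proof -
    have "Im (\<phi> ((x \<oplus> t \<odot> y)\<^sup>\<star> \<otimes> (x \<oplus> t \<odot> y))) = 0"
      using assms by (simp add: gns_sq(1) ccloseds)
    thus ?thesis unfolding pf_expand[OF assms] by simp
  qed
  show ?thesis using r[of 1] r[of \<i>] by (simp add: complex_eq_iff)
qed

lemma gns_sq_expand:
  assumes "x \<in> car C" "y \<in> car C"
  shows "gns_sq (x \<oplus> t \<odot> y) = gns_sq x + 2 * Re (t * \<phi> (x\<^sup>\<star> \<otimes> y)) + (cmod t)\<^sup>2 * gns_sq y"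
proof -
  have "gns_sq (x \<oplus> t \<odot> y) = gns_sq x + Re (t * \<phi> (x\<^sup>\<star> \<otimes> y)) + Re (cnj t * \<phi> (y\<^sup>\<star> \<otimes> x)) + (cmod t)\<^sup>2 * gns_sq y"
    unfolding gns_sq_def[of "x \<oplus> t \<odot> y"] pf_expand[OF assms] by (simp only: plus_complex.sel Re_complex_of_real)
  also have "Re (cnj t * \<phi> (y\<^sup>\<star> \<otimes> x)) = Re (t * \<phi> (x\<^sup>\<star> \<otimes> y))"
    unfolding pf_hermitian[OF assms] by simp
  finally show ?thesis by simp
qed

lemma pf_cauchy_schwarz:
  assumes "x \<in> car C" "y \<in> car C"
  shows "(cmod (\<phi> (x\<^sup>\<star> \<otimes> y)))\<^sup>2 \<le> gns_sq x * gns_sq y"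
proof -
  define c where "c = \<phi> (x\<^sup>\<star> \<otimes> y)"
  have q: "0 \<le> gns_sq x - 2 * r * (cmod c)\<^sup>2 + r\<^sup>2 * (cmod c)\<^sup>2 * gns_sq y" for r
  proof -
    have "Re ((- of_real r * cnj c) * c) = - r * (cmod c)\<^sup>2"
      using cmod_power2[of c] by (simp add: power2_eq_square) (simp add: algebra_simps)
    moreover have "0 \<le> gns_sq (x \<oplus> (- of_real r * cnj c) \<odot> y)" using assms by (simp add: gns_sq(2) ccloseds)
    ultimately show ?thesis
      unfolding gns_sq_expand[OF assms] c_def[symmetric] by (simp add: norm_mult power_mult_distrib)
  qed
  show ?thesis
  proof (cases "gns_sq y = 0")
    case True
    have "c = 0"
    proof (rule ccontr)
      assume "c \<noteq> 0"
      hence "(cmod c)\<^sup>2 > 0" by simp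
      thus False using q[of "(gns_sq x + 1) / (cmod c)\<^sup>2"] gns_sq(2)[OF assms(1)] True by simp
    qed
    thus ?thesis using True by (simp add: c_def)
  next
    case False
    hence y: "gns_sq y > 0" using gns_sq(2)[OF assms(2)] by simp
    have "0 \<le> gns_sq x - (cmod c)\<^sup>2 / gns_sq y"
      using q[of "1 / gns_sq y"] y by (simp add: power2_eq_square field_simps)
    thus ?thesis using y by (simp add: c_def field_simps)
  qed
qed

text \<open>For \<open>b = x\<^sup>\<star> x / c\<^sup>2\<close> with \<open>c > \<parallel>x\<parallel>\<close> and \<open>(1 - m)\<^sup>2 = 1 - b\<close>, the difference \<open>\<phi> (y\<^sup>\<star> y) - \<phi> (y\<^sup>\<star> b y)\<close> is \<open>\<phi> (w\<^sup>\<star> w)\<close> for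
  \<open>w = (1 - m) y\<close>. The choice \<open>c = \<parallel>x\<parallel> + 1\<close> avoids a limit.\<close>

lemma gns_sq_mul:
  assumes x: "x \<in> car C" and y: "y \<in> car C"
  shows "gns_sq (x \<otimes> y) \<le> (\<parallel>x\<parallel> + 1)\<^sup>2 * gns_sq y"
proof -
  define c where "c = \<parallel>x\<parallel> + 1"
  have c: "c > 0" "\<parallel>x\<parallel> < c" using norm_nonneg[OF x] by (simp_all add: c_def)
  define b where "b = complex_of_real (1 / c\<^sup>2) \<odot> (x\<^sup>\<star> \<otimes> x)"
  have bs: "selfadj b" unfolding b_def by (rule selfadj_scal[OF selfadj_mul_adj(2)[OF x]])
  hence b: "selfadj b" "b \<in> car C" by (simp_all add: selfadj_def)
  have "\<parallel>x\<parallel>\<^sup>2 < c\<^sup>2" using c norm_nonneg[OF x] by (intro power_strict_mono) auto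
  hence "\<parallel>b\<parallel> < 1"
    unfolding b_def using c by (simp add: norm_scal ccloseds x cstar_identity norm_divide norm_power)
  then obtain m where m: "selfadj m" "2 \<odot> m = b \<oplus> m \<otimes> m" using sqrt_witness[OF b(1)] by blast
  have mC: "m \<in> car C" "m\<^sup>\<star> = m" using m by (simp_all add: selfadj_def)
  have my: "2 \<odot> (m \<otimes> y) = b \<otimes> y \<oplus> m \<otimes> (m \<otimes> y)"
    using arg_cong[OF m(2), of "\<lambda>u. u \<otimes> y"] by (simp add: mul_scal_left mul_add_left mul_assoc mC b y ccloseds)
  have "\<phi> (y\<^sup>\<star> \<otimes> (2 \<odot> (m \<otimes> y))) = \<phi> (y\<^sup>\<star> \<otimes> (b \<otimes> y \<oplus> m \<otimes> (m \<otimes> y)))" by (simp only: my)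
  hence 1: "2 * \<phi> (y\<^sup>\<star> \<otimes> (m \<otimes> y)) = \<phi> (y\<^sup>\<star> \<otimes> (b \<otimes> y)) + \<phi> (y\<^sup>\<star> \<otimes> (m \<otimes> (m \<otimes> y)))"
    by (simp add: mul_scal_right mul_add_right pf_add pf_scal mC b y ccloseds)
  have 2: "\<phi> (y\<^sup>\<star> \<otimes> (b \<otimes> y)) = of_real (gns_sq (x \<otimes> y) / c\<^sup>2)"
    using gns_sq(1)[of "x \<otimes> y"]
    by (simp add: b_def mul_scal_left mul_scal_right mul_assoc adj_mul pf_scal x y ccloseds)
  have "\<phi> ((y \<ominus> m \<otimes> y)\<^sup>\<star> \<otimes> (y \<ominus> m \<otimes> y)) = of_real (gns_sq y) - of_real (gns_sq (x \<otimes> y) / c\<^sup>2)"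
    using 1 2 gns_sq(1)[OF y]
    by (simp add: adj_vsub adj_mul mul_vsub mul_assoc pf_vsub mC y ccloseds)
  hence "0 \<le> gns_sq y - gns_sq (x \<otimes> y) / c\<^sup>2"
    using gns_sq(2)[of "y \<ominus> m \<otimes> y"] by (simp add: gns_sq_def mC y ccloseds)
  hence "gns_sq (x \<otimes> y) \<le> c\<^sup>2 * gns_sq y" using c by (simp add: field_simps)
  thus ?thesis by (simp only: c_def)
qed

context
  fixes I F
  assumes contr: "\<And>x. x \<in> car C \<Longrightarrow> cmod (\<phi> x) \<le> \<parallel>x\<parallel>"
    and I: "lin_subspace C I" and I_left: "\<And>x y. \<lbrakk>x \<in> car C; y \<in> I\<rbrakk> \<Longrightarrow> x \<otimes> y \<in> I"
    and I_adj: "\<And>y. y \<in> I \<Longrightarrow> y\<^sup>\<star> \<in> I"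
    and F: "F \<noteq> bot" "\<forall>\<^sub>F v in F. v \<in> car C \<and> \<parallel>v\<parallel> \<le> 1"
    and unit: "\<And>y. y \<in> I \<Longrightarrow> ((\<lambda>v. \<parallel>v \<otimes> y \<ominus> y\<parallel>) \<longlongrightarrow> 0) F"
begin

lemma I_closed: "y \<in> I \<Longrightarrow> y \<in> car C" "\<zero> \<in> I" "\<lbrakk>x \<in> I; y \<in> I\<rbrakk> \<Longrightarrow> x \<oplus> y \<in> I" "y \<in> I \<Longrightarrow> c \<odot> y \<in> I"
  "\<lbrakk>x \<in> I; y \<in> I\<rbrakk> \<Longrightarrow> x \<ominus> y \<in> I"
  using I by (auto simp: lin_subspace_def vsub_def)

lemma ideal_limit:
  assumes y: "y \<in> I"
  shows "((\<lambda>v. \<phi> (v \<otimes> y)) \<longlongrightarrow> \<phi> y) F" "((\<lambda>v. \<phi> ((v \<otimes> y)\<^sup>\<star>)) \<longlongrightarrow> \<phi> (y\<^sup>\<star>)) F"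
proof -
  have yC: "y \<in> car C" using I_closed(1)[OF y] .
  have "\<forall>\<^sub>F v in F. cmod (\<phi> (v \<otimes> y) - \<phi> y) \<le> \<parallel>v \<otimes> y \<ominus> y\<parallel>"
    using F(2) by eventually_elim (use contr yC in \<open>simp add: pf_vsub[symmetric] ccloseds\<close>)
  thus "((\<lambda>v. \<phi> (v \<otimes> y)) \<longlongrightarrow> \<phi> y) F"
    using Lim_null_comparison[OF _ unit[OF y]] by (simp add: Lim_null[where l = "\<phi> y"])
  have "\<forall>\<^sub>F v in F. cmod (\<phi> ((v \<otimes> y)\<^sup>\<star>) - \<phi> (y\<^sup>\<star>)) \<le> \<parallel>v \<otimes> y \<ominus> y\<parallel>"
    using F(2)
  proof eventually_elim
    case (elim v)
    have "cmod (\<phi> ((v \<otimes> y \<ominus> y)\<^sup>\<star>)) \<le> \<parallel>v \<otimes> y \<ominus> y\<parallel>"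
      using contr[of "(v \<otimes> y \<ominus> y)\<^sup>\<star>"] norm_adj[of "v \<otimes> y \<ominus> y"] elim yC by (simp add: ccloseds)
    thus ?case using elim yC by (simp add: adj_vsub pf_vsub ccloseds)
  qed
  thus "((\<lambda>v. \<phi> ((v \<otimes> y)\<^sup>\<star>)) \<longlongrightarrow> \<phi> (y\<^sup>\<star>)) F"
    using Lim_null_comparison[OF _ unit[OF y]] by (simp add: Lim_null[where l = "\<phi> (y\<^sup>\<star>)"])
qed

text \<open>By Cauchy-Schwarz the bound holds for \<open>v y\<close> with \<open>\<parallel>v\<parallel> \<le> 1\<close>, and \<open>\<phi> (v y)\<close> tends to \<open>\<phi> y\<close>.\<close>

lemma ideal_bound:
  assumes y: "y \<in> I"
  shows "(cmod (\<phi> y))\<^sup>2 \<le> gns_sq y"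
proof -
  have yC: "y \<in> car C" using I_closed(1)[OF y] .
  have "\<forall>\<^sub>F v in F. (cmod (\<phi> (v \<otimes> y)))\<^sup>2 \<le> gns_sq y"
    using F(2)
  proof eventually_elim
    case (elim v)
    have "gns_sq (v\<^sup>\<star>) \<le> cmod (\<phi> (v \<otimes> v\<^sup>\<star>))"
      using elim by (simp add: gns_sq_def adj_adj complex_Re_le_cmod)
    also have "\<dots> \<le> \<parallel>v\<parallel>\<^sup>2" using contr[of "v \<otimes> v\<^sup>\<star>"] elim by (simp add: norm_mul_adj ccloseds)
    also have "\<dots> \<le> 1" using elim norm_nonneg[of v] by (simp add: power_le_one)
    finally have "gns_sq (v\<^sup>\<star>) * gns_sq y \<le> gns_sq y"
      using gns_sq(2)[OF yC] gns_sq(2)[of "v\<^sup>\<star>"] elim by (simp add: mult_left_le_one_le ccloseds)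
    thus ?case using pf_cauchy_schwarz[of "v\<^sup>\<star>" y] elim yC by (simp add: adj_adj ccloseds)
  qed
  moreover have "((\<lambda>v. (cmod (\<phi> (v \<otimes> y)))\<^sup>2) \<longlongrightarrow> (cmod (\<phi> y))\<^sup>2) F"
    by (intro tendsto_intros ideal_limit y)
  ultimately show ?thesis using F(1) by (intro tendsto_upperbound)
qed

lemma ideal_hermitian:
  assumes y: "y \<in> I"
  shows "\<phi> (y\<^sup>\<star>) = cnj (\<phi> y)"
proof (rule tendsto_unique[OF F(1) ideal_limit(2)[OF y]])
  have yC: "y \<in> car C" using I_closed(1)[OF y] .
  have "((\<lambda>v. cnj (\<phi> (v \<otimes> y))) \<longlongrightarrow> cnj (\<phi> y)) F" by (intro tendsto_intros ideal_limit y)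
  moreover have "\<forall>\<^sub>F v in F. cnj (\<phi> (v \<otimes> y)) = \<phi> ((v \<otimes> y)\<^sup>\<star>)"
    using F(2)
  proof eventually_elim
    case (elim v)
    thus ?case using pf_hermitian[of "v\<^sup>\<star>" y] yC by (simp add: adj_adj adj_mul ccloseds)
  qed
  ultimately show "((\<lambda>v. \<phi> ((v \<otimes> y)\<^sup>\<star>)) \<longlongrightarrow> cnj (\<phi> y)) F" by (rule Lim_transform_eventually)
qed

text \<open>The sequence minimises \<open>gns_sq y - 2 Re (\<phi> y)\<close> over the ideal. By the parallelogram identity it is
  Cauchy for the GNS seminorm, and minimality to first order says that it represents \<open>\<phi>\<close> on the ideal
  in the limit. In the GNS space it converges to the projection of the cyclic vector to the closure
  of the ideal.\<close>

lemma riesz_sequence: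
  obtains z where "\<And>n. z n \<in> I" "\<And>n. gns_sq (z n) \<le> 9"
    "\<And>n m. gns_sq (z n \<ominus> z m) \<le> 2 / real (Suc n) + 2 / real (Suc m)"
    "\<And>n y. y \<in> I \<Longrightarrow> (cmod (\<phi> y - \<phi> ((z n)\<^sup>\<star> \<otimes> y)))\<^sup>2 \<le> (gns_sq y + 1) / real (Suc n)"
proof -
  define J where "J y = gns_sq y - 2 * Re (\<phi> y)" for y
  have Jlow: "- 1 \<le> J y" if y: "y \<in> I" for y
  proof -
    define s where "s = sqrt (gns_sq y)"
    have s: "gns_sq y = s\<^sup>2" "s \<ge> 0" using gns_sq(2)[OF I_closed(1)[OF y]] by (simp_all add: s_def)
    have "Re (\<phi> y) \<le> cmod (\<phi> y)" by (rule complex_Re_le_cmod)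
    also have "cmod (\<phi> y) \<le> s" by (rule power2_le_imp_le[OF _ s(2)]) (use ideal_bound[OF y] s(1) in simp)
    finally have "s\<^sup>2 - 2 * s \<le> J y" by (simp add: J_def s)
    moreover have "0 \<le> (s - 1)\<^sup>2" by simp
    ultimately show ?thesis by (simp add: power2_eq_square algebra_simps)
  qed
  define d where "d = (INF y\<in>I. J y)"
  have bdd: "bdd_below (J ` I)" by (rule bdd_belowI2[of _ "- 1"]) (rule Jlow)
  have dJ: "d \<le> J y" if "y \<in> I" for y unfolding d_def by (rule cINF_lower[OF bdd that])
  have "\<exists>y\<in>I. J y < d + 1 / real (Suc n)" for n
  proof -
    have "d < d + 1 / real (Suc n)" by simp
    thus ?thesis using cInf_lessD[of "J ` I" "d + 1 / real (Suc n)"] I_closed(2) unfolding d_def by blast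
  qed
  then obtain z where z: "\<And>n. z n \<in> I" "\<And>n. J (z n) < d + 1 / real (Suc n)" by metis
  have zC: "z n \<in> car C" for n using I_closed(1)[OF z(1)] .
  \<comment> \<open>The sequence satisfies \<open>J (z n) \<le> J \<zero> + 1 = 1\<close>, that is, \<open>s\<^sup>2 - 2 s \<le> 1\<close> for \<open>s\<^sup>2 = gns_sq (z n)\<close>, so \<open>s \<le> 3\<close>.\<close>
  have "gns_sq (z n) \<le> 9" for n
  proof -
    define s where "s = sqrt (gns_sq (z n))"
    have s: "gns_sq (z n) = s\<^sup>2" "s \<ge> 0" using gns_sq(2)[OF zC] by (simp_all add: s_def)
    have "Re (\<phi> (z n)) \<le> s"
      using ideal_bound[OF z(1), of n] s complex_Re_le_cmod[of "\<phi> (z n)"] power2_le_imp_le[of "cmod (\<phi> (z n))" s]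
      by simp
    moreover have "J (z n) \<le> 1"
    proof -
      have "J \<zero> = 0" using pf_scal[OF zero_closed, of 0] pf_scal[of "\<zero>\<^sup>\<star> \<otimes> \<zero>" 0]
      by (simp add: J_def gns_sq_def zero_scal mul_zero ccloseds)
      moreover have "1 / real (Suc n) \<le> 1" by simp
      ultimately show ?thesis using z(2)[of n] dJ[OF I_closed(2)] by linarith
    qed
    ultimately have "s\<^sup>2 \<le> 1 + 2 * s" by (simp add: J_def s)
    hence "(s - 1)\<^sup>2 \<le> 2\<^sup>2" by (simp add: power2_eq_square algebra_simps)
    hence "s - 1 \<le> 2" by (rule power2_le_imp_le) simp
    hence "s\<^sup>2 \<le> 3\<^sup>2" using s by (intro power_mono) auto
    thus ?thesis by (simp add: s)
  qed
  moreover have "gns_sq (z n \<ominus> z m) \<le> 2 / real (Suc n) + 2 / real (Suc m)" for n m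
  proof -
    define w where "w = (1/2) \<odot> (z n \<oplus> 1 \<odot> z m)"
    have w: "w \<in> I" by (simp add: w_def I_closed z)
    have Nw: "gns_sq w = (gns_sq (z n) + 2 * Re (\<phi> ((z n)\<^sup>\<star> \<otimes> z m)) + gns_sq (z m)) / 4"
    proof -
      have "\<phi> (w\<^sup>\<star> \<otimes> w) = (1/4) * \<phi> ((z n \<oplus> 1 \<odot> z m)\<^sup>\<star> \<otimes> (z n \<oplus> 1 \<odot> z m))"
        unfolding w_def by (simp add: adj_scal mul_scal_left mul_scal_right scal_scal pf_scal zC ccloseds)
      from arg_cong[OF this, of Re] have "gns_sq w = gns_sq (z n \<oplus> 1 \<odot> z m) / 4"
        unfolding gns_sq_def by simp
      thus ?thesis unfolding gns_sq_expand[OF zC zC] by simp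
    qed
    have pw: "Re (\<phi> w) = (Re (\<phi> (z n)) + Re (\<phi> (z m))) / 2"
      by (simp add: w_def pf_scal pf_add zC ccloseds)
    have Nd: "gns_sq (z n \<ominus> z m) = gns_sq (z n) - 2 * Re (\<phi> ((z n)\<^sup>\<star> \<otimes> z m)) + gns_sq (z m)"
      unfolding vsub_def gns_sq_expand[OF zC zC] by simp
    have "gns_sq (z n \<ominus> z m) = 2 * (J (z n) + J (z m) - 2 * J w)"
      unfolding Nd J_def Nw pw by (simp add: field_simps)
    thus ?thesis using dJ[OF w] z(2)[of n] z(2)[of m] by simp
  qed
  moreover have "(cmod (\<phi> y - \<phi> ((z n)\<^sup>\<star> \<otimes> y)))\<^sup>2 \<le> (gns_sq y + 1) / real (Suc n)" if y: "y \<in> I" for n y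
  proof -
    have yC: "y \<in> car C" using I_closed(1)[OF y] .
    define w where "w = \<phi> y - \<phi> ((z n)\<^sup>\<star> \<otimes> y)"
    \<comment> \<open>Moving from \<open>z n\<close> in the direction \<open>t y\<close> cannot lower \<open>J\<close> below its infimum; \<open>r\<close> makes the quadratic term at most half of the linear one.\<close>
    define r where "r = 1 / (gns_sq y + 1)"
    have N0: "0 \<le> gns_sq y" by (rule gns_sq(2)[OF yC])
    have r: "r > 0" "r * gns_sq y \<le> 1" using N0 by (simp_all add: r_def)
    define t where "t = of_real r * cnj w"
    have "J (z n \<oplus> t \<odot> y) = J (z n) - 2 * Re (t * w) + (cmod t)\<^sup>2 * gns_sq y"
      unfolding J_def gns_sq_expand[OF zC yC] by (simp add: pf_add pf_scal zC yC ccloseds w_def algebra_simps)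
    moreover have "Re (t * w) = r * (cmod w)\<^sup>2"
      using cmod_power2[of w] by (simp add: t_def power2_eq_square) (simp add: algebra_simps)
    moreover have "(cmod t)\<^sup>2 = r\<^sup>2 * (cmod w)\<^sup>2" by (simp add: t_def norm_mult power_mult_distrib)
    moreover have "d \<le> J (z n \<oplus> t \<odot> y)" by (intro dJ I_closed z y)
    ultimately have "2 * (r * (cmod w)\<^sup>2) - r\<^sup>2 * (cmod w)\<^sup>2 * gns_sq y \<le> 1 / real (Suc n)"
      using z(2)[of n] by simp
    moreover have "r\<^sup>2 * (cmod w)\<^sup>2 * gns_sq y \<le> r * (cmod w)\<^sup>2"
    proof -
      have "r\<^sup>2 * (cmod w)\<^sup>2 * gns_sq y = (r * gns_sq y) * (r * (cmod w)\<^sup>2)" by (simp add: power2_eq_square)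
      also have "\<dots> \<le> 1 * (r * (cmod w)\<^sup>2)" using r by (intro mult_right_mono) auto
      finally show ?thesis by simp
    qed
    ultimately have "r * (cmod w)\<^sup>2 \<le> 1 / real (Suc n)" by linarith
    thus ?thesis using N0 by (simp add: r_def w_def field_simps)
  qed
  ultimately show thesis using that[of z] z(1) by blast
qed

text \<open>Let \<open>z\<close> be a sequence as in \<open>riesz_sequence\<close>. The functional \<open>\<rho> x = lim \<phi> (x z\<^sub>n)\<close> satisfies \<open>\<rho> (x\<^sup>\<star> x) = lim gns_sq (x z\<^sub>n)\<close>, so it is
  positive, and Cauchy-Schwarz for \<open>x\<close> and \<open>x z\<^sub>n\<close> gives \<open>\<rho> (x\<^sup>\<star> x) \<le> \<phi> (x\<^sup>\<star> x)\<close>. Purity makes \<open>\<rho>\<close> a multiple of \<open>\<phi>\<close>, and since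
  they agree on the ideal, where \<open>\<phi>\<close> does not vanish, they are equal. So \<open>\<phi> x\<close> is close to \<open>\<phi> (x z\<^sub>n)\<close> for one \<open>n\<close>, uniformly for
  bounded \<open>x\<close>; replacing \<open>x\<close> by \<open>x v\<close> and using \<open>v z\<^sub>n \<approx> z\<^sub>n\<close> gives the claim.\<close>

lemma pure_ideal_unit:
  assumes pure: "pure_state C \<phi>" and nz: "w \<in> I" "\<phi> w \<noteq> 0" and \<epsilon>: "\<epsilon> > 0"
  shows "\<forall>\<^sub>F v in F. \<forall>x\<in>car C. cmod (\<phi> (x \<otimes> v) - \<phi> x) \<le> \<epsilon> * (\<parallel>x\<parallel> + 1)"
proof -
  obtain z where z: "\<And>n. z n \<in> I" and z9: "\<And>n. gns_sq (z n) \<le> 9"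
    and zz: "\<And>n m. gns_sq (z n \<ominus> z m) \<le> 2 / real (Suc n) + 2 / real (Suc m)"
    and zr: "\<And>n y. y \<in> I \<Longrightarrow> (cmod (\<phi> y - \<phi> ((z n)\<^sup>\<star> \<otimes> y)))\<^sup>2 \<le> (gns_sq y + 1) / real (Suc n)"
    using riesz_sequence by blast
  have zC: "z n \<in> car C" for n using I_closed(1)[OF z] .
  define \<delta> where "\<delta> n = sqrt (2 / real (Suc n))" for n
  have inv: "(\<lambda>n. a / real (Suc n)) \<longlonglongrightarrow> 0" for a
    using tendsto_mult_right_zero[OF LIMSEQ_inverse_real_of_nat, of a] by (simp add: divide_inverse)
  have \<delta>0: "\<delta> \<longlonglongrightarrow> 0"
    unfolding \<delta>_def using tendsto_real_sqrt[OF inv[of 2]] by simp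
  have zr': "(\<lambda>n. \<phi> ((z n)\<^sup>\<star> \<otimes> y)) \<longlonglongrightarrow> \<phi> y" if y: "y \<in> I" for y
  proof -
    have le: "cmod (\<phi> ((z n)\<^sup>\<star> \<otimes> y) - \<phi> y) \<le> sqrt ((gns_sq y + 1) / real (Suc n))" for n
      using zr[OF y, of n] by (simp add: norm_minus_commute real_le_rsqrt)
    have lim: "(\<lambda>n. sqrt ((gns_sq y + 1) / real (Suc n))) \<longlonglongrightarrow> 0"
      using tendsto_real_sqrt[OF inv] by simp
    show ?thesis
      by (rule LIM_zero_cancel, rule Lim_null_comparison[OF always_eventually[OF allI[OF le]] lim])
  qed
  have step: "cmod (\<phi> (x \<otimes> z n) - \<phi> (x \<otimes> z m)) \<le> (\<parallel>x\<parallel> + 1) * sqrt (2 / real (Suc n) + 2 / real (Suc m))"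
    if x: "x \<in> car C" for x n m
  proof -
    have xz: "x \<otimes> (z n \<ominus> z m) \<in> I" by (intro I_left x I_closed z)
    have "(cmod (\<phi> (x \<otimes> (z n \<ominus> z m))))\<^sup>2 \<le> (\<parallel>x\<parallel> + 1)\<^sup>2 * gns_sq (z n \<ominus> z m)"
      using ideal_bound[OF xz] gns_sq_mul[OF x vsub_closed[OF zC zC], of n m] by simp
    also have "\<dots> \<le> (\<parallel>x\<parallel> + 1)\<^sup>2 * (2 / real (Suc n) + 2 / real (Suc m))"
      using zz by (intro mult_left_mono) auto
    finally have "cmod (\<phi> (x \<otimes> (z n \<ominus> z m))) \<le> sqrt ((\<parallel>x\<parallel> + 1)\<^sup>2 * (2 / real (Suc n) + 2 / real (Suc m)))"
      by (rule real_le_rsqrt)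
    thus ?thesis using norm_nonneg[OF x] by (simp add: mul_vsub pf_vsub x zC ccloseds real_sqrt_mult)
  qed
  have conv: "convergent (\<lambda>n. \<phi> (x \<otimes> z n))" if x: "x \<in> car C" for x
  proof (rule Cauchy_convergent, rule metric_CauchyI)
    fix e :: real assume e: "e > 0"
    have K: "\<parallel>x\<parallel> + 1 > 0" using norm_nonneg[OF x] by simp
    have "(\<lambda>n. (\<parallel>x\<parallel> + 1) * sqrt (4 / real (Suc n))) \<longlonglongrightarrow> (\<parallel>x\<parallel> + 1) * sqrt 0"
      by (intro tendsto_intros inv)
    hence "\<forall>\<^sub>F n in sequentially. (\<parallel>x\<parallel> + 1) * sqrt (4 / real (Suc n)) < e"
      using e by (intro order_tendstoD(2)) auto
    then obtain N where N: "(\<parallel>x\<parallel> + 1) * sqrt (4 / real (Suc N)) < e" by (auto simp: eventually_sequentially)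
    have "dist (\<phi> (x \<otimes> z m)) (\<phi> (x \<otimes> z n)) < e" if "m \<ge> N" "n \<ge> N" for m n
    proof -
      have "2 / real (Suc m) \<le> 2 / real (Suc N)" "2 / real (Suc n) \<le> 2 / real (Suc N)"
        using that by (simp_all add: field_simps)
      hence "sqrt (2 / real (Suc m) + 2 / real (Suc n)) \<le> sqrt (4 / real (Suc N))" by simp
      hence "(\<parallel>x\<parallel> + 1) * sqrt (2 / real (Suc m) + 2 / real (Suc n)) \<le> (\<parallel>x\<parallel> + 1) * sqrt (4 / real (Suc N))"
        using K by (intro mult_left_mono) auto
      thus ?thesis using step[OF x, of m n] N by (simp add: dist_norm)
    qed
    thus "\<exists>M. \<forall>m\<ge>M. \<forall>n\<ge>M. dist (\<phi> (x \<otimes> z m)) (\<phi> (x \<otimes> z n)) < e" by blast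
  qed
  define \<rho> where "\<rho> x = lim (\<lambda>n. \<phi> (x \<otimes> z n))" for x
  have \<rho>: "(\<lambda>n. \<phi> (x \<otimes> z n)) \<longlonglongrightarrow> \<rho> x" if "x \<in> car C" for x
    using conv[OF that] by (simp add: \<rho>_def convergent_LIMSEQ_iff)
  have \<rho>_rate: "cmod (\<phi> (x \<otimes> z n) - \<rho> x) \<le> (\<parallel>x\<parallel> + 1) * \<delta> n" if x: "x \<in> car C" for x n
  proof (rule tendsto_le[OF sequentially_bot])
    show "(\<lambda>m. (\<parallel>x\<parallel> + 1) * sqrt (2 / real (Suc n) + 2 / real (Suc m))) \<longlonglongrightarrow> (\<parallel>x\<parallel> + 1) * \<delta> n"
      unfolding \<delta>_def using inv[of 2] by (intro tendsto_intros) (auto intro: tendsto_eq_intros)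
    show "(\<lambda>m. cmod (\<phi> (x \<otimes> z n) - \<phi> (x \<otimes> z m))) \<longlonglongrightarrow> cmod (\<phi> (x \<otimes> z n) - \<rho> x)"
      by (intro tendsto_intros \<rho> x)
  qed (use step[OF x] in \<open>auto intro: always_eventually\<close>)
  have \<rho>_diag: "(\<lambda>n. of_real (gns_sq (x \<otimes> z n))) \<longlonglongrightarrow> \<rho> (x\<^sup>\<star> \<otimes> x)" if x: "x \<in> car C" for x
  proof -
    define b where "b = x\<^sup>\<star> \<otimes> x"
    have bC: "b \<in> car C" by (simp add: b_def x ccloseds)
    have e: "of_real (gns_sq (x \<otimes> z n)) = \<phi> ((z n)\<^sup>\<star> \<otimes> (b \<otimes> z n))" for n
      using gns_sq(1)[of "x \<otimes> z n"] by (simp add: b_def x zC ccloseds adj_mul mul_assoc)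
    have le: "cmod (\<phi> (b \<otimes> z n) - \<phi> ((z n)\<^sup>\<star> \<otimes> (b \<otimes> z n))) \<le> \<delta> n * (3 * (\<parallel>b\<parallel> + 1))" for n
    proof (rule tendsto_le[OF sequentially_bot])
      have bz: "b \<otimes> z n \<in> I" by (intro I_left bC z)
      have bzC: "b \<otimes> z n \<in> car C" by (rule I_closed(1)[OF bz])
      show "(\<lambda>m. cmod (\<phi> ((z m)\<^sup>\<star> \<otimes> (b \<otimes> z n)) - \<phi> ((z n)\<^sup>\<star> \<otimes> (b \<otimes> z n)))) \<longlonglongrightarrow>
          cmod (\<phi> (b \<otimes> z n) - \<phi> ((z n)\<^sup>\<star> \<otimes> (b \<otimes> z n)))"
        by (intro tendsto_intros zr' bz)
      show "(\<lambda>m. sqrt (2 / real (Suc m) + 2 / real (Suc n)) * (3 * (\<parallel>b\<parallel> + 1))) \<longlonglongrightarrow> \<delta> n * (3 * (\<parallel>b\<parallel> + 1))"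
        unfolding \<delta>_def using inv[of 2] by (intro tendsto_intros) (auto intro: tendsto_eq_intros)
      have "cmod (\<phi> ((z m)\<^sup>\<star> \<otimes> (b \<otimes> z n)) - \<phi> ((z n)\<^sup>\<star> \<otimes> (b \<otimes> z n))) \<le>
          sqrt (2 / real (Suc m) + 2 / real (Suc n)) * (3 * (\<parallel>b\<parallel> + 1))" for m
      proof -
        have dC: "z m \<ominus> z n \<in> car C" by (intro ccloseds zC)
        have "gns_sq (b \<otimes> z n) \<le> 3\<^sup>2 * (\<parallel>b\<parallel> + 1)\<^sup>2"
          using gns_sq_mul[OF bC zC, of n] mult_left_mono[OF z9[of n], of "(\<parallel>b\<parallel> + 1)\<^sup>2"] by simp
        hence "gns_sq (z m \<ominus> z n) * gns_sq (b \<otimes> z n) \<le>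
            (2 / real (Suc m) + 2 / real (Suc n)) * (3\<^sup>2 * (\<parallel>b\<parallel> + 1)\<^sup>2)"
          by (intro mult_mono zz) (auto intro!: gns_sq bzC)
        hence "(cmod (\<phi> ((z m \<ominus> z n)\<^sup>\<star> \<otimes> (b \<otimes> z n))))\<^sup>2 \<le>
            (2 / real (Suc m) + 2 / real (Suc n)) * (3 * (\<parallel>b\<parallel> + 1))\<^sup>2"
          unfolding power_mult_distrib by (rule order_trans[OF pf_cauchy_schwarz[OF dC bzC]])
        hence "cmod (\<phi> ((z m \<ominus> z n)\<^sup>\<star> \<otimes> (b \<otimes> z n))) \<le>
            sqrt ((2 / real (Suc m) + 2 / real (Suc n)) * (3 * (\<parallel>b\<parallel> + 1))\<^sup>2)"
          by (rule real_le_rsqrt)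
        thus ?thesis using norm_nonneg[OF bC]
          by (simp add: real_sqrt_mult adj_vsub mul_vsub pf_vsub zC bzC ccloseds)
      qed
      thus "\<forall>\<^sub>F m in sequentially. cmod (\<phi> ((z m)\<^sup>\<star> \<otimes> (b \<otimes> z n)) - \<phi> ((z n)\<^sup>\<star> \<otimes> (b \<otimes> z n))) \<le>
          sqrt (2 / real (Suc m) + 2 / real (Suc n)) * (3 * (\<parallel>b\<parallel> + 1))" by simp
    qed
    have "(\<lambda>n. \<phi> (b \<otimes> z n) - \<phi> ((z n)\<^sup>\<star> \<otimes> (b \<otimes> z n))) \<longlonglongrightarrow> 0"
      by (rule Lim_null_comparison[OF always_eventually[OF allI[OF le]] tendsto_mult_left_zero[OF \<delta>0]])
    from tendsto_diff[OF \<rho>[OF bC] this] show ?thesis by (simp add: b_def[symmetric] e)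
  qed
  have \<rho>_real: "\<rho> (x\<^sup>\<star> \<otimes> x) = of_real (Re (\<rho> (x\<^sup>\<star> \<otimes> x)))" "0 \<le> Re (\<rho> (x\<^sup>\<star> \<otimes> x))"
    "Re (\<rho> (x\<^sup>\<star> \<otimes> x)) \<le> gns_sq x" if x: "x \<in> car C" for x
  proof -
    define L where "L = Re (\<rho> (x\<^sup>\<star> \<otimes> x))"
    have L: "(\<lambda>n. gns_sq (x \<otimes> z n)) \<longlonglongrightarrow> L" using tendsto_Re[OF \<rho>_diag[OF x]] by (simp add: L_def)
    have "(\<lambda>n. complex_of_real (gns_sq (x \<otimes> z n))) \<longlonglongrightarrow> of_real L" by (intro tendsto_intros L)
    from LIMSEQ_unique[OF \<rho>_diag[OF x] this] have r': "\<rho> (x\<^sup>\<star> \<otimes> x) = of_real L" .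
    thus r: "\<rho> (x\<^sup>\<star> \<otimes> x) = of_real (Re (\<rho> (x\<^sup>\<star> \<otimes> x)))" unfolding L_def .
    have xz: "x \<otimes> z n \<in> car C" for n by (simp add: x zC ccloseds)
    have L0: "0 \<le> L" by (rule LIMSEQ_le_const[OF L]) (use gns_sq(2)[OF xz] in auto)
    thus "0 \<le> Re (\<rho> (x\<^sup>\<star> \<otimes> x))" by (simp add: L_def)
    have "L\<^sup>2 \<le> gns_sq x * L"
    proof (rule tendsto_le[OF sequentially_bot])
      show "(\<lambda>n. gns_sq x * gns_sq (x \<otimes> z n)) \<longlonglongrightarrow> gns_sq x * L" by (intro tendsto_intros L)
      have "(\<lambda>n. (cmod (\<phi> ((x\<^sup>\<star> \<otimes> x) \<otimes> z n)))\<^sup>2) \<longlonglongrightarrow> (cmod (\<rho> (x\<^sup>\<star> \<otimes> x)))\<^sup>2"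
        by (intro tendsto_intros \<rho>) (simp add: x ccloseds)
      thus "(\<lambda>n. (cmod (\<phi> ((x\<^sup>\<star> \<otimes> x) \<otimes> z n)))\<^sup>2) \<longlonglongrightarrow> L\<^sup>2" using L0 by (simp add: r' del: of_real_power)
      show "\<forall>\<^sub>F n in sequentially. (cmod (\<phi> ((x\<^sup>\<star> \<otimes> x) \<otimes> z n)))\<^sup>2 \<le> gns_sq x * gns_sq (x \<otimes> z n)"
        using pf_cauchy_schwarz[OF x xz] by (simp add: mul_assoc x zC ccloseds)
    qed
    thus "Re (\<rho> (x\<^sup>\<star> \<otimes> x)) \<le> gns_sq x"
      using L0 gns_sq(2)[OF x] by (cases "L = 0") (simp_all add: L_def[symmetric] power2_eq_square)
  qed
  have "\<rho> (x \<oplus> y) = \<rho> x + \<rho> y" if "x \<in> car C" "y \<in> car C" for x y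
  proof (rule LIMSEQ_unique[OF \<rho>])
    show "(\<lambda>n. \<phi> ((x \<oplus> y) \<otimes> z n)) \<longlonglongrightarrow> \<rho> x + \<rho> y"
      using tendsto_add[OF \<rho>[OF that(1)] \<rho>[OF that(2)]] by (simp add: mul_add_left pf_add zC that ccloseds)
  qed (simp add: that ccloseds)
  moreover have "\<rho> (c \<odot> x) = c * \<rho> x" if "x \<in> car C" for c x
  proof (rule LIMSEQ_unique[OF \<rho>])
    show "(\<lambda>n. \<phi> ((c \<odot> x) \<otimes> z n)) \<longlonglongrightarrow> c * \<rho> x"
      using tendsto_mult_left[OF \<rho>[OF that], of c] by (simp add: mul_scal_left pf_scal zC that ccloseds)
  qed (simp add: that ccloseds)
  moreover have "\<rho> (x\<^sup>\<star> \<otimes> x) \<in> \<real>\<^sub>\<ge>\<^sub>0" "\<phi> (x\<^sup>\<star> \<otimes> x) - \<rho> (x\<^sup>\<star> \<otimes> x) \<in> \<real>\<^sub>\<ge>\<^sub>0" if x: "x \<in> car C" for x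
  proof -
    show "\<rho> (x\<^sup>\<star> \<otimes> x) \<in> \<real>\<^sub>\<ge>\<^sub>0" by (subst \<rho>_real(1)[OF x]) (use \<rho>_real(2)[OF x] in simp)
    show "\<phi> (x\<^sup>\<star> \<otimes> x) - \<rho> (x\<^sup>\<star> \<otimes> x) \<in> \<real>\<^sub>\<ge>\<^sub>0"
      unfolding gns_sq(1)[OF x] by (subst \<rho>_real(1)[OF x]) (use \<rho>_real(3)[OF x] in \<open>simp flip: of_real_diff\<close>)
  qed
  ultimately have "positive_functional C \<rho> \<and> positive_functional C (\<lambda>x. \<phi> x - \<rho> x)"
    by (simp add: positive_functional_def pf_add pf_scal algebra_simps)
  then obtain t :: real where t: "\<And>x. x \<in> car C \<Longrightarrow> \<rho> x = of_real t * \<phi> x"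
    using pure unfolding pure_state_def by blast
  have "\<rho> w = \<phi> w"
  proof (rule LIMSEQ_unique[OF \<rho>[OF I_closed(1)[OF nz(1)]]])
    have "\<phi> (w \<otimes> z n) = cnj (\<phi> ((z n)\<^sup>\<star> \<otimes> w\<^sup>\<star>))" for n
      using pf_hermitian[of "z n" "w\<^sup>\<star>"] I_closed(1)[OF nz(1)] by (simp add: adj_adj zC ccloseds)
    moreover have "(\<lambda>n. cnj (\<phi> ((z n)\<^sup>\<star> \<otimes> w\<^sup>\<star>))) \<longlonglongrightarrow> cnj (\<phi> (w\<^sup>\<star>))"
      by (intro tendsto_intros zr' I_adj nz)
    ultimately show "(\<lambda>n. \<phi> (w \<otimes> z n)) \<longlonglongrightarrow> \<phi> w" by (simp add: ideal_hermitian[OF nz(1)])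
  qed
  hence "t = 1" using t[OF I_closed(1)[OF nz(1)]] nz(2) by simp
  hence rate: "cmod (\<phi> (x \<otimes> z n) - \<phi> x) \<le> (\<parallel>x\<parallel> + 1) * \<delta> n" if "x \<in> car C" for x n
    using \<rho>_rate[OF that, of n] t[OF that] by simp
  obtain n where n: "\<delta> n < \<epsilon> / 3"
    using order_tendstoD(2)[OF \<delta>0, of "\<epsilon> / 3"] \<epsilon> by (auto simp: eventually_sequentially)
  have "\<forall>\<^sub>F v in F. \<parallel>v \<otimes> z n \<ominus> z n\<parallel> < \<epsilon> / 3"
    using order_tendstoD(2)[OF unit[OF z, of n], of "\<epsilon> / 3"] \<epsilon> by simp
  thus ?thesis
    using F(2)
  proof eventually_elim
    case (elim v)
    show ?case
    proof
      fix x assume x: "x \<in> car C"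
      have v: "v \<in> car C" using elim by simp
      have K: "0 \<le> \<parallel>x\<parallel>" "\<delta> n \<ge> 0" using norm_nonneg[OF x] by (auto simp: \<delta>_def)
      have "\<parallel>x \<otimes> v\<parallel> \<le> \<parallel>x\<parallel>" using norm_mul[OF x v] elim K by (meson mult_left_le order_trans)
      hence "(\<parallel>x \<otimes> v\<parallel> + 1) * \<delta> n \<le> (\<parallel>x\<parallel> + 1) * \<delta> n" using K by (intro mult_right_mono) auto
      also have "\<dots> \<le> (\<parallel>x\<parallel> + 1) * (\<epsilon> / 3)" using n K by (intro mult_left_mono) auto
      finally have 1: "cmod (\<phi> ((x \<otimes> v) \<otimes> z n) - \<phi> (x \<otimes> v)) \<le> (\<parallel>x\<parallel> + 1) * (\<epsilon> / 3)"
        using rate[of "x \<otimes> v" n] x v by (simp add: ccloseds)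
      have "(\<parallel>x\<parallel> + 1) * \<delta> n \<le> (\<parallel>x\<parallel> + 1) * (\<epsilon> / 3)" using n K by (intro mult_left_mono) auto
      hence 2: "cmod (\<phi> (x \<otimes> z n) - \<phi> x) \<le> (\<parallel>x\<parallel> + 1) * (\<epsilon> / 3)" using rate[OF x, of n] by simp
      have "cmod (\<phi> (x \<otimes> (v \<otimes> z n \<ominus> z n))) \<le> \<parallel>x\<parallel> * \<parallel>v \<otimes> z n \<ominus> z n\<parallel>"
        using contr[of "x \<otimes> (v \<otimes> z n \<ominus> z n)"] norm_mul[of x "v \<otimes> z n \<ominus> z n"] x v zC
        by (simp add: ccloseds)
      also have "\<dots> \<le> (\<parallel>x\<parallel> + 1) * (\<epsilon> / 3)"
        using elim K norm_nonneg[of "v \<otimes> z n \<ominus> z n"] v zC by (intro mult_mono) (auto simp: ccloseds)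
      finally have 3: "cmod (\<phi> ((x \<otimes> v) \<otimes> z n) - \<phi> (x \<otimes> z n)) \<le> (\<parallel>x\<parallel> + 1) * (\<epsilon> / 3)"
        by (simp add: mul_vsub pf_vsub mul_assoc x v zC ccloseds)
      have tri: "cmod (p - s) \<le> cmod (q - p) + cmod (q - r) + cmod (r - s)" for p q r s by norm
      have "cmod (\<phi> (x \<otimes> v) - \<phi> x) \<le> 3 * ((\<parallel>x\<parallel> + 1) * (\<epsilon> / 3))"
        using 1 2 3 tri[of "\<phi> (x \<otimes> v)" "\<phi> x" "\<phi> ((x \<otimes> v) \<otimes> z n)" "\<phi> (x \<otimes> z n)"] by linarith
      thus "cmod (\<phi> (x \<otimes> v) - \<phi> x) \<le> \<epsilon> * (\<parallel>x\<parallel> + 1)" by (simp add: mult.commute)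
    qed
  qed
qed

end
end
end

section \<open>Inverse semigroups and normal forms in the expansion\<close>

lemma idem_sinv_mult: "s * sinv s \<in> idem" "sinv s * s \<in> idem"
  by (simp_all add: idem_def sinv_idems)

lemma idem_mult: assumes "e \<in> idem" "f \<in> idem" shows "e * f \<in> idem"
proof -
  have "e * f * (e * f) = e * (f * e) * f" by (simp only: mult.assoc)
  also have "f * e = e * f" using assms by (intro idem_commute) (simp_all add: idem_def)
  also have "e * (e * f) * f = (e * e) * (f * f)" by (simp only: mult.assoc)
  finally show ?thesis using assms by (simp add: idem_def)
qed

lemma idem_comm: "\<lbrakk>e \<in> idem; f \<in> idem\<rbrakk> \<Longrightarrow> e * f = f * e"
  by (simp add: idem_def idem_commute)

lemma sinv_idem': "e \<in> idem \<Longrightarrow> sinv e = e"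
  by (simp add: idem_def sinv_idem)

lemma idem_conj:
  assumes "e \<in> idem" shows "t * e = t * e * sinv t * t" "t * e * sinv t \<in> idem"
proof -
  have "t * e * sinv t * t = t * (e * (sinv t * t))" by (simp only: mult.assoc)
  also have "\<dots> = t * ((sinv t * t) * e)" using idem_comm[OF assms idem_sinv_mult(2)] by simp
  also have "\<dots> = t * e" using sinv_props(1)[of t] by (simp add: mult.assoc[symmetric])
  finally show 1: "t * e = t * e * sinv t * t" by simp
  have "(t * e * sinv t) * (t * e * sinv t) = (t * e * sinv t * t) * e * sinv t" by (simp only: mult.assoc)
  also have "\<dots> = t * (e * e) * sinv t" by (simp only: 1[symmetric]) (simp only: mult.assoc)
  finally show "t * e * sinv t \<in> idem" using assms by (simp add: idem_def)
qed

lemma nat_leD: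
  assumes "nat_le s t"
  shows "t * (sinv s * s) = s" "\<exists>e\<in>idem. s = e * t"
proof -
  obtain e where e: "e \<in> idem" "s = t * e" using assms by (auto simp: nat_le_def)
  have "t * (sinv s * s) = t * (e * (sinv t * t) * e)"
    by (simp add: e sinv_mult sinv_idem' mult.assoc)
  also have "e * (sinv t * t) = sinv t * t * e" by (rule idem_comm[OF e(1) idem_sinv_mult(2)])
  also have "t * (sinv t * t * e * e) = (t * sinv t * t) * (e * e)" by (simp only: mult.assoc)
  finally show "t * (sinv s * s) = s" using e by (simp add: sinv_props idem_def)
  show "\<exists>e\<in>idem. s = e * t" using idem_conj[OF e(1), of t] e(2) by metis
qed

lemma nat_le_left: assumes "e \<in> idem" shows "nat_le (e * t) t"
proof -
  have "e * t = sinv (sinv t * e)" using assms by (simp add: sinv_mult sinv_idem')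
  also have "sinv t * e = sinv t * e * t * sinv t" using idem_conj(1)[OF assms, of "sinv t"] by simp
  also have "sinv \<dots> = t * (sinv t * e * t)" using assms by (simp add: sinv_mult sinv_idem' mult.assoc)
  finally show ?thesis using idem_conj(2)[OF assms, of "sinv t"] by (auto simp: nat_le_def)
qed

lemma nat_le_right: "e \<in> idem \<Longrightarrow> nat_le (t * e) t"
  by (auto simp: nat_le_def)

lemma pr_deg_sinv: "pr_deg (sinv x) = sinv (pr_deg x)"
  by (rule sinv_eqI[symmetric]) (simp_all flip: pr_deg_simps(2) add: sinv_props)

lemma pr_deg_idem: "e \<in> idem \<Longrightarrow> pr_deg e \<in> idem"
  by (simp add: idem_def flip: pr_deg_simps(2))

lemma nat_le_pr_deg: "nat_le x y \<Longrightarrow> nat_le (pr_deg x) (pr_deg y)"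
  using pr_deg_idem by (fastforce simp: nat_le_def)

lemma sinv_pgen: "sinv (pgen s) = pgen (sinv s)"
  using pgen_rels(3)[of s] pgen_rels(3)[of "sinv s"] by (intro sinv_eqI) simp_all

lemma eps_prods_idem': "a \<in> eps_prods \<Longrightarrow> a \<in> idem"
  by (simp add: idem_def eps_prods_idem)

lemma pgen_in_idem: "e \<in> idem \<Longrightarrow> pgen e \<in> idem"
  using eps_prods_idem'[OF eps_prods.intros(1), of e] by (simp add: idem_def pgen_idem)

lemma pr_decomp_deg: "\<exists>a\<in>idem. x = a * pgen (pr_deg x)"
proof -
  obtain a r where a: "a \<in> eps_prods" "x = a * pgen r" using pr_decomp by blast
  hence "x = a * pgen (pr_deg x)" unfolding a(2) pr_deg_simps by (intro eps_prods_pgen)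
  thus ?thesis using eps_prods_idem'[OF a(1)] by blast
qed

lemma nat_le_pgen_deg: "nat_le x (pgen (pr_deg x))"
  using pr_decomp_deg[of x] nat_le_left by metis

lemma pgen_mult: "pgen s * pgen t = eps s * pgen (s * t)"
proof -
  have "pgen s * pgen t = pgen s * pgen (sinv s) * pgen s * pgen t" by (simp only: pgen_rels)
  also have "\<dots> = pgen s * (pgen (sinv s) * pgen s * pgen t)" by (simp only: mult.assoc)
  also have "\<dots> = eps s * pgen (s * t)" unfolding pgen_rels(2) by (simp only: eps_def mult.assoc)
  finally show ?thesis .
qed

lemma eps_in_idem: "eps s \<in> idem"
  by (rule eps_prods_idem'[OF eps_prods.intros(1)])

text \<open>This lifts an idempotent below \<open>pr_deg x\<close> to one below \<open>x\<close>.\<close>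

lemma mult_pgen_idem:
  assumes e: "e \<in> idem" and le: "nat_le e (pr_deg x)"
  shows "x * pgen e \<in> idem" "nat_le (x * pgen e) x" "pr_deg (x * pgen e) = e"
proof -
  obtain a where a: "a \<in> idem" "x = a * pgen (pr_deg x)" using pr_decomp_deg by blast
  have se: "pr_deg x * e = e" using nat_leD(1)[OF le] e by (simp add: sinv_idem' idem_def)
  thus "pr_deg (x * pgen e) = e" by simp
  have "x * pgen e = a * (eps (pr_deg x) * pgen e)"
    by (subst a(2)) (simp add: mult.assoc pgen_mult se)
  thus "x * pgen e \<in> idem" using a(1) eps_in_idem[of "pr_deg x"] pgen_in_idem[OF e] by (auto intro!: idem_mult)
  show "nat_le (x * pgen e) x" by (rule nat_le_right[OF pgen_in_idem[OF e]])
qed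

abbreviation eps_fold :: "'g::inverse_semigroup list \<Rightarrow> 'g pr \<Rightarrow> 'g pr" where
  "eps_fold rs \<equiv> foldr (\<lambda>s y. eps s * y) rs"

lemma eps_prods_fold:
  "a \<in> eps_prods \<Longrightarrow> \<exists>rs. \<forall>y. a * y = eps_fold rs y"
proof (induction rule: eps_prods.induct)
  case (1 s)
  show ?case by (rule exI[of _ "[s]"]) simp
next
  case (2 a s)
  then obtain rs where "\<forall>y. a * y = eps_fold rs y" by blast
  thus ?case by (intro exI[of _ "s # rs"]) (simp add: mult.assoc)
qed

lemma pr_deg_eps: "pr_deg (eps s) = s * sinv s"
  by (simp add: eps_def)

lemma eps_fold_deg_absorb:
  "u \<in> set rs \<Longrightarrow> (u * sinv u) * pr_deg (eps_fold rs y) = pr_deg (eps_fold rs y)"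
proof (induction rs)
  case (Cons s rs)
  show ?case
  proof (cases "u = s")
    case True
    thus ?thesis by (simp add: pr_deg_eps mult.assoc[symmetric] sinv_props)
  next
    case False
    have "u * sinv u * (s * sinv s * d) = s * sinv s * (u * sinv u * d)" for d
      using idem_comm[OF idem_sinv_mult(1)[of u] idem_sinv_mult(1)[of s]]
      by (simp add: mult.assoc[symmetric])
    thus ?thesis using Cons False by (simp add: pr_deg_eps)
  qed
qed simp

text \<open>Moving \<open>\<epsilon>\<^bsub>e\<^esub>\<close> to the left past \<open>\<epsilon>\<^bsub>u\<^esub>\<close> turns the latter into \<open>\<epsilon>\<^bsub>e u\<^esub>\<close>, since \<open>\<epsilon>\<^bsub>e\<^esub> = [e]\<close>.\<close>

lemma eps_fold_idem:
  assumes e: "e \<in> idem"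
  shows "eps_fold (map (\<lambda>u. e * u) rs) (eps e * z) = eps e * eps_fold rs z"
proof (induction rs)
  case (Cons u rs)
  have pe: "pgen e = eps e" using e by (simp add: idem_def pgen_idem)
  have "eps_fold (map (\<lambda>u. e * u) (u # rs)) (eps e * z) = (eps (e * u) * eps e) * eps_fold rs z"
    by (simp add: Cons mult.assoc)
  also have "eps (e * u) * eps e = eps e * eps u" using pgen_eps[of e u] by (simp add: pe)
  finally show ?case by (simp add: mult.assoc)
qed simp

text \<open>Write \<open>x = \<epsilon>\<^bsub>u1\<^esub> \<cdots> \<epsilon>\<^bsub>un\<^esub> [r]\<close> with \<open>r\<close> the degree of \<open>x\<close>, and let \<open>e = r r\<^sup>*\<close>. As \<open>\<epsilon>\<^bsub>e\<^esub>\<close> and \<open>\<epsilon>\<^bsub>r\<^esub>\<close> fix \<open>[r]\<close>, they may be inserted,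
  and by \<open>eps_fold_idem\<close> every \<open>u\<close> may be replaced by \<open>e u\<close>. Since \<open>e\<close> lies below \<open>u u\<^sup>*\<close>, the new indices have \<open>e\<close> as their
  range projection.\<close>

lemma normal_form_exists: "\<exists>rs r. is_normal_form rs r x"
proof -
  obtain a r' where a: "a \<in> eps_prods" "x = a * pgen r'" using pr_decomp by blast
  obtain rs where rs: "\<And>y. a * y = eps_fold rs y" using eps_prods_fold[OF a(1)] by blast
  define r where "r = pr_deg x"
  define e where "e = r * sinv r"
  have e: "e \<in> idem" by (simp add: e_def idem_sinv_mult)
  have x: "x = a * pgen r" unfolding r_def a(2) pr_deg_simps by (rule eps_prods_pgen[OF a(1)])
  have er: "eps e * pgen r = pgen r"
  proof -
    have "eps e * pgen r = pgen (r * sinv r) * pgen r"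
      using pgen_idem[of e] e unfolding e_def idem_def by simp
    also have "\<dots> = pgen r * pgen (sinv r) * pgen r"
      using pgen_rels(1)[of r "sinv r"] unfolding sinv_sinv by (rule sym)
    finally show ?thesis unfolding pgen_rels(3) .
  qed
  have u: "(e * u) * sinv (e * u) = e" if "u \<in> set rs" for u
  proof -
    have "(u * sinv u) * r = r" using eps_fold_deg_absorb[OF that, of "pgen r"]
      unfolding rs[symmetric] x[symmetric] r_def[symmetric] .
    hence "(u * sinv u) * e = e" by (simp add: e_def mult.assoc[symmetric])
    moreover have "(e * u) * sinv (e * u) = e * ((u * sinv u) * e)"
      using e by (simp add: sinv_mult sinv_idem' mult.assoc)
    ultimately show ?thesis using e by (simp add: idem_def)
  qed
  have "eps_fold (r # e # map (\<lambda>u. e * u) rs) (pgen r) = eps r * (eps e * eps_fold (map (\<lambda>u. e * u) rs) (eps e * pgen r))"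
    by (simp add: er)
  also have "\<dots> = eps r * (eps e * (eps e * (a * pgen r)))" by (simp only: eps_fold_idem[OF e] rs)
  also have "\<dots> = (eps r * (eps e * a)) * pgen r" using eps_idem[of e] by (simp add: mult.assoc[symmetric])
  also have "eps r * (eps e * a) = a * (eps r * eps e)"
    using eps_prods_eps[OF a(1), of e] eps_prods_eps[OF a(1), of r] by (metis mult.assoc)
  also have "a * (eps r * eps e) * pgen r = x"
    by (subst x) (simp only: mult.assoc er eps_pgen)
  finally have "is_normal_form (r # e # map (\<lambda>u. e * u) rs) r x"
    using u e by (auto simp: is_normal_form_def e_def[symmetric] sinv_idem' idem_def)
  thus ?thesis by blast
qed

lemma is_normal_form_normal_form:
  obtains rs r where "normal_form x = (rs, r)" "is_normal_form rs r x"
proof -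
  have "\<exists>p. case p of (rs, r) \<Rightarrow> is_normal_form rs r x" using normal_form_exists by auto
  from someI_ex[OF this] show thesis
    using that by (cases "normal_form x") (auto simp: normal_form_def)
qed

lemma normal_form_deg:
  assumes "is_normal_form rs r x" shows "pr_deg x = r"
proof -
  have "pr_deg (eps_fold ss (pgen r)) = r" if "\<forall>s\<in>set ss. s * sinv s = r * sinv r" for ss
    using that by (induction ss) (simp_all add: pr_deg_eps sinv_props)
  moreover have "x = eps_fold rs (pgen r)" "\<forall>s\<in>set rs. s * sinv s = r * sinv r"
    using assms unfolding is_normal_form_def by blast+
  ultimately show ?thesis by blast
qed

lemma snd_normal_form: "snd (normal_form x) = pr_deg x"
  by (rule is_normal_form_normal_form[of x]) (simp add: normal_form_deg)

section \<open>Closed ideals and multipliers\<close>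

context cstar_algebra
begin

lemma closed_idealD:
  assumes "closed_ideal C I"
  shows "x \<in> I \<Longrightarrow> x \<in> car C" "\<zero> \<in> I" "\<lbrakk>x \<in> I; y \<in> I\<rbrakk> \<Longrightarrow> x \<oplus> y \<in> I" "x \<in> I \<Longrightarrow> c \<odot> x \<in> I"
    "\<lbrakk>x \<in> car C; y \<in> I\<rbrakk> \<Longrightarrow> x \<otimes> y \<in> I" "\<lbrakk>x \<in> I; y \<in> car C\<rbrakk> \<Longrightarrow> x \<otimes> y \<in> I" "x \<in> I \<Longrightarrow> x\<^sup>\<star> \<in> I"
  using assms closed_ideal_adj[OF assms] by (auto simp: closed_ideal_def lin_subspace_def)

lemma closed_ideal_Inter:
  assumes "T \<noteq> {}" "\<And>t. t \<in> T \<Longrightarrow> closed_ideal C (I t)"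
  shows "closed_ideal C (\<Inter>t\<in>T. I t)"
proof -
  note I = closed_idealD[OF assms(2)]
  have "(\<Inter>t\<in>T. I t) \<subseteq> car C" using assms(1) I(1) by auto
  moreover have "norm_closed C (\<Inter>t\<in>T. I t)"
    unfolding norm_closed_def
  proof (intro allI ballI impI INT_I)
    fix Y x t assume "x \<in> car C" "(\<forall>n::nat. Y n \<in> (\<Inter>t\<in>T. I t)) \<and> (\<lambda>n. vdist C (Y n) x) \<longlonglongrightarrow> 0" "t \<in> T"
    moreover from this have "norm_closed C (I t)" using assms(2) by (simp add: closed_ideal_def)
    ultimately show "x \<in> I t" unfolding norm_closed_def by auto
  qed
  ultimately show ?thesis using I by (simp add: closed_ideal_def lin_subspace_def)
qed

lemma ideal_cstar: "closed_ideal C I \<Longrightarrow> cstar_algebra (C\<lparr>car := I\<rparr>)"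
  by (intro subalgebra_cstar closed_ideal_subalgebra)

text \<open>If \<open>w\<close> runs through approximate units of \<open>I\<close>, then \<open>x u\<close> is the limit of \<open>(x w) u = x (w u)\<close>, which lies in \<open>I\<close>.\<close>

lemma multiplier_ideal:
  assumes u: "u \<in> multipliers C D" and D: "D \<subseteq> car C" and I: "closed_ideal C I" "I \<subseteq> D" and x: "x \<in> I"
  shows "rmult u x \<in> I"
proof -
  interpret I: cstar_algebra "C\<lparr>car := I\<rparr>" by (rule ideal_cstar[OF I(1)])
  define R where "R = rmult u"
  have R: "\<And>y. y \<in> D \<Longrightarrow> R y \<in> D" "\<And>y z. \<lbrakk>y \<in> D; z \<in> D\<rbrakk> \<Longrightarrow> R (y \<oplus> z) = R y \<oplus> R z"
    "\<And>c y. y \<in> D \<Longrightarrow> R (c \<odot> y) = c \<odot> R y" "\<And>y z. \<lbrakk>y \<in> D; z \<in> D\<rbrakk> \<Longrightarrow> R (y \<otimes> z) = y \<otimes> R z"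
    using u by (cases u; auto simp: multipliers_def lin_map_def R_def)+
  have "\<exists>K. \<forall>y\<in>D. \<parallel>R y\<parallel> \<le> K * \<parallel>y\<parallel>"
    using u by (cases u) (force simp: multipliers_def R_def)
  then obtain K where RK: "\<And>y. y \<in> D \<Longrightarrow> \<parallel>R y\<parallel> \<le> K * \<parallel>y\<parallel>" by blast
  have vs: "I.vsub = vsub" by (simp add: fun_eq_iff vsub_def I.vsub_def)
  have "\<exists>w\<in>I. \<parallel>x \<otimes> w \<ominus> x\<parallel> < inverse (real (Suc n))" for n
    using I.approximate_unit_finite[of "{x}" "inverse (real (Suc n))"] x by (auto simp: vs)
  then obtain w where w: "\<And>n. w n \<in> I" "\<And>n. \<parallel>x \<otimes> w n \<ominus> x\<parallel> < inverse (real (Suc n))" by metis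
  define Y where "Y n = x \<otimes> R (w n)" for n
  have Y: "Y n \<in> I" for n
    unfolding Y_def using closed_idealD(6)[OF I(1) x] R(1) w(1) I(2) D by blast
  have "\<parallel>Y n \<ominus> R x\<parallel> \<le> \<bar>K\<bar> * inverse (real (Suc n))" for n
  proof -
    have xw: "x \<otimes> w n \<in> I" using closed_idealD(6)[OF I(1) x] w(1) I(2) D by blast
    have d: "x \<otimes> w n \<ominus> x \<in> I" unfolding vsub_def by (intro closed_idealD[OF I(1)] xw x)
    have "Y n \<ominus> R x = R (x \<otimes> w n \<ominus> x)"
    proof -
      have "x \<in> D" "w n \<in> D" "x \<otimes> w n \<in> D" "(- 1) \<odot> x \<in> D"
        using xw x w(1)[of n] I(2) closed_idealD(4)[OF I(1) x, of "- 1"] by auto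
      thus ?thesis by (simp add: Y_def vsub_def R)
    qed
    also have "\<parallel>\<dots>\<parallel> \<le> K * \<parallel>x \<otimes> w n \<ominus> x\<parallel>" using RK d I(2) by blast
    also have "\<dots> \<le> \<bar>K\<bar> * inverse (real (Suc n))"
      using w(2)[of n] norm_nonneg[OF closed_idealD(1)[OF I(1) d]] by (intro mult_mono) auto
    finally show ?thesis .
  qed
  hence le: "norm \<parallel>Y n \<ominus> R x\<parallel> \<le> \<bar>K\<bar> * inverse (real (Suc n))" for n
    using norm_nonneg[of "Y n \<ominus> R x"] closed_idealD(1)[OF I(1) Y] R(1) x I D
    by (auto simp: vsub_closed subset_iff)
  have "(\<lambda>n. vdist C (Y n) (R x)) \<longlonglongrightarrow> 0"
    unfolding vdist_vsub
    by (rule Lim_null_comparison[OF always_eventually[OF allI[OF le]]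
        tendsto_mult_right_zero[OF LIMSEQ_inverse_real_of_nat]])
  thus ?thesis
    using I(1) Y R(1) x I(2) D unfolding closed_ideal_def norm_closed_def R_def by blast
qed

end

section \<open>Twisted partial actions\<close>

context twisted_partial_action
begin

abbreviation D where "D \<equiv> tdom \<alpha>"

lemmas D_ideal = closed_idealD[OF ideals]

lemma act_bij: "bij_betw (tact \<alpha> s) (D (sinv s)) (D s)"
  using act_iso[of s] by (simp add: star_iso_def)

lemma act_inj: "inj_on (tact \<alpha> s) (D (sinv s))"
  using act_bij by (rule bij_betw_imp_inj_on)

lemma act_inv_closed:
  assumes "a \<in> D s" shows "act_inv \<alpha> s a \<in> D (sinv s)" "tact \<alpha> s (act_inv \<alpha> s a) = a"
  using assms bij_betw_imp_surj_on[OF act_bij[of s]] unfolding act_inv_def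
  by (auto intro: inv_into_into f_inv_into_f)

lemma D_range: "D r \<subseteq> D (r * sinv r)"
  using act_dom[of r "sinv r"] unfolding Int_absorb bij_betw_imp_surj_on[OF act_bij] by blast

lemma coc_adj_one:
  assumes "tcoc \<alpha> s t = mult_one (D s \<inter> D (s * t))" "a \<in> D s \<inter> D (s * t)"
  shows "rmult (coc_adj B \<alpha> s t) a = a"
  using assms by (simp add: coc_adj_def mult_adj_def mult_one_def D_ideal(7) adj_adj[OF D_ideal(1)[of _ s]])

text \<open>As \<open>\<omega>(e, e) = 1\<close>, the map \<open>\<beta>\<^bsub>e\<^esub>\<close> is idempotent, and it is injective.\<close>

lemma act_idem:
  assumes e: "e \<in> idem" and x: "x \<in> D e"
  shows "tact \<alpha> e x = x"
proof -
  have ee: "e * e = e" "sinv e = e" using e by (simp_all add: idem_def sinv_idem)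
  have t: "tact \<alpha> e x \<in> D e" using bij_betwE[OF act_bij[of e]] x by (simp add: ee)
  have one: "tcoc \<alpha> e e = mult_one (D e)" using coc_idem[OF e e] by (simp add: ee)
  have "tact \<alpha> e (tact \<alpha> e x) = rmult (coc_adj B \<alpha> e e) (lmult (tcoc \<alpha> e e) (tact \<alpha> (e * e) x))"
    using x by (intro act_act) (simp add: ee)
  also have "\<dots> = tact \<alpha> e x"
    using coc_adj_one[of e e] t by (simp add: ee one) (simp add: mult_one_def)
  finally show ?thesis using act_inj[of e] t x by (simp add: ee inj_on_eq_iff)
qed

lemma act_idem_image: "e \<in> idem \<Longrightarrow> X \<subseteq> D e \<Longrightarrow> tact \<alpha> e ` X = X"
  using act_idem by (force simp: image_iff)

lemma D_idem_mult_inter: "e \<in> idem \<Longrightarrow> D e \<inter> D (e * s) = D e \<inter> D s"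
  using act_dom[of e s] act_idem_image[of e "D e \<inter> D s"] by (simp add: sinv_idem')

lemma D_idem_mono: "\<lbrakk>e \<in> idem; f \<in> idem; f * e = f\<rbrakk> \<Longrightarrow> D f \<subseteq> D e"
  using D_idem_mult_inter[of f e] by auto

text \<open>Idempotents cut down the domains. The inclusion in \<open>D e\<close> holds because the domain of \<open>e s\<close> lies in
  that of its range projection, which lies below \<open>e\<close>.\<close>

lemma D_idem_mult:
  assumes e: "e \<in> idem" shows "D (e * s) = D e \<inter> D s"
proof -
  have "(e * s) * sinv (e * s) * e = e * (s * sinv s) * (e * e)"
    using e by (simp add: sinv_mult sinv_idem' mult.assoc)
  also have "\<dots> = (e * s) * sinv (e * s)" using e by (simp add: idem_def sinv_mult sinv_idem mult.assoc)
  finally have "D ((e * s) * sinv (e * s)) \<subseteq> D e"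
    by (intro D_idem_mono[OF e idem_sinv_mult(1)])
  hence "D (e * s) \<subseteq> D e" using D_range[of "e * s"] by blast
  thus ?thesis using D_idem_mult_inter[OF e, of s] by blast
qed

lemma D_mono: "nat_le s t \<Longrightarrow> D s \<subseteq> D t"
  using nat_leD(2)[of s t] D_idem_mult by auto

text \<open>The axiom on the image of a single ideal passes to intersections because \<open>\<beta>\<^bsub>r\<^esub>\<close> is injective. An
  empty family is allowed.\<close>

lemma act_family_image:
  "tact \<alpha> r ` (D (sinv r) \<inter> (\<Inter>t\<in>T. D t)) = D r \<inter> (\<Inter>t\<in>T. D (r * t))"
proof (intro equalityI subsetI)
  fix y assume "y \<in> tact \<alpha> r ` (D (sinv r) \<inter> (\<Inter>t\<in>T. D t))"
  then obtain x where x: "x \<in> D (sinv r)" "\<And>t. t \<in> T \<Longrightarrow> x \<in> D t" "y = tact \<alpha> r x" by blast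
  have "y \<in> D r" using bij_betwE[OF act_bij] x by blast
  moreover have "y \<in> D (r * t)" if "t \<in> T" for t
    using act_dom[of r t] x that by blast
  ultimately show "y \<in> D r \<inter> (\<Inter>t\<in>T. D (r * t))" by blast
next
  fix y assume y: "y \<in> D r \<inter> (\<Inter>t\<in>T. D (r * t))"
  define x where "x = act_inv \<alpha> r y"
  have x: "x \<in> D (sinv r)" "tact \<alpha> r x = y" using act_inv_closed[of y r] y by (simp_all add: x_def)
  have "x \<in> D t" if "t \<in> T" for t
  proof -
    have "y \<in> tact \<alpha> r ` (D (sinv r) \<inter> D t)" using act_dom[of r t] y that by blast
    thus ?thesis using x inj_onD[OF act_inj[of r]] by blast
  qed
  thus "y \<in> tact \<alpha> r ` (D (sinv r) \<inter> (\<Inter>t\<in>T. D t))" using x by blast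
qed

end

subsection \<open>Domains over the expansion\<close>

text \<open>For a product \<open>s1 \<cdots> sn\<close> of generators, bracketed in any way, these are the degrees \<open>s1, s1 s2, \<dots>, s1 \<cdots> sn\<close>
  of its prefixes. The intersection of the corresponding ideals is the same as for a normal form, but
  prefixes are easier to compute for products.\<close>

primrec wsupp :: "'g::inverse_semigroup pr_word \<Rightarrow> 'g set" where
  "wsupp (Gen s) = {s}"
| "wsupp (Mul u v) = wsupp u \<union> (*) (word_deg u) ` wsupp v"

lemma word_deg_wsupp: "word_deg w \<in> wsupp w"
  by (induction w) auto

context twisted_partial_action
begin

definition wdom :: "'s pr_word \<Rightarrow> 'b set" where
  "wdom w = (\<Inter>t\<in>wsupp w. D t)"

lemma wdom_deg: "wdom w \<subseteq> D (word_deg w)"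
  using word_deg_wsupp by (auto simp: wdom_def)

lemma wdom_Mul:
  "wdom (Mul u v) = wdom u \<inter> tact \<alpha> (word_deg u) ` (D (sinv (word_deg u)) \<inter> wdom v)"
  unfolding wdom_def act_family_image using wdom_deg[of u] by (auto simp: wdom_def)

text \<open>Congruence holds because the domain of a product depends only on the domains and degrees of
  the factors, and associativity because the supports are equal. The defining relations change the
  support, but only by indices whose ideals contain that of another index.\<close>

lemma wdom_cong: "pr_eq u v \<Longrightarrow> wdom u = wdom v"
proof -
  have deg: "word_deg u = word_deg v" if "pr_eq u v" for u v :: "'s pr_word"
    using that pr_deg.abs_eq pr.abs_eq_iff by metis
  show "pr_eq u v \<Longrightarrow> wdom u = wdom v"
  proof (induction rule: pr_eq.induct)
    case (pr_cong u u' v v')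
    thus ?case by (simp add: wdom_Mul deg)
  next
    case (pr_assoc u v w)
    show ?case by (simp add: wdom_def image_Un image_image mult.assoc Un_assoc)
  next
    case (pr_rel1 s t)
    have "D (s * t) \<inter> D (s * t * sinv t) \<subseteq> D s"
    proof -
      have "nat_le (s * (t * sinv t)) s" by (rule nat_le_right[OF idem_sinv_mult(1)])
      thus ?thesis using D_mono[of "s * t * sinv t" s] by (auto simp: mult.assoc)
    qed
    thus ?case by (auto simp: wdom_def mult.assoc)
  next
    case (pr_rel2 s t)
    show ?case using D_range[of "sinv s"] by (auto simp: wdom_def mult.assoc)
  next
    case (pr_rel3 s)
    show ?case using D_range[of s] by (auto simp: wdom_def sinv_props)
  qed auto
qed

definition prdom :: "'s pr \<Rightarrow> 'b set" where
  "prdom x = wdom (rep_pr x)"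

lemma prdom_abs: "prdom (abs_pr w) = wdom w"
  unfolding prdom_def by (rule wdom_cong) (metis Quotient_pr Quotient_rep_abs pr_refl)

lemma pr_word_cases: obtains w where "x = abs_pr w"
  by (metis Quotient_pr Quotient_abs_rep)

lemma prdom_deg: "prdom x \<subseteq> D (pr_deg x)"
  by (rule pr_word_cases[of x]) (simp add: prdom_abs pr_deg.abs_eq wdom_deg)

lemma prdom_pgen: "prdom (pgen s) = D s"
  by (simp add: pgen.abs_eq prdom_abs wdom_def)

lemma prdom_mult: "prdom (x * y) = prdom x \<inter> tact \<alpha> (pr_deg x) ` (D (sinv (pr_deg x)) \<inter> prdom y)"
  by (rule pr_word_cases[of x], rule pr_word_cases[of y])
    (simp add: times_pr.abs_eq prdom_abs pr_deg.abs_eq wdom_Mul)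

lemma prdom_mult_subset: "prdom (x * y) \<subseteq> prdom x"
  by (simp add: prdom_mult)

lemma prdom_ideal: "closed_ideal B (prdom x)"
  unfolding prdom_def wdom_def using word_deg_wsupp ideals by (intro closed_ideal_Inter) auto

lemmas prdomD = closed_idealD[OF prdom_ideal]

lemma prdom_mono: "nat_le x y \<Longrightarrow> prdom x \<subseteq> prdom y"
  using prdom_mult_subset by (auto simp: nat_le_def)

lemma prdom_sinv_subset: "prdom (sinv x) \<subseteq> D (sinv (pr_deg x))"
  using prdom_deg[of "sinv x"] by (simp add: pr_deg_sinv)

text \<open>One inclusion follows from \<open>x = x (x\<^sup>* x)\<close>, the other from \<open>x\<^sup>* = x\<^sup>* (x x\<^sup>*)\<close> and the formula for images of
  intersections.\<close>

lemma act_prdom: "tact \<alpha> (pr_deg x) ` prdom (sinv x) = prdom x"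
proof
  let ?r = "pr_deg x"
  have "prdom x = prdom (x * (sinv x * x))" by (simp add: mult.assoc[symmetric] sinv_props)
  also have "\<dots> \<subseteq> tact \<alpha> ?r ` prdom (sinv x * x)" unfolding prdom_mult[of x "sinv x * x"] by blast
  also have "\<dots> \<subseteq> tact \<alpha> ?r ` prdom (sinv x)" using prdom_mult_subset by (intro image_mono)
  finally show "prdom x \<subseteq> tact \<alpha> ?r ` prdom (sinv x)" .
  define T where "T = wsupp (rep_pr x)"
  have x: "prdom x = (\<Inter>t\<in>T. D t)" by (simp add: prdom_def wdom_def T_def)
  have "prdom (sinv x) = prdom (sinv x * (x * sinv x))" by (simp add: mult.assoc[symmetric] sinv_props)
  also have "\<dots> \<subseteq> tact \<alpha> (sinv ?r) ` (D ?r \<inter> prdom (x * sinv x))"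
    unfolding prdom_mult[of "sinv x" "x * sinv x"] by (auto simp: pr_deg_sinv)
  also have "\<dots> \<subseteq> tact \<alpha> (sinv ?r) ` (D (sinv (sinv ?r)) \<inter> (\<Inter>t\<in>T. D t))"
    using prdom_mult_subset[of x "sinv x"] by (intro image_mono) (auto simp: x)
  also have "\<dots> = D (sinv ?r) \<inter> (\<Inter>t\<in>T. D (sinv ?r * t))" by (rule act_family_image)
  also have "\<dots> = D (sinv ?r) \<inter> (\<Inter>u\<in>(*) (sinv ?r) ` T. D u)" by simp
  finally have "tact \<alpha> ?r ` prdom (sinv x) \<subseteq> D ?r \<inter> (\<Inter>u\<in>(*) (sinv ?r) ` T. D (?r * u))"
    unfolding act_family_image[of ?r "(*) (sinv ?r) ` T", symmetric] by (rule image_mono)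
  also have "\<dots> \<subseteq> prdom x"
    using D_idem_mult[OF idem_sinv_mult(1)[of ?r]] by (auto simp: x mult.assoc[symmetric])
  finally show "tact \<alpha> ?r ` prdom (sinv x) \<subseteq> prdom x" .
qed

lemma prdom_eps_fold: "prdom (eps_fold rs y) = (\<Inter>s\<in>set rs. D s) \<inter> prdom y"
proof (induction rs)
  case (Cons s rs)
  have "prdom (eps s) = D s \<inter> D (s * sinv s)"
    unfolding eps_def prdom_mult prdom_pgen pr_deg_simps act_dom by blast
  hence eps: "prdom (eps s) = D s" using D_range[of s] by blast
  have "prdom (eps s * z) = D s \<inter> prdom z" for z
  proof -
    have "tact \<alpha> (s * sinv s) ` (D (s * sinv s) \<inter> prdom z) = D (s * sinv s) \<inter> prdom z"
      by (rule act_idem_image[OF idem_sinv_mult(1)]) blast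
    thus ?thesis using D_range[of s]
      by (auto simp: prdom_mult eps pr_deg_eps sinv_mult)
  qed
  thus ?case using Cons by auto
qed simp

subsection \<open>The twisted action of the expansion as a restriction\<close>

lemma tdom_pr_action: "tdom (pr_action \<alpha>) x = prdom x"
proof -
  obtain rs r where nf: "normal_form x = (rs, r)" "is_normal_form rs r x"
    by (rule is_normal_form_normal_form)
  have "x = eps_fold rs (pgen r)" using nf(2) unfolding is_normal_form_def by blast
  hence "prdom x = (\<Inter>s\<in>set rs. D s) \<inter> D r" using prdom_eps_fold[of rs "pgen r"] by (simp add: prdom_pgen)
  thus ?thesis by (simp add: pr_action_def pr_dom_def nf(1))
qed

lemma pr_dom_eq: "pr_dom \<alpha> = prdom"
  using tdom_pr_action by (simp add: fun_eq_iff pr_action_def)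

text \<open>Each factor \<open>\<beta>\<^bsub>s\<^esub> \<beta>\<^bsub>s\<^esub>\<^sup>-\<^sup>1\<close> of the composite is the identity of \<open>D s\<close>, and \<open>\<beta>\<^bsub>r\<^esub> b\<close> lies in all these ideals.\<close>

lemma tact_pr_action:
  assumes b: "b \<in> prdom (sinv x)"
  shows "tact (pr_action \<alpha>) x b = tact \<alpha> (pr_deg x) b"
proof -
  obtain rs r where nf: "normal_form x = (rs, r)" "is_normal_form rs r x"
    by (rule is_normal_form_normal_form)
  have r: "pr_deg x = r" by (rule normal_form_deg[OF nf(2)])
  have x: "x = eps_fold rs (pgen r)" using nf(2) unfolding is_normal_form_def by blast
  have c: "tact \<alpha> r b \<in> prdom x" using act_prdom[of x] b r by blast
  have bD: "b \<in> D (sinv r)" using prdom_sinv_subset[of x] b r by blast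
  have cs: "tact \<alpha> r b \<in> D s" if "s \<in> set rs" for s
    using c that prdom_eps_fold[of rs "pgen r"] x by auto
  have "foldr (\<lambda>s m. act_pmap \<alpha> s \<circ>\<^sub>m act_inv_pmap \<alpha> s \<circ>\<^sub>m m) ss (act_pmap \<alpha> r) b = Some (tact \<alpha> r b)"
    if "set ss \<subseteq> set rs" for ss
    using that
  proof (induction ss)
    case Nil
    show ?case by (simp add: act_pmap_def bD)
  next
    case (Cons s ss)
    hence "tact \<alpha> r b \<in> D s" using cs by simp
    thus ?case using Cons act_inv_closed[of "tact \<alpha> r b" s]
      by (simp add: map_comp_def act_pmap_def act_inv_pmap_def)
  qed
  from this[of rs] show ?thesis by (simp add: pr_action_def pr_act_pmap_def nf(1) r)
qed

lemma act_inv_prdom: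
  assumes a: "a \<in> prdom x"
  shows "act_inv \<alpha> (pr_deg x) a \<in> prdom (sinv x)"
proof -
  obtain b where b: "b \<in> prdom (sinv x)" "a = tact \<alpha> (pr_deg x) b" using act_prdom[of x] a by blast
  have "act_inv \<alpha> (pr_deg x) a = b"
    unfolding act_inv_def b(2) using prdom_sinv_subset b(1) by (intro inv_into_f_f[OF act_inj]) blast
  thus ?thesis using b by simp
qed

lemma act_inv_pr_action:
  assumes a: "a \<in> prdom x"
  shows "act_inv (pr_action \<alpha>) x a = act_inv \<alpha> (pr_deg x) a"
proof -
  have inj: "inj_on (tact (pr_action \<alpha>) x) (prdom (sinv x))"
  proof (rule inj_onI)
    fix b c assume "b \<in> prdom (sinv x)" "c \<in> prdom (sinv x)"
      "tact (pr_action \<alpha>) x b = tact (pr_action \<alpha>) x c"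
    thus "b = c" using prdom_sinv_subset[of x] inj_onD[OF act_inj[of "pr_deg x"], of b c]
      by (auto simp: tact_pr_action)
  qed
  have aD: "a \<in> D (pr_deg x)" using prdom_deg a by blast
  show ?thesis
    unfolding act_inv_def[of "pr_action \<alpha>"] tdom_pr_action
    by (rule inv_into_f_eq[OF inj act_inv_prdom[OF a]])
      (simp add: tact_pr_action[OF act_inv_prdom[OF a]] act_inv_closed(2)[OF aD])
qed

lemma tcoc_pr_action: "tcoc (pr_action \<alpha>) x y = mult_restrict (prdom (x * y)) (tcoc \<alpha> (pr_deg x) (pr_deg y))"
  by (simp add: pr_action_def pr_dom_eq snd_normal_form)

lemma act_product_prdom:
  assumes a: "a \<in> prdom x" and b: "b \<in> prdom y"
  shows "act_inv \<alpha> (pr_deg x) a \<otimes> b \<in> prdom (sinv x) \<inter> prdom y"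
    "tact \<alpha> (pr_deg x) (act_inv \<alpha> (pr_deg x) a \<otimes> b) \<in> prdom (x * y)"
proof -
  show c: "act_inv \<alpha> (pr_deg x) a \<otimes> b \<in> prdom (sinv x) \<inter> prdom y"
    using prdomD(5,6) prdomD(1)[OF act_inv_prdom[OF a]] prdomD(1)[OF b] act_inv_prdom[OF a] b by blast
  show "tact \<alpha> (pr_deg x) (act_inv \<alpha> (pr_deg x) a \<otimes> b) \<in> prdom (x * y)"
    using c act_prdom[of x] prdom_sinv_subset[of x] unfolding prdom_mult by blast
qed

abbreviation A where "A \<equiv> twisted_bundle B \<alpha>"
abbreviation A' where "A' \<equiv> twisted_bundle B (pr_action \<alpha>)"

lemma fcar_A: "fcar A s = D s" "fcar A' x = prdom x"
  by (simp_all add: twisted_bundle_def tdom_pr_action)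

lemma fib_simps:
  "add (fib A s) = add B" "scal (fib A s) = scal B" "nrm (fib A s) = nrm B" "zer (fib A s) = \<zero>"
  "add (fib A' x) = add B" "scal (fib A' x) = scal B" "nrm (fib A' x) = nrm B" "zer (fib A' x) = \<zero>"
  by (simp_all add: twisted_bundle_def)

lemma fmul_restrict:
  assumes "a \<in> prdom x" "b \<in> prdom y"
  shows "fmul A' x y a b = fmul A (pr_deg x) (pr_deg y) a b"
  using act_product_prdom[OF assms] assms
  by (simp add: twisted_bundle_def act_inv_pr_action tact_pr_action tcoc_pr_action mult_restrict_def)

lemma fadj_restrict:
  assumes a: "a \<in> prdom x"
  shows "fadj A' x a = fadj A (pr_deg x) a"
proof -
  define y where "y = act_inv \<alpha> (pr_deg x) (a\<^sup>\<star>)"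
  have aa: "a\<^sup>\<star> \<in> prdom x" using prdomD(7)[OF a] .
  have y: "y \<in> prdom (sinv x)" unfolding y_def by (rule act_inv_prdom[OF aa])
  have "prdom (sinv x) = prdom (sinv x * x * sinv x)" by (simp add: sinv_props)
  hence yx: "y \<in> prdom (sinv x * x)" using y prdom_mult_subset by blast
  have "y \<in> D (sinv (pr_deg x))" using y prdom_sinv_subset by blast
  moreover have "y \<in> D (sinv (pr_deg x) * pr_deg x)" using yx prdom_deg[of "sinv x * x"] by (auto simp: pr_deg_sinv)
  ultimately have "fadj A (pr_deg x) a = (lmult (tcoc \<alpha> (sinv (pr_deg x)) (pr_deg x)) (y\<^sup>\<star>))\<^sup>\<star>"
    by (simp add: twisted_bundle_def y_def[symmetric] coc_adj_def mult_adj_def)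
  moreover have "fadj A' x a = (lmult (tcoc \<alpha> (sinv (pr_deg x)) (pr_deg x)) (y\<^sup>\<star>))\<^sup>\<star>"
    using y yx prdomD(7)[OF yx]
    by (simp add: twisted_bundle_def act_inv_pr_action[OF aa] y_def[symmetric] coc_adj_def mult_adj_def
        tdom_pr_action tcoc_pr_action mult_restrict_def pr_deg_sinv)
  ultimately show ?thesis by simp
qed

lemma fincl_restrict:
  assumes le: "nat_le x y" and a: "a \<in> prdom x"
  shows "fincl A' y x a = fincl A (pr_deg y) (pr_deg x) a"
proof -
  have x: "y * (sinv x * x) = x" by (rule nat_leD(1)[OF le])
  have d: "pr_deg y * (sinv (pr_deg x) * pr_deg x) = pr_deg x" by (rule nat_leD(1)[OF nat_le_pr_deg[OF le]])
  have "a \<in> prdom y" using prdom_mono[OF le] a by blast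
  moreover from this have "a \<in> D (pr_deg y)" "a \<in> D (pr_deg x)" using prdom_deg a by blast+
  ultimately show ?thesis using a prdomD(7)[OF a]
    by (simp add: twisted_bundle_def coc_adj_def mult_adj_def tdom_pr_action tcoc_pr_action mult_restrict_def
        pr_deg_sinv x d)
qed

lemma fincl_refl: "a \<in> D s \<Longrightarrow> fincl A s s a = a"
  using coc_adj_one[of s "sinv s * s" a] coc_unit_right[of s]
  by (simp add: twisted_bundle_def sinv_props mult.assoc[symmetric])

text \<open>Over idempotents the Fell bundle is not twisted: its fibers are ideals of \<open>B\<close> with the operations of \<open>B\<close>.\<close>

lemma idem_fiber:
  assumes e: "e \<in> idem" and a: "a \<in> D e"
  shows "b \<in> D e \<Longrightarrow> fmul A e e a b = a \<otimes> b" "fadj A e a = a\<^sup>\<star>"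
    "\<lbrakk>f \<in> idem; nat_le e f\<rbrakk> \<Longrightarrow> fincl A f e a = a"
proof -
  have ee: "e * e = e" "sinv e = e" using e by (simp_all add: idem_def sinv_idem)
  have inv: "act_inv \<alpha> e c = c" if "c \<in> D e" for c
    using act_inv_closed[OF that] act_idem[OF e, of "act_inv \<alpha> e c"] by (simp add: ee)
  have one: "tcoc \<alpha> e e = mult_one (D e)" using coc_idem[OF e e] by (simp add: ee)
  show "fmul A e e a b = a \<otimes> b" if b: "b \<in> D e"
  proof -
    have "a \<otimes> b \<in> D e" using D_ideal(6)[OF a D_ideal(1)[OF b]] .
    thus ?thesis by (simp add: twisted_bundle_def inv[OF a] act_idem[OF e] one) (simp add: mult_one_def)
  qed
  have aa: "a\<^sup>\<star> \<in> D e" using D_ideal(7)[OF a] .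
  show "fadj A e a = a\<^sup>\<star>"
    using coc_adj_one[of e e "a\<^sup>\<star>"] by (simp add: twisted_bundle_def inv[OF aa] one ee aa)
  show "fincl A f e a = a" if f: "f \<in> idem" "nat_le e f"
  proof -
    have fe: "f * e = e" using nat_leD(1)[OF f(2)] by (simp add: ee)
    have "a \<in> D f" using D_mono[OF f(2)] a by blast
    moreover have "tcoc \<alpha> f e = mult_one (D f \<inter> D (f * e))"
      using coc_idem[OF f(1) e] D_mono[OF f(2)] by (simp add: fe Int_absorb1)
    ultimately show ?thesis using coc_adj_one[of f e a] a by (simp add: twisted_bundle_def ee fe)
  qed
qed

text \<open>The cocycle is a multiplier of an ideal that may be larger than the fiber over \<open>x y\<close>, so this rests on
  \<open>multiplier_ideal\<close>.\<close>

lemma fmul_prdom: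
  assumes a: "a \<in> prdom x" and b: "b \<in> prdom y"
  shows "fmul A (pr_deg x) (pr_deg y) a b \<in> prdom (x * y)"
proof -
  let ?r = "pr_deg x" and ?s = "pr_deg y"
  have sub: "prdom (x * y) \<subseteq> D ?r \<inter> D (?r * ?s)"
    using prdom_mult_subset[of x y] prdom_deg[of x] prdom_deg[of "x * y"] by auto
  have "tcoc \<alpha> ?r ?s \<in> multipliers B (D ?r \<inter> D (?r * ?s))"
    using cocycle_unitary by (simp add: unitary_multipliers_def)
  from multiplier_ideal[OF this _ prdom_ideal sub act_product_prdom(2)[OF a b]]
  show ?thesis using D_ideal(1) by (auto simp: twisted_bundle_def)
qed

end

section \<open>Representations of the two Fell bundles\<close>

lemma fell_repD:
  assumes "fell_rep A C \<pi>"
  shows "a \<in> fcar A s \<Longrightarrow> \<pi> s a \<in> car C"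
    "\<lbrakk>a \<in> fcar A s; b \<in> fcar A s\<rbrakk> \<Longrightarrow> \<pi> s (a \<oplus>\<^bsub>fib A s\<^esub> b) = \<pi> s a \<oplus>\<^bsub>C\<^esub> \<pi> s b"
    "a \<in> fcar A s \<Longrightarrow> \<pi> s (c \<odot>\<^bsub>fib A s\<^esub> a) = c \<odot>\<^bsub>C\<^esub> \<pi> s a"
    "\<lbrakk>a \<in> fcar A s; b \<in> fcar A t\<rbrakk> \<Longrightarrow> \<pi> s a \<otimes>\<^bsub>C\<^esub> \<pi> t b = \<pi> (s * t) (fmul A s t a b)"
    "a \<in> fcar A s \<Longrightarrow> (\<pi> s a)\<^sup>\<star>\<^bsub>C\<^esub> = \<pi> (sinv s) (fadj A s a)"
    "\<lbrakk>nat_le s t; a \<in> fcar A s\<rbrakk> \<Longrightarrow> \<pi> t (fincl A t s a) = \<pi> s a"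
  using assms by (simp_all add: fell_rep_def lin_map_def)

lemma fell_repI:
  assumes "\<And>s a. a \<in> fcar A s \<Longrightarrow> \<pi> s a \<in> car C"
    "\<And>s a b. \<lbrakk>a \<in> fcar A s; b \<in> fcar A s\<rbrakk> \<Longrightarrow> \<pi> s (a \<oplus>\<^bsub>fib A s\<^esub> b) = \<pi> s a \<oplus>\<^bsub>C\<^esub> \<pi> s b"
    "\<And>s a c. a \<in> fcar A s \<Longrightarrow> \<pi> s (c \<odot>\<^bsub>fib A s\<^esub> a) = c \<odot>\<^bsub>C\<^esub> \<pi> s a"
    "\<And>s t a b. \<lbrakk>a \<in> fcar A s; b \<in> fcar A t\<rbrakk> \<Longrightarrow> \<pi> s a \<otimes>\<^bsub>C\<^esub> \<pi> t b = \<pi> (s * t) (fmul A s t a b)"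
    "\<And>s a. a \<in> fcar A s \<Longrightarrow> (\<pi> s a)\<^sup>\<star>\<^bsub>C\<^esub> = \<pi> (sinv s) (fadj A s a)"
    "\<And>s t a. \<lbrakk>nat_le s t; a \<in> fcar A s\<rbrakk> \<Longrightarrow> \<pi> t (fincl A t s a) = \<pi> s a"
  shows "fell_rep A C \<pi>"
  using assms by (simp add: fell_rep_def lin_map_def)

context twisted_partial_action
begin

lemma fell_rep_pullback:
  assumes \<pi>: "fell_rep A C \<pi>"
  shows "fell_rep A' C (\<lambda>x. \<pi> (pr_deg x))"
proof -
  note p = fell_repD[OF \<pi>, unfolded fcar_A fib_simps]
  have d: "a \<in> prdom x \<Longrightarrow> a \<in> D (pr_deg x)" for a x using prdom_deg by blast
  show ?thesis
  proof (rule fell_repI, unfold fcar_A fib_simps, goal_cases)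
    case (4 x y a b)
    thus ?case using p(4)[OF d d] by (simp add: fmul_restrict)
  next
    case (5 x a)
    thus ?case using p(5)[OF d] by (simp add: fadj_restrict pr_deg_sinv)
  next
    case (6 x y a)
    thus ?case using p(6)[OF nat_le_pr_deg d] by (simp add: fincl_restrict)
  qed (use p(1-3) d in blast)+
qed

text \<open>The element \<open>x\<close> lies below \<open>[pr_deg x]\<close>, and the inclusion of fibers is the identity as \<open>\<omega>(r, r\<^sup>* r) = 1\<close>.\<close>

lemma fell_rep_pgen_deg:
  assumes \<pi>: "fell_rep A' C \<pi>" and a: "a \<in> prdom x"
  shows "\<pi> (pgen (pr_deg x)) a = \<pi> x a"
proof -
  have "fincl A' (pgen (pr_deg x)) x a = a"
    using fincl_restrict[OF nat_le_pgen_deg a] fincl_refl[of a "pr_deg x"] prdom_deg[of x] a by auto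
  thus ?thesis using fell_repD(6)[OF \<pi> nat_le_pgen_deg[of x], of a] a by (simp add: fcar_A)
qed

lemma fell_rep_section:
  assumes \<pi>: "fell_rep A' C \<pi>"
  shows "fell_rep A C (\<lambda>s. \<pi> (pgen s))"
proof -
  note p = fell_repD[OF \<pi>, unfolded fcar_A fib_simps]
  have d: "a \<in> D s \<Longrightarrow> a \<in> prdom (pgen s)" for a s by (simp add: prdom_pgen)
  show ?thesis
  proof (rule fell_repI, unfold fcar_A fib_simps, goal_cases)
    case (4 s t a b)
    have "\<pi> (pgen s) a \<otimes>\<^bsub>C\<^esub> \<pi> (pgen t) b = \<pi> (pgen s * pgen t) (fmul A s t a b)"
      using p(4)[OF d[OF 4(1)] d[OF 4(2)]] fmul_restrict[OF d[OF 4(1)] d[OF 4(2)]] by simp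
    also have "\<dots> = \<pi> (pgen (s * t)) (fmul A s t a b)"
      using fell_rep_pgen_deg[OF \<pi>, of "fmul A s t a b" "pgen s * pgen t"] fmul_prdom[OF d[OF 4(1)] d[OF 4(2)]] by simp
    finally show ?case .
  next
    case (5 s a)
    thus ?case using p(5)[OF d] fadj_restrict[OF d] by (simp add: sinv_pgen)
  next
    case (6 s t a)
    \<comment> \<open>This element lies below \<open>[t]\<close> and has degree \<open>s\<close>, and its fiber is all of the fiber over \<open>s\<close>.\<close>
    define x where "x = pgen t * pgen (sinv s * s)"
    have ts: "t * (sinv s * s) = s" by (rule nat_leD(1)[OF 6(1)])
    hence dx: "pr_deg x = s" by (simp add: x_def)
    have "prdom x = D t \<inter> D s" unfolding x_def prdom_mult prdom_pgen pr_deg_simps act_dom ts by blast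
    hence ax: "a \<in> prdom x" using 6 D_mono by blast
    have le: "nat_le x (pgen t)" unfolding x_def by (intro nat_le_right pgen_in_idem idem_sinv_mult)
    have "\<pi> (pgen t) (fincl A t s a) = \<pi> x a"
      using p(6)[OF le ax] fincl_restrict[OF le ax] by (simp add: dx)
    thus ?case using fell_rep_pgen_deg[OF \<pi> ax] by (simp add: dx)
  qed (use p(1-3) d in blast)+
qed

end

section \<open>Transport along isomorphisms of \<open>C\<^sup>*\<close>-algebras\<close>

lemma star_homD:
  assumes "star_hom C C' f"
  shows "x \<in> car C \<Longrightarrow> f x \<in> car C'" "\<lbrakk>x \<in> car C; y \<in> car C\<rbrakk> \<Longrightarrow> f (x \<oplus>\<^bsub>C\<^esub> y) = f x \<oplus>\<^bsub>C'\<^esub> f y"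
    "x \<in> car C \<Longrightarrow> f (c \<odot>\<^bsub>C\<^esub> x) = c \<odot>\<^bsub>C'\<^esub> f x"
    "\<lbrakk>x \<in> car C; y \<in> car C\<rbrakk> \<Longrightarrow> f (x \<otimes>\<^bsub>C\<^esub> y) = f x \<otimes>\<^bsub>C'\<^esub> f y"
    "x \<in> car C \<Longrightarrow> f (x\<^sup>\<star>\<^bsub>C\<^esub>) = (f x)\<^sup>\<star>\<^bsub>C'\<^esub>"
  using assms by (auto simp: star_hom_def lin_map_def)

lemma star_homI:
  assumes "\<And>x. x \<in> car C \<Longrightarrow> f x \<in> car C'" "\<And>x y. \<lbrakk>x \<in> car C; y \<in> car C\<rbrakk> \<Longrightarrow> f (x \<oplus>\<^bsub>C\<^esub> y) = f x \<oplus>\<^bsub>C'\<^esub> f y"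
    "\<And>x c. x \<in> car C \<Longrightarrow> f (c \<odot>\<^bsub>C\<^esub> x) = c \<odot>\<^bsub>C'\<^esub> f x"
    "\<And>x y. \<lbrakk>x \<in> car C; y \<in> car C\<rbrakk> \<Longrightarrow> f (x \<otimes>\<^bsub>C\<^esub> y) = f x \<otimes>\<^bsub>C'\<^esub> f y"
    "\<And>x. x \<in> car C \<Longrightarrow> f (x\<^sup>\<star>\<^bsub>C\<^esub>) = (f x)\<^sup>\<star>\<^bsub>C'\<^esub>"
  shows "star_hom C C' f"
  using assms by (simp add: star_hom_def lin_map_def)

lemma star_hom_compose: "\<lbrakk>star_hom C C' f; star_hom C' C'' g\<rbrakk> \<Longrightarrow> star_hom C C'' (\<lambda>x. g (f x))"
  by (rule star_homI) (simp_all add: star_homD)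

lemma (in cstar_algebra) star_hom_restrict:
  "star_hom C C' f \<Longrightarrow> star_hom C C' (restrict f (car C))"
  by (rule star_homI) (simp_all add: star_homD ccloseds)

lemma full_cstar_unique:
  assumes full: "full_cstar A C \<iota>" and f: "star_hom C C f" "\<And>s a. a \<in> fcar A s \<Longrightarrow> f (\<iota> s a) = \<iota> s a"
    and x: "x \<in> car C"
  shows "f x = x"
proof -
  interpret cstar_algebra C using full by (simp add: full_cstar_def)
  have \<iota>: "fell_rep A C \<iota>" using full by (simp add: full_cstar_def)
  have "\<exists>!\<Phi>. \<Phi> \<in> extensional (car C) \<and> star_hom C C \<Phi> \<and> (\<forall>s. \<forall>a\<in>fcar A s. \<Phi> (\<iota> s a) = \<iota> s a)"
    using full \<iota> by (simp add: full_cstar_def)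
  moreover have "star_hom C C (\<lambda>x. x)" by (rule star_homI) simp_all
  ultimately have "restrict f (car C) = restrict (\<lambda>x. x) (car C)"
    using star_hom_restrict[OF f(1)] star_hom_restrict[of C "\<lambda>x. x"] f(2) fell_repD(1)[OF \<iota>]
    by (elim ex1E) (metis (no_types, lifting) restrict_apply' restrict_extensional)
  thus ?thesis using x by (metis restrict_apply')
qed

lemma full_cstar_hom:
  fixes C D :: "'c cstar"
  assumes "full_cstar A C \<iota>" "cstar_algebra D" "fell_rep A D \<pi>"
  obtains \<Phi> where "star_hom C D \<Phi>" "\<And>s a. a \<in> fcar A s \<Longrightarrow> \<Phi> (\<iota> s a) = \<pi> s a"
proof -
  have "\<exists>!\<Phi>. \<Phi> \<in> extensional (car C) \<and> star_hom C D \<Phi> \<and> (\<forall>s. \<forall>a\<in>fcar A s. \<Phi> (\<iota> s a) = \<pi> s a)"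
    using assms by (simp add: full_cstar_def)
  from ex1_implies_ex[OF this] obtain \<Phi> where "star_hom C D \<Phi>"
    "\<forall>s. \<forall>a\<in>fcar A s. \<Phi> (\<iota> s a) = \<pi> s a" by blast
  thus thesis using that[of \<Phi>] by blast
qed

locale star_equivalence = C: cstar_algebra C + C': cstar_algebra C'
  for C :: "'c cstar" and C' :: "'d cstar" +
  fixes \<Phi> \<Psi>
  assumes hom: "star_hom C C' \<Phi>" "star_hom C' C \<Psi>"
    and inverse: "x \<in> car C \<Longrightarrow> \<Psi> (\<Phi> x) = x" "y \<in> car C' \<Longrightarrow> \<Phi> (\<Psi> y) = y"
begin

lemma symmetric: "star_equivalence C' C \<Psi> \<Phi>"
  by unfold_locales (use hom inverse in auto)

lemmas \<Phi> = star_homD[OF hom(1)]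
lemmas \<Psi> = star_homD[OF hom(2)]

lemma \<Phi>_bij: "bij_betw \<Phi> (car C) (car C')"
  by (rule bij_betwI[where g = \<Psi>]) (use \<Phi>(1) \<Psi>(1) inverse in auto)

lemma norm_\<Phi>: assumes x: "x \<in> car C" shows "\<parallel>\<Phi> x\<parallel>\<^bsub>C'\<^esub> = \<parallel>x\<parallel>\<^bsub>C\<^esub>"
  using star_hom_contractive[OF C.cstar_algebra_axioms C'.cstar_algebra_axioms hom(1) x]
    star_hom_contractive[OF C'.cstar_algebra_axioms C.cstar_algebra_axioms hom(2) \<Phi>(1)[OF x]]
  by (simp add: inverse x)

lemma positive_functional_pullback:
  "positive_functional C' \<phi> \<Longrightarrow> positive_functional C (\<lambda>x. \<phi> (\<Phi> x))"
  using \<Phi> by (simp add: positive_functional_def C.ccloseds)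

lemma state_pullback:
  assumes "state C' \<phi>" shows "state C (\<lambda>x. \<phi> (\<Phi> x))"
  unfolding state_def
proof (intro conjI ballI allI impI)
  show "positive_functional C (\<lambda>x. \<phi> (\<Phi> x))"
    using assms by (intro positive_functional_pullback) (simp add: state_def)
  fix x assume x: "x \<in> car C"
  show "cmod (\<phi> (\<Phi> x)) \<le> \<parallel>x\<parallel>\<^bsub>C\<^esub>" using assms \<Phi>(1)[OF x] norm_\<Phi>[OF x] by (auto simp: state_def)
next
  fix K assume K: "\<forall>x\<in>car C. cmod (\<phi> (\<Phi> x)) \<le> K * \<parallel>x\<parallel>\<^bsub>C\<^esub>"
  have "cmod (\<phi> y) \<le> K * \<parallel>y\<parallel>\<^bsub>C'\<^esub>" if "y \<in> car C'" for y
    using K[rule_format, of "\<Psi> y"] norm_\<Phi>[of "\<Psi> y"] that by (simp add: inverse \<Psi>(1))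
  thus "1 \<le> K" using assms by (simp add: state_def)
qed

lemma pure_state_pullback:
  assumes pure: "pure_state C' \<phi>" shows "pure_state C (\<lambda>x. \<phi> (\<Phi> x))"
  unfolding pure_state_def
proof (intro conjI allI impI)
  show "state C (\<lambda>x. \<phi> (\<Phi> x))" using pure by (intro state_pullback) (simp add: pure_state_def)
  fix \<rho> assume \<rho>: "positive_functional C \<rho> \<and> positive_functional C (\<lambda>x. \<phi> (\<Phi> x) - \<rho> x)"
  interpret S: star_equivalence C' C \<Psi> \<Phi> by (rule symmetric)
  have "positive_functional C' (\<lambda>y. \<rho> (\<Psi> y))" using \<rho> S.positive_functional_pullback by blast
  moreover have "positive_functional C' (\<lambda>y. \<phi> y - \<rho> (\<Psi> y))"
    using S.positive_functional_pullback[OF conjunct2[OF \<rho>]]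
    by (simp add: positive_functional_def inverse C'.ccloseds)
  ultimately obtain t :: real where t: "t \<in> {0..1}" "\<And>y. y \<in> car C' \<Longrightarrow> \<rho> (\<Psi> y) = of_real t * \<phi> y"
    using pure unfolding pure_state_def by blast
  have "\<rho> x = of_real t * \<phi> (\<Phi> x)" if "x \<in> car C" for x
    using t(2)[OF \<Phi>(1)[OF that]] by (simp add: inverse that)
  thus "\<exists>t\<in>{0..1::real}. \<forall>x\<in>car C. \<rho> x = of_real t * \<phi> (\<Phi> x)" using t(1) by blast
qed

lemma gns_kernel_pullback:
  assumes "x \<in> gns_kernel C (\<lambda>x. \<psi> (\<Phi> x))"
  shows "\<Phi> x \<in> gns_kernel C' \<psi>"
proof -
  have x: "x \<in> car C" "\<And>y. y \<in> car C \<Longrightarrow>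
      \<psi> (\<Phi> ((x \<otimes>\<^bsub>C\<^esub> y)\<^sup>\<star>\<^bsub>C\<^esub> \<otimes>\<^bsub>C\<^esub> (x \<otimes>\<^bsub>C\<^esub> y))) = 0"
    using assms by (auto simp: gns_kernel_def gns_null_def)
  have "\<psi> ((\<Phi> x \<otimes>\<^bsub>C'\<^esub> y)\<^sup>\<star>\<^bsub>C'\<^esub> \<otimes>\<^bsub>C'\<^esub> (\<Phi> x \<otimes>\<^bsub>C'\<^esub> y)) = 0" if y: "y \<in> car C'" for y
    using x(2)[OF \<Psi>(1)[OF y]] by (simp add: \<Phi> \<Psi> inverse x y C.ccloseds C'.ccloseds)
  thus ?thesis using x by (simp add: gns_kernel_def gns_null_def \<Phi> C'.ccloseds)
qed

lemma generated_image:
  assumes X: "X \<subseteq> car C" and X': "\<Phi> ` X \<subseteq> X'"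
    and x: "x \<in> car (generated_cstar C X)"
  shows "\<Phi> x \<in> car (generated_cstar C' X')"
proof -
  have "\<Phi> x \<in> D" if D: "cstar_subalgebra C' D" "X' \<subseteq> D" for D
  proof -
    have D': "\<zero>\<^bsub>C'\<^esub> \<in> D" "\<And>x y. \<lbrakk>x \<in> D; y \<in> D\<rbrakk> \<Longrightarrow> x \<oplus>\<^bsub>C'\<^esub> y \<in> D" "\<And>c x. x \<in> D \<Longrightarrow> c \<odot>\<^bsub>C'\<^esub> x \<in> D"
      "\<And>x y. \<lbrakk>x \<in> D; y \<in> D\<rbrakk> \<Longrightarrow> x \<otimes>\<^bsub>C'\<^esub> y \<in> D" "\<And>x. x \<in> D \<Longrightarrow> x\<^sup>\<star>\<^bsub>C'\<^esub> \<in> D"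
      using D(1) by (auto simp: cstar_subalgebra_def lin_subspace_def)
    have zero: "\<Phi> \<zero>\<^bsub>C\<^esub> = \<zero>\<^bsub>C'\<^esub>"
      using \<Phi>(3)[OF C.zero_closed, of 0] C'.zero_scal[OF \<Phi>(1)[OF C.zero_closed]] by (simp add: C.scal_zero)
    have "cstar_subalgebra C {x \<in> car C. \<Phi> x \<in> D}"
      unfolding cstar_subalgebra_def
    proof (intro conjI)
      show "lin_subspace C {x \<in> car C. \<Phi> x \<in> D}"
        by (auto simp: lin_subspace_def C.ccloseds \<Phi> D' zero)
      show "norm_closed C {x \<in> car C. \<Phi> x \<in> D}"
        unfolding norm_closed_def
      proof (intro allI ballI impI)
        fix Y x assume x: "x \<in> car C"
          and Y: "(\<forall>n::nat. Y n \<in> {x \<in> car C. \<Phi> x \<in> D}) \<and> (\<lambda>n. vdist C (Y n) x) \<longlonglongrightarrow> 0"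
        have "vdist C' (\<Phi> (Y n)) (\<Phi> x) = vdist C (Y n) x" for n
          using norm_\<Phi>[OF C.vsub_closed[of "Y n" x]] x Y
          by (simp add: vdist_def C.vsub_def \<Phi> C.ccloseds)
        hence "(\<lambda>n. vdist C' (\<Phi> (Y n)) (\<Phi> x)) \<longlonglongrightarrow> 0" using Y by simp
        moreover have "norm_closed C' D" using D(1) by (simp add: cstar_subalgebra_def)
        ultimately have "\<Phi> x \<in> D"
          using Y \<Phi>(1)[OF x] unfolding norm_closed_def
          by (elim allE[of _ "\<lambda>n. \<Phi> (Y n)"] ballE[of _ _ "\<Phi> x"]) auto
        thus "x \<in> {x \<in> car C. \<Phi> x \<in> D}" using x by simp
      qed
    qed (auto simp: C.ccloseds \<Phi> D')
    moreover have "X \<subseteq> {x \<in> car C. \<Phi> x \<in> D}" using X X' D(2) by blast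
    ultimately show ?thesis using x by (auto simp: generated_cstar_def)
  qed
  thus ?thesis by (simp add: generated_cstar_def)
qed

end

context cstar_algebra
begin

lemma generated_subalgebra:
  assumes "X \<subseteq> car C"
  shows "cstar_subalgebra C (car (generated_cstar C X))" "X \<subseteq> car (generated_cstar C X)"
proof -
  show "X \<subseteq> car (generated_cstar C X)" by (auto simp: generated_cstar_def)
  define \<S> where "\<S> = {D. cstar_subalgebra C D \<and> X \<subseteq> D}"
  have top: "cstar_subalgebra C (car C)"
    by (simp add: cstar_subalgebra_def lin_subspace_def norm_closed_def ccloseds)
  hence "car C \<in> \<S>" using assms by (simp add: \<S>_def)
  moreover have S: "cstar_subalgebra C D" if "D \<in> \<S>" for D using that by (simp add: \<S>_def)
  have "norm_closed C (\<Inter>\<S>)"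
    unfolding norm_closed_def
  proof (intro allI ballI impI InterI)
    fix Y x D assume "x \<in> car C" "(\<forall>n::nat. Y n \<in> \<Inter>\<S>) \<and> (\<lambda>n. vdist C (Y n) x) \<longlonglongrightarrow> 0" "D \<in> \<S>"
    moreover from this have "norm_closed C D" using S by (simp add: cstar_subalgebra_def)
    ultimately show "x \<in> D" unfolding norm_closed_def by auto
  qed
  ultimately have "cstar_subalgebra C (\<Inter>\<S>)"
    using S unfolding cstar_subalgebra_def lin_subspace_def by auto
  thus "cstar_subalgebra C (car (generated_cstar C X))" by (simp add: generated_cstar_def \<S>_def)
qed

lemma generated_cstar_algebra:
  assumes "X \<subseteq> car C" shows "cstar_algebra (generated_cstar C X)"
  using subalgebra_cstar[OF generated_subalgebra(1)[OF assms]] by (simp add: generated_cstar_def)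

end

lemma (in star_equivalence) generated_equivalence:
  assumes "X \<subseteq> car C" "X' \<subseteq> car C'" "\<Phi> ` X \<subseteq> X'" "\<Psi> ` X' \<subseteq> X"
  shows "star_equivalence (generated_cstar C X) (generated_cstar C' X') \<Phi> \<Psi>"
proof -
  interpret G: cstar_algebra "generated_cstar C X" by (rule C.generated_cstar_algebra[OF assms(1)])
  interpret G': cstar_algebra "generated_cstar C' X'" by (rule C'.generated_cstar_algebra[OF assms(2)])
  interpret S: star_equivalence C' C \<Psi> \<Phi> by (rule symmetric)
  have ops: "add (generated_cstar C X) = add C" "scal (generated_cstar C X) = scal C"
    "mul (generated_cstar C X) = mul C" "adj (generated_cstar C X) = adj C" for C :: "'z cstar" and X
    by (simp_all add: generated_cstar_def)
  have sub: "x \<in> car (generated_cstar C X) \<Longrightarrow> x \<in> car C" "y \<in> car (generated_cstar C' X') \<Longrightarrow> y \<in> car C'" for x y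
    using C.generated_subalgebra(1)[OF assms(1)] C'.generated_subalgebra(1)[OF assms(2)]
    by (auto simp: cstar_subalgebra_def lin_subspace_def)
  show ?thesis
  proof unfold_locales
    show "star_hom (generated_cstar C X) (generated_cstar C' X') \<Phi>"
      by (rule star_homI) (simp_all add: ops \<Phi> sub generated_image[OF assms(1,3)])
    show "star_hom (generated_cstar C' X') (generated_cstar C X) \<Psi>"
      by (rule star_homI) (simp_all add: ops \<Psi> sub S.generated_image[OF assms(2,4)])
  qed (simp_all add: inverse sub)
qed

text \<open>The operations on cosets are unions over representatives, so taking images under the isomorphism
  commutes with them.\<close>

lemma (in star_equivalence) quotient_isomorphic:
  assumes J: "J \<subseteq> car C" and J': "\<Phi> ` J = J'"
  shows "cstar_quotient C J \<cong> cstar_quotient C' J'"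
proof -
  have coset: "\<Phi> ` coset C J x = coset C' J' (\<Phi> x)" if "x \<in> car C" for x
    using J that unfolding coset_def J'[symmetric] image_image
    by (intro image_cong refl) (auto simp: \<Phi> subset_iff)
  have sub: "x \<in> car C" if "x \<in> X" "X \<in> coset C J ` car C" for x X
    using that J by (auto simp: coset_def C.ccloseds subset_iff)
  have "star_hom (cstar_quotient C J) (cstar_quotient C' J') ((`) \<Phi>)"
  proof (rule star_homI)
    fix X assume "X \<in> car (cstar_quotient C J)"
    hence X: "X \<in> coset C J ` car C" by (simp add: cstar_quotient_def)
    note X' = sub[OF _ X]
    show "\<Phi> ` X \<in> car (cstar_quotient C' J')" using X coset \<Phi>(1) by (auto simp: cstar_quotient_def)
    show "\<Phi> ` (c \<odot>\<^bsub>cstar_quotient C J\<^esub> X) = c \<odot>\<^bsub>cstar_quotient C' J'\<^esub> (\<Phi> ` X)" for c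
      using X' by (simp add: cstar_quotient_def image_UN coset C.ccloseds \<Phi>)
    show "\<Phi> ` (X\<^sup>\<star>\<^bsub>cstar_quotient C J\<^esub>) = (\<Phi> ` X)\<^sup>\<star>\<^bsub>cstar_quotient C' J'\<^esub>"
      using X' by (simp add: cstar_quotient_def image_UN coset C.ccloseds \<Phi>)
    fix Y assume "Y \<in> car (cstar_quotient C J)"
    hence Y: "Y \<in> coset C J ` car C" by (simp add: cstar_quotient_def)
    note Y' = sub[OF _ Y]
    show "\<Phi> ` (X \<oplus>\<^bsub>cstar_quotient C J\<^esub> Y) = (\<Phi> ` X) \<oplus>\<^bsub>cstar_quotient C' J'\<^esub> (\<Phi> ` Y)"
      using X' Y' by (simp add: cstar_quotient_def image_UN coset C.ccloseds \<Phi>)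
    show "\<Phi> ` (X \<otimes>\<^bsub>cstar_quotient C J\<^esub> Y) = (\<Phi> ` X) \<otimes>\<^bsub>cstar_quotient C' J'\<^esub> (\<Phi> ` Y)"
      using X' Y' by (simp add: cstar_quotient_def image_UN coset C.ccloseds \<Phi>)
  qed
  moreover have "bij_betw ((`) \<Phi>) (coset C J ` car C) (coset C' J' ` car C')"
    unfolding bij_betw_def
  proof
    have "coset C J ` car C \<subseteq> Pow (car C)" using sub by blast
    thus "inj_on ((`) \<Phi>) (coset C J ` car C)"
      using inj_on_image_Pow[OF bij_betw_imp_inj_on[OF \<Phi>_bij]] inj_on_subset by blast
    have "(`) \<Phi> ` coset C J ` car C = coset C' J' ` \<Phi> ` car C"
      unfolding image_image by (intro image_cong refl coset)
    thus "(`) \<Phi> ` coset C J ` car C = coset C' J' ` car C'"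
      by (simp add: bij_betw_imp_surj_on[OF \<Phi>_bij])
  qed
  ultimately show ?thesis
    unfolding star_isomorphic_def star_iso_def by (auto simp: cstar_quotient_def)
qed

context twisted_partial_action
begin

lemma full_equivalence:
  fixes C C' :: "'c cstar"
  assumes full: "full_cstar A C \<iota>" and full': "full_cstar A' C' \<iota>'"
  obtains \<Phi> \<Psi> where "star_equivalence C C' \<Phi> \<Psi>"
    "\<And>s a. a \<in> D s \<Longrightarrow> \<Phi> (\<iota> s a) = \<iota>' (pgen s) a"
    "\<And>x a. a \<in> prdom x \<Longrightarrow> \<Psi> (\<iota>' x a) = \<iota> (pr_deg x) a"
proof -
  have \<iota>: "cstar_algebra C" "fell_rep A C \<iota>" and \<iota>': "cstar_algebra C'" "fell_rep A' C' \<iota>'"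
    using full full' by (simp_all add: full_cstar_def)
  obtain \<Phi> where \<Phi>: "star_hom C C' \<Phi>" "\<And>s a. a \<in> D s \<Longrightarrow> \<Phi> (\<iota> s a) = \<iota>' (pgen s) a"
    using full_cstar_hom[OF full \<iota>'(1) fell_rep_section[OF \<iota>'(2)]] unfolding fcar_A by metis
  obtain \<Psi> where \<Psi>: "star_hom C' C \<Psi>" "\<And>x a. a \<in> prdom x \<Longrightarrow> \<Psi> (\<iota>' x a) = \<iota> (pr_deg x) a"
    using full_cstar_hom[OF full' \<iota>(1) fell_rep_pullback[OF \<iota>(2)]] unfolding fcar_A by metis
  have "\<Psi> (\<Phi> x) = x" if "x \<in> car C" for x
    by (rule full_cstar_unique[OF full star_hom_compose[OF \<Phi>(1) \<Psi>(1)] _ that])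
      (use \<Phi>(2) \<Psi>(2) in \<open>simp add: fcar_A prdom_pgen\<close>)
  moreover have "\<Phi> (\<Psi> y) = y" if "y \<in> car C'" for y
    by (rule full_cstar_unique[OF full' star_hom_compose[OF \<Psi>(1) \<Phi>(1)] _ that])
      (simp add: fcar_A \<Psi>(2) \<Phi>(2) subsetD[OF prdom_deg] fell_rep_pgen_deg[OF \<iota>'(2)])
  ultimately have "star_equivalence C C' \<Phi> \<Psi>"
    using \<iota>(1) \<iota>'(1) \<Phi>(1) \<Psi>(1) by (simp add: star_equivalence_def star_equivalence_axioms_def)
  thus thesis using that \<Phi>(2) \<Psi>(2) by blast
qed

end

section \<open>Closures of subspaces\<close>

context cstar_algebra
begin

definition nclosure :: "'a set \<Rightarrow> 'a set" where
  "nclosure X = {x \<in> car C. \<forall>\<epsilon>>0. \<exists>y\<in>X. \<parallel>x \<ominus> y\<parallel> < \<epsilon>}"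

lemma nclosure_subset: assumes "X \<subseteq> car C" shows "X \<subseteq> nclosure X"
proof
  fix x assume x: "x \<in> X"
  have "\<parallel>x \<ominus> x\<parallel> = 0" using vsub_eq_zero_iff[of x x] x assms by (auto simp: norm_zero)
  thus "x \<in> nclosure X" using x assms by (auto simp: nclosure_def intro!: bexI[of _ x])
qed

lemma nclosure_idem:
  assumes X: "X \<subseteq> car C" shows "nclosure (nclosure X) \<subseteq> nclosure X"
proof
  fix x assume x: "x \<in> nclosure (nclosure X)"
  show "x \<in> nclosure X"
    unfolding nclosure_def
  proof (intro CollectI conjI allI impI)
    show xC: "x \<in> car C" using x by (simp add: nclosure_def)
    fix \<epsilon> :: real assume "\<epsilon> > 0"
    hence e: "\<epsilon> / 2 > 0" by simp
    then obtain y where y: "y \<in> nclosure X" "\<parallel>x \<ominus> y\<parallel> < \<epsilon> / 2" using x unfolding nclosure_def by blast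
    then obtain z where z: "z \<in> X" "\<parallel>y \<ominus> z\<parallel> < \<epsilon> / 2" using e unfolding nclosure_def by blast
    have "\<parallel>x \<ominus> z\<parallel> < \<epsilon>"
      using norm_vsub_triangle[of x y z] y z xC X by (auto simp: nclosure_def)
    thus "\<exists>y\<in>X. \<parallel>x \<ominus> y\<parallel> < \<epsilon>" using z by blast
  qed
qed

lemma nclosure_map:
  assumes X: "X \<subseteq> car C" and f: "\<And>y. y \<in> car C \<Longrightarrow> f y \<in> car C" "\<And>y. y \<in> X \<Longrightarrow> f y \<in> nclosure X"
    and lip: "\<And>y z. \<lbrakk>y \<in> car C; z \<in> car C\<rbrakk> \<Longrightarrow> \<parallel>f y \<ominus> f z\<parallel> \<le> K * \<parallel>y \<ominus> z\<parallel>"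
    and y: "y \<in> nclosure X"
  shows "f y \<in> nclosure X"
proof -
  have yC: "y \<in> car C" using y by (simp add: nclosure_def)
  have "\<exists>z\<in>nclosure X. \<parallel>f y \<ominus> z\<parallel> < \<epsilon>" if "\<epsilon> > 0" for \<epsilon>
  proof -
    have "\<epsilon> / (\<bar>K\<bar> + 1) > 0" using that by simp
    then obtain x where x: "x \<in> X" "\<parallel>y \<ominus> x\<parallel> < \<epsilon> / (\<bar>K\<bar> + 1)" using y unfolding nclosure_def by blast
    have xC: "x \<in> car C" using x X by blast
    have n: "0 \<le> \<parallel>y \<ominus> x\<parallel>" by (simp add: norm_nonneg ccloseds xC yC)
    have "\<parallel>f y \<ominus> f x\<parallel> \<le> K * \<parallel>y \<ominus> x\<parallel>" by (rule lip[OF yC xC])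
    also have "\<dots> \<le> (\<bar>K\<bar> + 1) * \<parallel>y \<ominus> x\<parallel>" using n by (intro mult_right_mono) auto
    also have "\<dots> < \<epsilon>" using x(2) by (simp add: field_simps)
    finally show ?thesis using f(2)[OF x(1)] by blast
  qed
  hence "f y \<in> nclosure (nclosure X)" using f(1)[OF yC] by (simp add: nclosure_def)
  thus ?thesis using nclosure_idem[OF X] by blast
qed

lemma nclosure_closed: assumes X: "X \<subseteq> car C" shows "norm_closed C (nclosure X)"
  unfolding norm_closed_def
proof (intro allI ballI impI)
  fix Y x assume x: "x \<in> car C" and Y: "(\<forall>n::nat. Y n \<in> nclosure X) \<and> (\<lambda>n. vdist C (Y n) x) \<longlonglongrightarrow> 0"
  have "\<exists>z\<in>nclosure X. \<parallel>x \<ominus> z\<parallel> < \<epsilon>" if e: "\<epsilon> > 0" for \<epsilon>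
  proof -
    obtain n where n: "vdist C (Y n) x < \<epsilon>"
      using order_tendstoD(2)[OF conjunct2[OF Y] e] by (auto simp: eventually_sequentially)
    have "Y n \<in> car C" using Y by (simp add: nclosure_def)
    thus ?thesis using n Y norm_vsub_commute[of x "Y n"] x by (intro bexI[of _ "Y n"]) (simp_all add: vdist_vsub)
  qed
  hence "x \<in> nclosure (nclosure X)" using x by (simp add: nclosure_def)
  thus "x \<in> nclosure X" using nclosure_idem[OF X] by blast
qed

lemma nclosure_subspace:
  assumes X: "lin_subspace C X" shows "lin_subspace C (nclosure X)"
proof -
  have XC: "X \<subseteq> car C" using X by (simp add: lin_subspace_def)
  have tr: "\<parallel>(x \<oplus> y) \<ominus> (x \<oplus> z)\<parallel> = \<parallel>y \<ominus> z\<parallel>" if "x \<in> car C" "y \<in> car C" "z \<in> car C" for x y z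
  proof -
    have "(x \<oplus> y) \<ominus> (x \<oplus> z) = y \<ominus> z"
      by (rule coordinates[of x y z x x]) (simp_all add: that vsub_def)
    thus ?thesis by simp
  qed
  have 1: "x \<oplus> y \<in> nclosure X" if "x \<in> X" "y \<in> nclosure X" for x y
  proof (rule nclosure_map[OF XC _ _ _ that(2), of "\<lambda>y. x \<oplus> y" 1])
    show "x \<oplus> z \<in> nclosure X" if "z \<in> X" for z
      using that \<open>x \<in> X\<close> X nclosure_subset[OF XC] by (auto simp: lin_subspace_def)
  qed (use that XC in \<open>auto simp: ccloseds tr\<close>)
  have 2: "x \<oplus> y \<in> nclosure X" if "x \<in> nclosure X" "y \<in> nclosure X" for x y
  proof -
    have yC: "y \<in> car C" using that by (simp add: nclosure_def)
    have "y \<oplus> x \<in> nclosure X"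
    proof (rule nclosure_map[OF XC _ _ _ that(1), of "\<lambda>x. y \<oplus> x" 1])
      show "y \<oplus> z \<in> nclosure X" if "z \<in> X" for z
        using 1[OF that \<open>y \<in> nclosure X\<close>] add_commute[OF yC, of z] that XC by auto
    qed (use yC in \<open>auto simp: ccloseds tr\<close>)
    thus ?thesis using add_commute[OF yC, of x] that by (simp add: nclosure_def)
  qed
  have 3: "c \<odot> x \<in> nclosure X" if "x \<in> nclosure X" for c x
  proof (rule nclosure_map[OF XC _ _ _ that, of "\<lambda>x. c \<odot> x" "cmod c"])
    show "c \<odot> z \<in> nclosure X" if "z \<in> X" for z
      using that X nclosure_subset[OF XC] by (auto simp: lin_subspace_def)
    show "\<parallel>c \<odot> y \<ominus> c \<odot> z\<parallel> \<le> cmod c * \<parallel>y \<ominus> z\<parallel>" if yz: "y \<in> car C" "z \<in> car C" for y z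
    proof -
      have "c \<odot> y \<ominus> c \<odot> z = c \<odot> (y \<ominus> z)" by (rule coordinates[of y z y y y]) (simp_all add: yz vsub_def)
      thus ?thesis using yz by (simp add: norm_scal ccloseds)
    qed
  qed (simp add: ccloseds)
  have "\<zero> \<in> nclosure X" using X nclosure_subset[OF XC] by (auto simp: lin_subspace_def)
  thus ?thesis using 2 3 by (auto simp: lin_subspace_def nclosure_def[of X])
qed

lemma nclosure_adj:
  assumes X: "X \<subseteq> car C" "\<And>x. x \<in> X \<Longrightarrow> x\<^sup>\<star> \<in> X" and y: "y \<in> nclosure X"
  shows "y\<^sup>\<star> \<in> nclosure X"
  by (rule nclosure_map[OF X(1) _ _ _ y, of "adj C" 1])
    (use X(2) nclosure_subset[OF X(1)] in \<open>auto simp: ccloseds norm_adj simp flip: adj_vsub\<close>)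

lemma nclosure_mul:
  assumes X: "X \<subseteq> car C" and x: "x \<in> car C" "\<And>y. y \<in> X \<Longrightarrow> x \<otimes> y \<in> nclosure X" and y: "y \<in> nclosure X"
  shows "x \<otimes> y \<in> nclosure X"
  by (rule nclosure_map[where f = "\<lambda>y. x \<otimes> y" and K = "\<parallel>x\<parallel>", OF X _ _ _ y])
    (simp_all add: x ccloseds norm_mul flip: mul_vsub)

text \<open>The elements \<open>x\<close> for which \<open>x\<close> and \<open>x\<^sup>\<star>\<close> multiply the closure into itself form a \<open>C\<^sup>*\<close>-subalgebra,
  and it contains the generators.\<close>

lemma generated_mul_nclosure:
  assumes G: "G \<subseteq> car C" "\<And>g. g \<in> G \<Longrightarrow> g\<^sup>\<star> \<in> G" and X: "lin_subspace C X"
    and GX: "\<And>g y. \<lbrakk>g \<in> G; y \<in> X\<rbrakk> \<Longrightarrow> g \<otimes> y \<in> nclosure X"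
    and x: "x \<in> car (generated_cstar C G)" and y: "y \<in> nclosure X"
  shows "x \<otimes> y \<in> nclosure X"
proof -
  have XC: "X \<subseteq> car C" using X by (simp add: lin_subspace_def)
  define N where "N = nclosure X"
  have N: "\<zero> \<in> N" "\<And>x y. \<lbrakk>x \<in> N; y \<in> N\<rbrakk> \<Longrightarrow> x \<oplus> y \<in> N" "\<And>c x. x \<in> N \<Longrightarrow> c \<odot> x \<in> N" "\<And>x. x \<in> N \<Longrightarrow> x \<in> car C"
    using nclosure_subspace[OF X] by (auto simp: lin_subspace_def N_def)
  define S where "S = {x \<in> car C. \<forall>y\<in>N. x \<otimes> y \<in> N \<and> x\<^sup>\<star> \<otimes> y \<in> N}"
  have za: "\<zero>\<^sup>\<star> = \<zero>" using adj_scal[OF zero_closed, of 0] by (simp add: zero_scal ccloseds)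
  have "cstar_subalgebra C S"
    unfolding cstar_subalgebra_def
  proof (intro conjI)
    show "lin_subspace C S"
      by (auto simp: lin_subspace_def S_def ccloseds za mul_zero N mul_add_left adj_add mul_scal_left adj_scal)
    show "\<forall>x\<in>S. \<forall>y\<in>S. x \<otimes> y \<in> S" by (auto simp: S_def ccloseds N adj_mul mul_assoc)
    show "\<forall>x\<in>S. x\<^sup>\<star> \<in> S" by (auto simp: S_def ccloseds adj_adj)
    show "norm_closed C S"
      unfolding norm_closed_def
    proof (intro allI ballI impI)
      fix Y x assume x: "x \<in> car C" and Y: "(\<forall>n::nat. Y n \<in> S) \<and> (\<lambda>n. vdist C (Y n) x) \<longlonglongrightarrow> 0"
      have YC: "Y n \<in> car C" for n using Y by (simp add: S_def)
      have l: "(\<lambda>n. \<parallel>Y n \<ominus> x\<parallel>) \<longlonglongrightarrow> 0" using Y by (simp add: vdist_vsub)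
      have "\<parallel>(Y n)\<^sup>\<star> \<ominus> x\<^sup>\<star>\<parallel> = \<parallel>Y n \<ominus> x\<parallel>" for n
        using norm_adj[OF vsub_closed[OF YC x], of n] by (simp add: adj_vsub YC x)
      hence la: "(\<lambda>n. \<parallel>(Y n)\<^sup>\<star> \<ominus> x\<^sup>\<star>\<parallel>) \<longlonglongrightarrow> 0" using l by simp
      have cl: "norm_closed C N" unfolding N_def by (rule nclosure_closed[OF XC])
      have "x \<otimes> y \<in> N \<and> x\<^sup>\<star> \<otimes> y \<in> N" if y: "y \<in> N" for y
      proof
        have "(\<lambda>n. vdist C (Y n \<otimes> y) (x \<otimes> y)) \<longlonglongrightarrow> 0"
          unfolding vdist_vsub by (rule limit_mul(2)[OF _ x N(4)[OF y] l]) (simp add: YC)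
        moreover have "\<forall>n. Y n \<otimes> y \<in> N" using Y y by (simp add: S_def)
        ultimately show "x \<otimes> y \<in> N" using cl mul_closed[OF x N(4)[OF y]] unfolding norm_closed_def
          by (elim allE[of _ "\<lambda>n. Y n \<otimes> y"] ballE[of _ _ "x \<otimes> y"]) auto
        have "(\<lambda>n. vdist C ((Y n)\<^sup>\<star> \<otimes> y) (x\<^sup>\<star> \<otimes> y)) \<longlonglongrightarrow> 0"
          unfolding vdist_vsub by (rule limit_mul(2)[OF _ adj_closed[OF x] N(4)[OF y] la]) (simp add: YC ccloseds)
        moreover have "\<forall>n. (Y n)\<^sup>\<star> \<otimes> y \<in> N" using Y y by (simp add: S_def)
        ultimately show "x\<^sup>\<star> \<otimes> y \<in> N" using cl mul_closed[OF adj_closed[OF x] N(4)[OF y]] unfolding norm_closed_def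
          by (elim allE[of _ "\<lambda>n. (Y n)\<^sup>\<star> \<otimes> y"] ballE[of _ _ "x\<^sup>\<star> \<otimes> y"]) auto
      qed
      thus "x \<in> S" using x by (simp add: S_def)
    qed
  qed
  moreover have "G \<subseteq> S"
  proof
    fix g assume g: "g \<in> G"
    have "h \<otimes> y \<in> N" if "h \<in> G" "y \<in> N" for h y
      unfolding N_def by (rule nclosure_mul[OF XC]) (use that G GX in \<open>auto simp: N_def\<close>)
    thus "g \<in> S" using g G by (auto simp: S_def)
  qed
  ultimately have "x \<in> S" using x by (auto simp: generated_cstar_def)
  thus ?thesis using y by (simp add: S_def N_def)
qed

lemma nclosure_minimal:
  assumes X: "X \<subseteq> car C" "X \<subseteq> N" and N: "norm_closed C N"
  shows "nclosure X \<subseteq> N"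
proof
  fix x assume x: "x \<in> nclosure X"
  hence xC: "x \<in> car C" by (simp add: nclosure_def)
  have "\<exists>y\<in>X. \<parallel>x \<ominus> y\<parallel> < inverse (real (Suc n))" for n using x by (simp add: nclosure_def)
  then obtain Y where Y: "\<And>n. Y n \<in> X" "\<And>n. \<parallel>x \<ominus> Y n\<parallel> < inverse (real (Suc n))" by metis
  have le: "norm (vdist C (Y n) x) \<le> inverse (real (Suc n))" for n
  proof -
    have YC: "Y n \<in> car C" using Y(1) X(1) by blast
    show ?thesis
      using Y(2)[of n] norm_vsub_commute[OF xC YC] norm_nonneg[OF vsub_closed[OF YC xC]] by (simp add: vdist_vsub)
  qed
  have "(\<lambda>n. vdist C (Y n) x) \<longlonglongrightarrow> 0"
    by (rule Lim_null_comparison[OF always_eventually[OF allI[OF le]] LIMSEQ_inverse_real_of_nat])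
  thus "x \<in> N" using N xC Y(1) X(2) unfolding norm_closed_def by blast
qed

lemma nclosure_unit:
  assumes X: "X \<subseteq> car C" and F: "\<forall>\<^sub>F v in F. v \<in> car C \<and> \<parallel>v\<parallel> \<le> 1"
    and unit: "\<And>y. y \<in> X \<Longrightarrow> ((\<lambda>v. \<parallel>v \<otimes> y \<ominus> y\<parallel>) \<longlongrightarrow> 0) F" and y: "y \<in> nclosure X"
  shows "((\<lambda>v. \<parallel>v \<otimes> y \<ominus> y\<parallel>) \<longlongrightarrow> 0) F"
  unfolding tendsto_iff
proof (intro allI impI)
  fix \<epsilon> :: real assume "\<epsilon> > 0"
  hence e: "\<epsilon> / 3 > 0" by simp
  then obtain x where x: "x \<in> X" "\<parallel>y \<ominus> x\<parallel> < \<epsilon> / 3" using y unfolding nclosure_def by blast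
  have c: "x \<in> car C" "y \<in> car C" using x X y by (auto simp: nclosure_def)
  have "\<forall>\<^sub>F v in F. \<parallel>v \<otimes> x \<ominus> x\<parallel> < \<epsilon> / 3" by (rule order_tendstoD(2)[OF unit[OF x(1)] e])
  thus "\<forall>\<^sub>F v in F. dist \<parallel>v \<otimes> y \<ominus> y\<parallel> 0 < \<epsilon>"
    using F
  proof eventually_elim
    case (elim v)
    have v: "v \<in> car C" using elim by simp
    have "\<parallel>v \<otimes> y \<ominus> v \<otimes> x\<parallel> \<le> \<parallel>v\<parallel> * \<parallel>y \<ominus> x\<parallel>"
      using norm_mul[of v "y \<ominus> x"] v c by (simp add: mul_vsub ccloseds)
    also have "\<dots> \<le> 1 * \<parallel>y \<ominus> x\<parallel>"
      using elim norm_nonneg[of "y \<ominus> x"] c by (intro mult_right_mono) (auto simp: ccloseds)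
    finally have "\<parallel>v \<otimes> y \<ominus> v \<otimes> x\<parallel> \<le> \<parallel>y \<ominus> x\<parallel>" by simp
    moreover have "\<parallel>v \<otimes> y \<ominus> y\<parallel> \<le> \<parallel>v \<otimes> y \<ominus> v \<otimes> x\<parallel> + \<parallel>v \<otimes> x \<ominus> y\<parallel>"
      "\<parallel>v \<otimes> x \<ominus> y\<parallel> \<le> \<parallel>v \<otimes> x \<ominus> x\<parallel> + \<parallel>x \<ominus> y\<parallel>"
      using v c by (auto intro!: norm_vsub_triangle simp: ccloseds)
    ultimately have "\<parallel>v \<otimes> y \<ominus> y\<parallel> < \<epsilon>"
      using elim(1) x(2) norm_vsub_commute[OF c] by linarith
    thus ?case using norm_nonneg[of "v \<otimes> y \<ominus> y"] v c by (simp add: ccloseds)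
  qed
qed

end

section \<open>Extensions of pure states to the cross-sectional algebras\<close>

context twisted_partial_action
begin

lemma idem_fmul:
  assumes e: "e \<in> idem" and f: "f \<in> idem" and a: "a \<in> D e" and b: "b \<in> D f"
  shows "fmul A e f a b = a \<otimes> b"
proof -
  have ee: "sinv e = e" using e by (rule sinv_idem')
  have inv: "act_inv \<alpha> e a = a"
    using act_inv_closed[OF a] act_idem[OF e, of "act_inv \<alpha> e a"] by (simp add: ee)
  have ab: "a \<otimes> b \<in> D e" "a \<otimes> b \<in> D f" using D_ideal(5,6) D_ideal(1) a b by blast+
  thus ?thesis using D_idem_mult[OF e, of f]
    by (simp add: twisted_bundle_def inv act_idem[OF e] coc_idem[OF e f]) (simp add: mult_one_def)
qed

lemma fiber_cstar: "cstar_algebra (B\<lparr>car := D e\<rparr>)"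
  by (rule ideal_cstar[OF ideals])

lemma idem_fiber_hom:
  assumes "fell_rep A C \<iota>" "e \<in> idem"
  shows "star_hom (B\<lparr>car := D e\<rparr>) C (\<iota> e)"
proof -
  note p = fell_repD[OF assms(1), unfolded fcar_A fib_simps]
  have ee: "e * e = e" "sinv e = e" using assms(2) by (simp_all add: idem_def sinv_idem)
  show ?thesis
    by (rule star_homI)
      (use p(1-3) p(4)[of _ e _ e] p(5)[of _ e] idem_fiber[OF assms(2)] in \<open>simp_all add: ee\<close>)
qed

lemma fiber_approximate_unit:
  assumes e: "e \<in> idem"
  obtains F where "approximate_unit A e F"
proof -
  interpret E: cstar_algebra "B\<lparr>car := D e\<rparr>" by (rule fiber_cstar)
  obtain F where F: "F \<noteq> bot" "\<forall>\<^sub>F u in F. u \<in> D e \<and> \<parallel>u\<parallel> \<le> 1"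
    "\<And>a. a \<in> D e \<Longrightarrow> ((\<lambda>u. \<parallel>a \<otimes> u \<ominus> a\<parallel>) \<longlongrightarrow> 0) F"
    "\<And>a. a \<in> D e \<Longrightarrow> ((\<lambda>u. \<parallel>u \<otimes> a \<ominus> a\<parallel>) \<longlongrightarrow> 0) F"
  proof -
    have vs: "E.vsub = vsub" by (simp add: fun_eq_iff vsub_def E.vsub_def)
    show thesis by (rule E.approximate_unit_filter) (rule that, simp_all add: vs)
  qed
  have m: "\<forall>\<^sub>F u in F. u \<in> D e" using F(2) by eventually_elim simp
  have "((\<lambda>u. vdist (fib A e) (fmul A e e a u) a) \<longlongrightarrow> 0) F"
    "((\<lambda>u. vdist (fib A e) (fmul A e e u a) a) \<longlongrightarrow> 0) F" if a: "a \<in> D e" for a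
  proof -
    have v: "vdist (fib A e) x y = \<parallel>x \<ominus> y\<parallel>" for x y by (simp add: vdist_def vsub_def fib_simps)
    show "((\<lambda>u. vdist (fib A e) (fmul A e e a u) a) \<longlongrightarrow> 0) F"
      by (rule Lim_transform_eventually[OF F(3)[OF a]])
        (use m in \<open>eventually_elim, simp add: v idem_fmul[OF e e a]\<close>)
    show "((\<lambda>u. vdist (fib A e) (fmul A e e u a) a) \<longlongrightarrow> 0) F"
      by (rule Lim_transform_eventually[OF F(4)[OF a]])
        (use m in \<open>eventually_elim, simp add: v idem_fmul[OF e e _ a]\<close>)
  qed
  thus thesis using F(1,2) by (intro that[of F]) (simp add: approximate_unit_def fcar_A fib_simps)
qed

lemma approximate_unitD:
  assumes e: "e \<in> idem" and F: "approximate_unit A' e F"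
  shows "F \<noteq> bot" "\<forall>\<^sub>F u in F. u \<in> prdom e \<and> \<parallel>u\<parallel> \<le> 1"
    "a \<in> prdom e \<Longrightarrow> ((\<lambda>u. \<parallel>u \<otimes> a \<ominus> a\<parallel>) \<longlongrightarrow> 0) F"
proof -
  show bd: "F \<noteq> bot" "\<forall>\<^sub>F u in F. u \<in> prdom e \<and> \<parallel>u\<parallel> \<le> 1"
    using F by (simp_all add: approximate_unit_def fcar_A fib_simps)
  show "((\<lambda>u. \<parallel>u \<otimes> a \<ominus> a\<parallel>) \<longlongrightarrow> 0) F" if a: "a \<in> prdom e"
  proof (rule Lim_transform_eventually)
    show "((\<lambda>u. vdist (fib A' e) (fmul A' e e u a) a) \<longlongrightarrow> 0) F"
      using F a by (simp add: approximate_unit_def fcar_A)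
    show "\<forall>\<^sub>F u in F. vdist (fib A' e) (fmul A' e e u a) a = \<parallel>u \<otimes> a \<ominus> a\<parallel>"
      using bd(2)
    proof eventually_elim
      case (elim u)
      have "fmul A' e e u a = u \<otimes> a"
        using elim a prdom_deg[of e] fmul_restrict[of u e a e] idem_fmul[OF pr_deg_idem[OF e] pr_deg_idem[OF e], of u a]
        by auto
      thus ?case by (simp add: vdist_def vsub_def fib_simps)
    qed
  qed
qed

lemma approximate_unit_restrict:
  assumes e: "x \<in> idem" and dom: "prdom x = D (pr_deg x)"
  shows "approximate_unit A' x F \<longleftrightarrow> approximate_unit A (pr_deg x) F"
proof -
  have v: "vdist (fib A' x) = vdist (fib A (pr_deg x))" by (simp add: fun_eq_iff vdist_def fib_simps)
  have "((\<lambda>u. vdist (fib A (pr_deg x)) (fmul A' x x a u) a) \<longlongrightarrow> 0) F \<longleftrightarrow>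
        ((\<lambda>u. vdist (fib A (pr_deg x)) (fmul A (pr_deg x) (pr_deg x) a u) a) \<longlongrightarrow> 0) F"
       "((\<lambda>u. vdist (fib A (pr_deg x)) (fmul A' x x u a) a) \<longlongrightarrow> 0) F \<longleftrightarrow>
        ((\<lambda>u. vdist (fib A (pr_deg x)) (fmul A (pr_deg x) (pr_deg x) u a) a) \<longlongrightarrow> 0) F"
    if m: "\<forall>\<^sub>F u in F. u \<in> D (pr_deg x) \<and> \<parallel>u\<parallel> \<le> 1" and a: "a \<in> D (pr_deg x)" for a
    by (rule tendsto_cong, use m in eventually_elim, use a in \<open>simp add: fmul_restrict dom\<close>)+
  thus ?thesis unfolding approximate_unit_def fcar_A fib_simps dom v by blast
qed

context
  fixes C :: "'c cstar" and \<iota> \<phi>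
  assumes C: "cstar_algebra C" and \<iota>: "fell_rep A C \<iota>"
    and pure: "pure_state (idem_cstar A C \<iota>) \<phi>"
begin

interpretation C: cstar_algebra C by (rule C)

abbreviation E where "E \<equiv> idem_cstar A C \<iota>"

lemma idem_generators:
  defines "G \<equiv> (\<Union>e\<in>idem. \<iota> e ` D e)"
  shows "E = generated_cstar C G" "G \<subseteq> car C" "g \<in> G \<Longrightarrow> g\<^sup>\<star>\<^bsub>C\<^esub> \<in> G" "G \<subseteq> car E" "cstar_algebra E"
    "cstar_subalgebra C (car E)"
proof -
  show 1: "E = generated_cstar C G" by (simp add: idem_cstar_def G_def fcar_A)
  show 2: "G \<subseteq> car C" using fell_repD(1)[OF \<iota>] by (auto simp: G_def fcar_A)
  show "g\<^sup>\<star>\<^bsub>C\<^esub> \<in> G" if g: "g \<in> G"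
  proof -
    obtain e a where e: "e \<in> idem" "a \<in> D e" "g = \<iota> e a" using g by (auto simp: G_def)
    hence "g\<^sup>\<star>\<^bsub>C\<^esub> = \<iota> e (a\<^sup>\<star>)" using star_homD(5)[OF idem_fiber_hom[OF \<iota> e(1)], of a] by simp
    thus ?thesis using e(1) D_ideal(7)[OF e(2)] by (auto simp: G_def)
  qed
  show "G \<subseteq> car E" "cstar_algebra E" "cstar_subalgebra C (car E)"
    unfolding 1 using C.generated_subalgebra[OF 2] C.generated_cstar_algebra[OF 2] by auto
qed

interpretation E: cstar_algebra E by (rule idem_generators(5))

lemma E_ops: "zer E = zer C" "add E = add C" "scal E = scal C" "nrm E = nrm C" "mul E = mul C" "adj E = adj C"
  by (simp_all add: idem_cstar_def generated_cstar_def)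

lemma E_vsub: "E.vsub = C.vsub"
  by (simp add: fun_eq_iff E.vsub_def C.vsub_def E_ops)

lemma E_car: "x \<in> car E \<Longrightarrow> x \<in> car C"
  using idem_generators(6) by (auto simp: cstar_subalgebra_def lin_subspace_def)

lemma fiber_in_E: "\<lbrakk>e \<in> idem; a \<in> D e\<rbrakk> \<Longrightarrow> \<iota> e a \<in> car E"
  using idem_generators(4) by blast

lemma \<phi>_state:
  "positive_functional E \<phi>" "x \<in> car E \<Longrightarrow> cmod (\<phi> x) \<le> \<parallel>x\<parallel>\<^bsub>C\<^esub>"
  using pure by (auto simp: pure_state_def state_def E_ops)

lemma norm_idem_fiber: "\<lbrakk>e \<in> idem; a \<in> D e\<rbrakk> \<Longrightarrow> \<parallel>\<iota> e a\<parallel>\<^bsub>C\<^esub> \<le> \<parallel>a\<parallel>"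
  using star_hom_contractive[OF fiber_cstar[of e] C idem_fiber_hom[OF \<iota>]] by simp

text \<open>The closure of the image of the fiber over \<open>x\<close> is an ideal of the algebra generated by the fibers
  over idempotents, because \<open>\<iota> f c \<cdot> \<iota> e a = \<iota> e (c a)\<close> for idempotents \<open>e\<close> and \<open>f\<close>. So \<open>pure_ideal_unit\<close> applies to it.\<close>

lemma pure_fiber_unit:
  assumes x: "x \<in> idem" and nz: "b \<in> prdom x" "\<phi> (\<iota> (pr_deg x) b) \<noteq> 0"
    and F: "approximate_unit A' x F" and \<epsilon>: "\<epsilon> > 0"
  shows "\<forall>\<^sub>F u in F. \<forall>y\<in>car E. cmod (\<phi> (y \<otimes>\<^bsub>C\<^esub> \<iota> (pr_deg x) u) - \<phi> y) \<le> \<epsilon> * (\<parallel>y\<parallel>\<^bsub>C\<^esub> + 1)"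
proof -
  define e where "e = pr_deg x"
  have e: "e \<in> idem" unfolding e_def by (rule pr_deg_idem[OF x])
  have sub: "a \<in> prdom x \<Longrightarrow> a \<in> D e" for a using prdom_deg unfolding e_def by blast
  note FD = approximate_unitD[OF x F]
  note h = star_homD[OF idem_fiber_hom[OF \<iota> e], simplified]
  define X where "X = \<iota> e ` prdom x"
  have zero: "\<iota> e \<zero> = \<zero>\<^bsub>C\<^esub>"
    using h(3)[of \<zero> 0] D_ideal(2) h(1)[of \<zero>] by (simp add: C.zero_scal scal_zero)
  have XE: "X \<subseteq> car E" using fiber_in_E[OF e] sub by (auto simp: X_def)
  have XC: "X \<subseteq> car C" using XE E_car by blast
  have Xsub: "lin_subspace C X"
    unfolding lin_subspace_def
  proof (intro conjI ballI allI)
    show "\<zero>\<^bsub>C\<^esub> \<in> X" unfolding X_def zero[symmetric] by (rule imageI) (rule prdomD(2))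
    show "y \<oplus>\<^bsub>C\<^esub> z \<in> X" if y: "y \<in> X" and z: "z \<in> X" for y z
    proof -
      obtain a where a: "a \<in> prdom x" "y = \<iota> e a" using y by (auto simp: X_def)
      obtain c where c: "c \<in> prdom x" "z = \<iota> e c" using z by (auto simp: X_def)
      have "y \<oplus>\<^bsub>C\<^esub> z = \<iota> e (a \<oplus> c)" using h(2)[OF sub[OF a(1)] sub[OF c(1)]] a(2) c(2) by simp
      thus ?thesis using prdomD(3)[OF a(1) c(1)] by (simp add: X_def)
    qed
    show "k \<odot>\<^bsub>C\<^esub> y \<in> X" if y: "y \<in> X" for y k
    proof -
      obtain a where a: "a \<in> prdom x" "y = \<iota> e a" using y by (auto simp: X_def)
      have "k \<odot>\<^bsub>C\<^esub> y = \<iota> e (k \<odot> a)" using h(3)[OF sub[OF a(1)]] a(2) by simp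
      thus ?thesis using prdomD(4)[OF a(1)] by (simp add: X_def)
    qed
  qed (rule XC)
  have Xadj: "y\<^sup>\<star>\<^bsub>C\<^esub> \<in> X" if y: "y \<in> X" for y
  proof -
    obtain a where a: "a \<in> prdom x" "y = \<iota> e a" using y by (auto simp: X_def)
    have "y\<^sup>\<star>\<^bsub>C\<^esub> = \<iota> e (a\<^sup>\<star>)" using h(5)[OF sub[OF a(1)]] a(2) by simp
    thus ?thesis using prdomD(7)[OF a(1)] by (simp add: X_def)
  qed
  have GX: "g \<otimes>\<^bsub>C\<^esub> y \<in> C.nclosure X" if gy: "g \<in> (\<Union>e\<in>idem. \<iota> e ` D e)" "y \<in> X" for g y
  proof -
    obtain f c where f: "f \<in> idem" "c \<in> D f" "g = \<iota> f c" using gy(1) by blast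
    obtain a where a: "a \<in> prdom x" "y = \<iota> e a" using gy(2) by (auto simp: X_def)
    have fe: "f * e \<in> idem" by (rule idem_mult[OF f(1) e])
    have ca: "c \<otimes> a \<in> prdom x" using prdomD(5)[OF D_ideal(1)[OF f(2)] a(1)] .
    have caD: "c \<otimes> a \<in> D (f * e)"
      using D_ideal(6)[OF f(2) prdomD(1)[OF a(1)]] sub[OF ca] D_idem_mult[OF f(1)] by blast
    have "g \<otimes>\<^bsub>C\<^esub> y = \<iota> (f * e) (c \<otimes> a)"
      using fell_repD(4)[OF \<iota>, of c f a e] f a sub idem_fmul[OF f(1) e f(2) sub] by (simp add: fcar_A)
    also have "\<dots> = \<iota> e (c \<otimes> a)"
      using fell_repD(6)[OF \<iota> nat_le_left[OF f(1)], of "c \<otimes> a" e] caD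
        idem_fiber(3)[OF fe caD e nat_le_left[OF f(1)]] by (simp add: fcar_A)
    finally show ?thesis using ca C.nclosure_subset[OF XC] by (auto simp: X_def)
  qed
  define I where "I = C.nclosure X"
  have IE: "I \<subseteq> car E"
    unfolding I_def using idem_generators(6) by (intro C.nclosure_minimal XC XE) (simp add: cstar_subalgebra_def)
  have FC: "\<forall>\<^sub>F v in filtermap (\<iota> e) F. v \<in> car C \<and> \<parallel>v\<parallel>\<^bsub>C\<^esub> \<le> 1"
    unfolding eventually_filtermap
    using FD(2)
  proof eventually_elim
    case (elim u)
    thus ?case using h(1)[OF sub] norm_idem_fiber[OF e sub, of u] by auto
  qed
  have "\<forall>\<^sub>F v in filtermap (\<iota> e) F. \<forall>y\<in>car E. cmod (\<phi> (y \<otimes>\<^bsub>E\<^esub> v) - \<phi> y) \<le> \<epsilon> * (\<parallel>y\<parallel>\<^bsub>E\<^esub> + 1)"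
  proof (rule E.pure_ideal_unit[where I = I and w = "\<iota> e b"])
    show "positive_functional E \<phi>" by (rule \<phi>_state)
    show "cmod (\<phi> y) \<le> \<parallel>y\<parallel>\<^bsub>E\<^esub>" if "y \<in> car E" for y using \<phi>_state(2)[OF that] by (simp add: E_ops)
    show "lin_subspace E I"
      using C.nclosure_subspace[OF Xsub] IE by (simp add: lin_subspace_def I_def E_ops)
    show "y \<otimes>\<^bsub>E\<^esub> z \<in> I" if "y \<in> car E" "z \<in> I" for y z
      using C.generated_mul_nclosure[OF idem_generators(2,3) Xsub GX, of y z] that
      by (simp add: E_ops I_def flip: idem_generators(1))
    show "y\<^sup>\<star>\<^bsub>E\<^esub> \<in> I" if "y \<in> I" for y
      using C.nclosure_adj[OF XC Xadj] that by (simp add: E_ops I_def)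
    show "filtermap (\<iota> e) F \<noteq> bot" using FD(1) by (simp add: filtermap_bot_iff)
    show "\<forall>\<^sub>F v in filtermap (\<iota> e) F. v \<in> car E \<and> \<parallel>v\<parallel>\<^bsub>E\<^esub> \<le> 1"
      unfolding eventually_filtermap
      using FD(2)
    proof eventually_elim
      case (elim u)
      thus ?case using fiber_in_E[OF e sub] norm_idem_fiber[OF e sub, of u] by (auto simp: E_ops)
    qed
    show "((\<lambda>v. \<parallel>E.vsub (v \<otimes>\<^bsub>E\<^esub> y) y\<parallel>\<^bsub>E\<^esub>) \<longlongrightarrow> 0) (filtermap (\<iota> e) F)" if "y \<in> I" for y
      unfolding E_ops E_vsub
    proof (rule C.nclosure_unit[OF XC FC _ that[unfolded I_def]])
      fix y assume "y \<in> X"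
      then obtain a where a: "a \<in> prdom x" "y = \<iota> e a" by (auto simp: X_def)
      have "\<forall>\<^sub>F u in F. norm \<parallel>C.vsub (\<iota> e u \<otimes>\<^bsub>C\<^esub> y) y\<parallel>\<^bsub>C\<^esub> \<le> \<parallel>u \<otimes> a \<ominus> a\<parallel>"
        using FD(2)
      proof eventually_elim
        case (elim u)
        have u: "u \<in> D e" "a \<in> D e" "u \<otimes> a \<in> D e" "(- 1) \<odot> a \<in> D e"
          using elim a sub D_ideal(4) D_ideal(6) D_ideal(1) by blast+
        have d: "u \<otimes> a \<ominus> a \<in> D e" unfolding vsub_def by (rule D_ideal(3)[OF u(3,4)])
        have "C.vsub (\<iota> e u \<otimes>\<^bsub>C\<^esub> y) y = \<iota> e (u \<otimes> a \<ominus> a)"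
          using u by (simp add: a(2) vsub_def C.vsub_def h)
        thus ?case using norm_idem_fiber[OF e d] C.norm_nonneg[OF h(1)[OF d]] by simp
      qed
      thus "((\<lambda>v. \<parallel>C.vsub (v \<otimes>\<^bsub>C\<^esub> y) y\<parallel>\<^bsub>C\<^esub>) \<longlongrightarrow> 0) (filtermap (\<iota> e) F)"
        unfolding filterlim_filtermap by (rule Lim_null_comparison[OF _ FD(3)[OF a(1)]])
    qed
    show "pure_state E \<phi>" by (rule pure)
    show "\<iota> e b \<in> I" using nz(1) C.nclosure_subset[OF XC] by (auto simp: I_def X_def)
    show "\<phi> (\<iota> e b) \<noteq> 0" using nz(2) by (simp add: e_def)
  qed (rule \<epsilon>)
  thus ?thesis by (simp add: eventually_filtermap E_ops e_def)
qed

text \<open>Let \<open>X = \<iota> (pr_deg x) a\<close> and let \<open>e\<close> be the degree of \<open>y\<close>. If \<open>w\<close> runs through an approximate unit of \<open>D e\<close>, then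
  \<open>\<phi> (X w)\<close> tends to \<open>\<psi> X\<close> by assumption, and \<open>\<phi> (X w u)\<close> tends to \<open>\<phi> (X u)\<close> for \<open>u\<close> in the fiber over \<open>y\<close>. For \<open>u\<close> far enough in its
  approximate unit, \<open>\<phi> (X w u)\<close> is close to \<open>\<phi> (X w)\<close> uniformly in \<open>w\<close> by \<open>pure_fiber_unit\<close>, so \<open>\<phi> (X u)\<close> is close to \<open>\<psi> X\<close>.\<close>

lemma tilde_limit:
  assumes tilde: "tilde_state A C \<iota> \<phi> \<psi>" and a: "a \<in> prdom x"
    and y: "y \<in> idem" "nat_le y x" and nz: "b \<in> prdom y" "\<phi> (\<iota> (pr_deg y) b) \<noteq> 0"
    and F: "approximate_unit A' y F"
  shows "((\<lambda>u. \<phi> (\<iota> (pr_deg (x * y)) (fmul A' x y a u))) \<longlongrightarrow> \<psi> (\<iota> (pr_deg x) a)) F"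
proof -
  define g where "g = pr_deg x"
  define e where "e = pr_deg y"
  have e: "e \<in> idem" "nat_le e g" unfolding e_def g_def by (rule pr_deg_idem[OF y(1)]) (rule nat_le_pr_deg[OF y(2)])
  have ge: "g * e = e" using nat_leD(1)[OF e(2)] e(1) by (simp add: sinv_idem' idem_def)
  have sub: "u \<in> prdom y \<Longrightarrow> u \<in> D e" for u using prdom_deg unfolding e_def by blast
  have aD: "a \<in> D g" using a prdom_deg unfolding g_def by blast
  note FD = approximate_unitD[OF y(1) F]
  note h = star_homD[OF idem_fiber_hom[OF \<iota> e(1)], simplified]
  define X where "X = \<iota> g a"
  have XC: "X \<in> car C" using fell_repD(1)[OF \<iota>, of a g] aD by (simp add: X_def fcar_A)
  have mult: "X \<otimes>\<^bsub>C\<^esub> \<iota> e u = \<iota> (g * e) (fmul A g e a u)" if "u \<in> D e" for u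
    using fell_repD(4)[OF \<iota>, of a g u e] aD that by (simp add: fcar_A X_def)
  have XE: "X \<otimes>\<^bsub>C\<^esub> \<iota> e u \<in> car E" if u: "u \<in> D e" for u
  proof -
    have "fmul A g e a u \<in> D (g * e)"
      using fmul_prdom[of a "pgen g" u "pgen e"] prdom_deg[of "pgen g * pgen e"] aD u by (auto simp: prdom_pgen)
    thus ?thesis unfolding mult[OF u] ge by (rule fiber_in_E[OF e(1)])
  qed
  have bound: "cmod (\<phi> (X \<otimes>\<^bsub>C\<^esub> \<iota> e u)) \<le> \<parallel>X\<parallel>\<^bsub>C\<^esub> * \<parallel>u\<parallel>" if u: "u \<in> D e" for u
  proof -
    have "cmod (\<phi> (X \<otimes>\<^bsub>C\<^esub> \<iota> e u)) \<le> \<parallel>X \<otimes>\<^bsub>C\<^esub> \<iota> e u\<parallel>\<^bsub>C\<^esub>" by (rule \<phi>_state(2)[OF XE[OF u]])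
    also have "\<dots> \<le> \<parallel>X\<parallel>\<^bsub>C\<^esub> * \<parallel>\<iota> e u\<parallel>\<^bsub>C\<^esub>" by (rule C.norm_mul[OF XC h(1)[OF u]])
    also have "\<dots> \<le> \<parallel>X\<parallel>\<^bsub>C\<^esub> * \<parallel>u\<parallel>"
      using norm_idem_fiber[OF e(1) u] C.norm_nonneg[OF XC] by (rule mult_left_mono)
    finally show ?thesis .
  qed
  obtain F0 where F0: "approximate_unit A e F0" using fiber_approximate_unit[OF e(1)] .
  have F0': "approximate_unit A' (pgen e) F0"
    using approximate_unit_restrict[OF pgen_in_idem[OF e(1)], of F0] F0 by (simp add: prdom_pgen)
  note FD0 = approximate_unitD[OF pgen_in_idem[OF e(1)] F0', unfolded prdom_pgen]
  have "nonzero_on_fiber A \<iota> \<phi> e" using nz sub by (auto simp: nonzero_on_fiber_def fcar_A e_def)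
  hence "((\<lambda>u. \<phi> (\<iota> (g * e) (fmul A g e a u))) \<longlongrightarrow> \<psi> (\<iota> g a)) F0"
    using tilde e F0 aD unfolding tilde_state_def fcar_A by blast
  hence lim0: "((\<lambda>w. \<phi> (X \<otimes>\<^bsub>C\<^esub> \<iota> e w)) \<longlongrightarrow> \<psi> X) F0"
    unfolding X_def[symmetric]
    by (rule Lim_transform_eventually) (use FD0(2) in \<open>eventually_elim, simp add: mult\<close>)
  have "((\<lambda>u. \<phi> (X \<otimes>\<^bsub>C\<^esub> \<iota> e u)) \<longlongrightarrow> \<psi> X) F"
    unfolding tendsto_iff
  proof (intro allI impI)
    fix \<epsilon> :: real assume \<epsilon>: "\<epsilon> > 0"
    define \<delta> where "\<delta> = \<epsilon> / (2 * (\<parallel>X\<parallel>\<^bsub>C\<^esub> + 1))"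
    have K: "\<parallel>X\<parallel>\<^bsub>C\<^esub> + 1 > 0" using C.norm_nonneg[OF XC] by simp
    hence \<delta>: "\<delta> > 0" using \<epsilon> by (simp add: \<delta>_def)
    have \<delta>K: "\<delta> * (\<parallel>X\<parallel>\<^bsub>C\<^esub> + 1) = \<epsilon> / 2" using K by (simp add: \<delta>_def field_simps)
    have "\<forall>\<^sub>F u in F. \<forall>z\<in>car E. cmod (\<phi> (z \<otimes>\<^bsub>C\<^esub> \<iota> e u) - \<phi> z) \<le> \<delta> * (\<parallel>z\<parallel>\<^bsub>C\<^esub> + 1)"
      using pure_fiber_unit[OF y(1) nz F \<delta>] by (simp add: e_def)
    thus "\<forall>\<^sub>F u in F. dist (\<phi> (X \<otimes>\<^bsub>C\<^esub> \<iota> e u)) (\<psi> X) < \<epsilon>"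
      using FD(2)
    proof eventually_elim
      case (elim u)
      have u: "u \<in> D e" using elim sub by blast
      have lim1: "((\<lambda>w. \<phi> (X \<otimes>\<^bsub>C\<^esub> \<iota> e (w \<otimes> u))) \<longlongrightarrow> \<phi> (X \<otimes>\<^bsub>C\<^esub> \<iota> e u)) F0"
      proof (rule LIM_zero_cancel, rule Lim_null_comparison)
        show "((\<lambda>w. \<parallel>X\<parallel>\<^bsub>C\<^esub> * \<parallel>w \<otimes> u \<ominus> u\<parallel>) \<longlongrightarrow> 0) F0"
          by (rule tendsto_mult_right_zero[OF FD0(3)[OF u]])
        show "\<forall>\<^sub>F w in F0. cmod (\<phi> (X \<otimes>\<^bsub>C\<^esub> \<iota> e (w \<otimes> u)) - \<phi> (X \<otimes>\<^bsub>C\<^esub> \<iota> e u)) \<le> \<parallel>X\<parallel>\<^bsub>C\<^esub> * \<parallel>w \<otimes> u \<ominus> u\<parallel>"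
          using FD0(2)
        proof eventually_elim
          case (elim w)
          have wu: "w \<otimes> u \<in> D e" using D_ideal(6) D_ideal(1)[OF u] elim by blast
          have n: "(- 1) \<odot> u \<in> D e" by (rule D_ideal(4)[OF u])
          have d: "w \<otimes> u \<ominus> u \<in> D e" unfolding vsub_def by (rule D_ideal(3)[OF wu n])
          have "X \<otimes>\<^bsub>C\<^esub> \<iota> e (w \<otimes> u \<ominus> u) = C.vsub (X \<otimes>\<^bsub>C\<^esub> \<iota> e (w \<otimes> u)) (X \<otimes>\<^bsub>C\<^esub> \<iota> e u)"
            unfolding vsub_def C.vsub_def h(2)[OF wu n] h(3)[OF u]
            by (simp only: C.mul_add_right C.mul_scal_right XC h(1)[OF wu] h(1)[OF u] C.ccloseds)
          hence "\<phi> (X \<otimes>\<^bsub>C\<^esub> \<iota> e (w \<otimes> u \<ominus> u)) = \<phi> (X \<otimes>\<^bsub>C\<^esub> \<iota> e (w \<otimes> u)) - \<phi> (X \<otimes>\<^bsub>C\<^esub> \<iota> e u)"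
            using E.pf_vsub[OF \<phi>_state(1) XE[OF wu] XE[OF u]] by (simp add: E_vsub)
          thus ?case using bound[OF d] by simp
        qed
      qed
      have "cmod (\<phi> (X \<otimes>\<^bsub>C\<^esub> \<iota> e u) - \<psi> X) \<le> \<delta> * (\<parallel>X\<parallel>\<^bsub>C\<^esub> + 1)"
      proof (rule tendsto_upperbound[OF _ _ FD0(1)])
        show "((\<lambda>w. cmod (\<phi> (X \<otimes>\<^bsub>C\<^esub> \<iota> e (w \<otimes> u)) - \<phi> (X \<otimes>\<^bsub>C\<^esub> \<iota> e w))) \<longlongrightarrow>
            cmod (\<phi> (X \<otimes>\<^bsub>C\<^esub> \<iota> e u) - \<psi> X)) F0"
          by (intro tendsto_intros lim0 lim1)
        show "\<forall>\<^sub>F w in F0. cmod (\<phi> (X \<otimes>\<^bsub>C\<^esub> \<iota> e (w \<otimes> u)) - \<phi> (X \<otimes>\<^bsub>C\<^esub> \<iota> e w)) \<le> \<delta> * (\<parallel>X\<parallel>\<^bsub>C\<^esub> + 1)"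
          using FD0(2)
        proof eventually_elim
          case (elim w)
          have w: "w \<in> D e" "\<parallel>w\<parallel> \<le> 1" using elim by auto
          have eq: "X \<otimes>\<^bsub>C\<^esub> \<iota> e (w \<otimes> u) = (X \<otimes>\<^bsub>C\<^esub> \<iota> e w) \<otimes>\<^bsub>C\<^esub> \<iota> e u"
            by (simp add: h(4) C.mul_assoc XC h(1) w u)
          have "\<parallel>X \<otimes>\<^bsub>C\<^esub> \<iota> e w\<parallel>\<^bsub>C\<^esub> \<le> \<parallel>X\<parallel>\<^bsub>C\<^esub> * \<parallel>\<iota> e w\<parallel>\<^bsub>C\<^esub>" by (rule C.norm_mul[OF XC h(1)[OF w(1)]])
          also have "\<dots> \<le> \<parallel>X\<parallel>\<^bsub>C\<^esub> * 1"
            using norm_idem_fiber[OF e(1) w(1)] w(2) C.norm_nonneg[OF XC] by (intro mult_left_mono) auto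
          finally have "\<delta> * (\<parallel>X \<otimes>\<^bsub>C\<^esub> \<iota> e w\<parallel>\<^bsub>C\<^esub> + 1) \<le> \<delta> * (\<parallel>X\<parallel>\<^bsub>C\<^esub> + 1)"
            using \<delta> by (intro mult_left_mono) auto
          moreover have "cmod (\<phi> ((X \<otimes>\<^bsub>C\<^esub> \<iota> e w) \<otimes>\<^bsub>C\<^esub> \<iota> e u) - \<phi> (X \<otimes>\<^bsub>C\<^esub> \<iota> e w)) \<le>
              \<delta> * (\<parallel>X \<otimes>\<^bsub>C\<^esub> \<iota> e w\<parallel>\<^bsub>C\<^esub> + 1)"
            using \<open>\<forall>z\<in>car E. _ z\<close> XE[OF w(1)] by blast
          ultimately show ?case unfolding eq by linarith
        qed
      qed
      thus ?case using \<epsilon> unfolding \<delta>K dist_norm by linarith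
    qed
  qed
  moreover have "\<forall>\<^sub>F u in F. \<phi> (X \<otimes>\<^bsub>C\<^esub> \<iota> e u) = \<phi> (\<iota> (pr_deg (x * y)) (fmul A' x y a u))"
    using FD(2)
  proof eventually_elim
    case (elim u)
    hence u: "u \<in> prdom y" by simp
    show ?case using mult[OF sub[OF u]] fmul_restrict[OF a u] by (simp add: g_def e_def)
  qed
  ultimately show ?thesis
    unfolding g_def[symmetric] X_def[symmetric] by (rule Lim_transform_eventually)
qed

text \<open>For the vanishing condition, suppose that \<open>\<phi>\<close> does not vanish on \<open>D e\<close> for some idempotent \<open>e\<close> below
  \<open>pr_deg x\<close>, but vanishes on the fibers over all idempotents below \<open>x\<close>. One of these is \<open>x [e]\<close>. The products \<open>a u\<close> with \<open>u \<in> D e\<close> lie in the fiber over \<open>x [e]\<close>, so the limit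
  that defines \<open>\<psi>\<close> at \<open>a\<close> is zero.\<close>

lemma tilde_state_extend:
  assumes tilde: "tilde_state A C \<iota> \<phi> \<psi>"
  shows "tilde_state A' C (\<lambda>x. \<iota> (pr_deg x)) \<phi> \<psi>"
  unfolding tilde_state_def fcar_A
proof (intro conjI allI ballI impI)
  show "state C \<psi>" using tilde by (simp add: tilde_state_def)
  fix x a assume a: "a \<in> prdom x"
  {
    fix y F assume y: "y \<in> idem"
      "nat_le y x \<and> nonzero_on_fiber A' (\<lambda>x. \<iota> (pr_deg x)) \<phi> y \<and> approximate_unit A' y F"
    then obtain b where "b \<in> prdom y" "\<phi> (\<iota> (pr_deg y) b) \<noteq> 0" by (auto simp: nonzero_on_fiber_def fcar_A)
    thus "((\<lambda>u. \<phi> (\<iota> (pr_deg (x * y)) (fmul A' x y a u))) \<longlongrightarrow> \<psi> (\<iota> (pr_deg x) a)) F"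
      using tilde_limit[OF tilde a] y by blast
  }
  assume no: "\<nexists>e. e \<in> idem \<and> nat_le e x \<and> nonzero_on_fiber A' (\<lambda>x. \<iota> (pr_deg x)) \<phi> e"
  have aD: "a \<in> D (pr_deg x)" using a prdom_deg by blast
  show "\<psi> (\<iota> (pr_deg x) a) = 0"
  proof (cases "\<exists>e. e \<in> idem \<and> nat_le e (pr_deg x) \<and> nonzero_on_fiber A \<iota> \<phi> e")
    case False
    thus ?thesis using tilde aD unfolding tilde_state_def fcar_A by blast
  next
    case True
    then obtain e where e: "e \<in> idem" "nat_le e (pr_deg x)" "nonzero_on_fiber A \<iota> \<phi> e" by blast
    note xe = mult_pgen_idem[OF e(1,2)]
    have ge: "pr_deg x * e = e" using xe(3) by simp
    have zero: "\<phi> (\<iota> e b) = 0" if "b \<in> prdom (x * pgen e)" for b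
      using no xe that by (auto simp: nonzero_on_fiber_def fcar_A)
    obtain F where F: "approximate_unit A e F" using fiber_approximate_unit[OF e(1)] .
    have "((\<lambda>u. \<phi> (\<iota> (pr_deg x * e) (fmul A (pr_deg x) e a u))) \<longlongrightarrow> \<psi> (\<iota> (pr_deg x) a)) F"
      using tilde e F aD unfolding tilde_state_def fcar_A by blast
    moreover have "\<forall>\<^sub>F u in F. u \<in> D e" "F \<noteq> bot"
      using F by (auto simp: approximate_unit_def fcar_A elim: eventually_mono)
    moreover from this(1) have "\<forall>\<^sub>F u in F. \<phi> (\<iota> (pr_deg x * e) (fmul A (pr_deg x) e a u)) = 0"
    proof eventually_elim
      case (elim u)
      thus ?case using fmul_prdom[OF a, of u "pgen e"] zero by (simp add: prdom_pgen ge)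
    qed
    ultimately show ?thesis
      using tendsto_cong[of "\<lambda>u. \<phi> (\<iota> (pr_deg x * e) (fmul A (pr_deg x) e a u))" "\<lambda>_. 0" F]
      by (simp add: tendsto_const_iff)
  qed
qed

end

text \<open>The fiber over the idempotent \<open>[s] [e]\<close> is \<open>D e\<close>, so every condition for \<open>G\<close> is one of the conditions for
  the expansion.\<close>

lemma tilde_state_descend:
  assumes tilde: "tilde_state A' C (\<lambda>x. \<iota> (pr_deg x)) \<phi> \<psi>"
  shows "tilde_state A C \<iota> \<phi> \<psi>"
  unfolding tilde_state_def fcar_A
proof (intro conjI allI ballI impI)
  show "state C \<psi>" using tilde by (simp add: tilde_state_def)
  fix s a assume a: "a \<in> D s"
  hence a': "a \<in> prdom (pgen s)" by (simp add: prdom_pgen)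
  {
    fix e F assume e: "e \<in> idem" and eF: "nat_le e s \<and> nonzero_on_fiber A \<iota> \<phi> e \<and> approximate_unit A e F"
    \<comment> \<open>An idempotent below \<open>[s]\<close> of degree \<open>e\<close> whose fiber is all of \<open>D e\<close>.\<close>
    define y where "y = pgen s * pgen e"
    have y: "y \<in> idem" "nat_le y (pgen s)" "pr_deg y = e"
      using mult_pgen_idem[OF e, of "pgen s"] eF by (simp_all add: y_def)
    have se: "s * e = e" using y(3) by (simp add: y_def)
    have "prdom y = D s \<inter> D e" unfolding y_def prdom_mult prdom_pgen pr_deg_simps act_dom se by blast
    hence dom: "prdom y = D e" using D_mono eF by blast
    have F: "approximate_unit A' y F"
      using approximate_unit_restrict[OF y(1)] eF by (simp add: y(3) dom)
    have "nonzero_on_fiber A' (\<lambda>x. \<iota> (pr_deg x)) \<phi> y"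
      using eF by (simp add: nonzero_on_fiber_def fcar_A dom y(3))
    hence "((\<lambda>u. \<phi> (\<iota> (pr_deg (pgen s * y)) (fmul A' (pgen s) y a u))) \<longlongrightarrow> \<psi> (\<iota> (pr_deg (pgen s)) a)) F"
      using tilde y F a' unfolding tilde_state_def fcar_A by blast
    hence "((\<lambda>u. \<phi> (\<iota> (s * e) (fmul A' (pgen s) y a u))) \<longlongrightarrow> \<psi> (\<iota> s a)) F" by (simp add: y(3))
    moreover have "\<forall>\<^sub>F u in F. u \<in> D e"
      using eF by (auto simp: approximate_unit_def fcar_A elim: eventually_mono)
    hence "\<forall>\<^sub>F u in F. \<phi> (\<iota> (s * e) (fmul A' (pgen s) y a u)) = \<phi> (\<iota> (s * e) (fmul A s e a u))"
      by eventually_elim (use a' in \<open>simp add: fmul_restrict dom y(3)\<close>)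
    ultimately show "((\<lambda>u. \<phi> (\<iota> (s * e) (fmul A s e a u))) \<longlongrightarrow> \<psi> (\<iota> s a)) F"
      by (rule Lim_transform_eventually)
  }
  assume no: "\<nexists>e. e \<in> idem \<and> nat_le e s \<and> nonzero_on_fiber A \<iota> \<phi> e"
  have "\<not> nonzero_on_fiber A' (\<lambda>x. \<iota> (pr_deg x)) \<phi> y" if "y \<in> idem" "nat_le y (pgen s)" for y
    using no pr_deg_idem[OF that(1)] nat_le_pr_deg[OF that(2)] prdom_deg[of y]
    by (auto simp: nonzero_on_fiber_def fcar_A)
  hence "\<psi> (\<iota> (pr_deg (pgen s)) a) = 0" using tilde a' unfolding tilde_state_def fcar_A by blast
  thus "\<psi> (\<iota> s a) = 0" by simp
qed

lemma tilde_state_transport: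
  assumes f: "\<And>x a. a \<in> prdom x \<Longrightarrow> f (\<kappa> x a) = \<kappa>' x a"
    and state: "state C (\<lambda>x. \<psi> (f x))" and tilde: "tilde_state A' C' \<kappa>' \<phi> \<psi>"
  shows "tilde_state A' C \<kappa> (\<lambda>x. \<phi> (f x)) (\<lambda>x. \<psi> (f x))"
  unfolding tilde_state_def fcar_A
proof (intro conjI allI ballI impI)
  have nz: "nonzero_on_fiber A' \<kappa> (\<lambda>x. \<phi> (f x)) e \<longleftrightarrow> nonzero_on_fiber A' \<kappa>' \<phi> e" for e
    by (auto simp: nonzero_on_fiber_def fcar_A f)
  fix x a assume a: "a \<in> prdom x"
  {
    fix e F assume e: "e \<in> idem"
      and eF: "nat_le e x \<and> nonzero_on_fiber A' \<kappa> (\<lambda>x. \<phi> (f x)) e \<and> approximate_unit A' e F"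
    have "((\<lambda>u. \<phi> (\<kappa>' (x * e) (fmul A' x e a u))) \<longlongrightarrow> \<psi> (\<kappa>' x a)) F"
      using tilde e eF a unfolding tilde_state_def fcar_A nz by blast
    moreover have "\<forall>\<^sub>F u in F. u \<in> prdom e"
      using eF by (auto simp: approximate_unit_def fcar_A elim: eventually_mono)
    hence "\<forall>\<^sub>F u in F. \<phi> (\<kappa>' (x * e) (fmul A' x e a u)) = \<phi> (f (\<kappa> (x * e) (fmul A' x e a u)))"
      by eventually_elim (use a in \<open>simp add: f fmul_restrict fmul_prdom\<close>)
    ultimately show "((\<lambda>u. \<phi> (f (\<kappa> (x * e) (fmul A' x e a u)))) \<longlongrightarrow> \<psi> (f (\<kappa> x a))) F"
      unfolding f[OF a] by (rule Lim_transform_eventually)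
  }
  assume "\<nexists>e. e \<in> idem \<and> nat_le e x \<and> nonzero_on_fiber A' \<kappa> (\<lambda>x. \<phi> (f x)) e"
  thus "\<psi> (f (\<kappa> x a)) = 0" using tilde a unfolding f[OF a] nz tilde_state_def fcar_A by blast
qed (rule state)

end

theorem corollary8p2:
  fixes B :: "'b cstar"
    and \<alpha> :: "('g::inverse_semigroup, 'b) twisted_data"
    and C C' :: "'c cstar"
    and \<iota> :: "'g \<Rightarrow> 'b \<Rightarrow> 'c"
    and \<iota>' :: "'g pr \<Rightarrow> 'b \<Rightarrow> 'c"
  assumes "cstar_algebra B"
    and "twisted_partial_action B \<alpha>"
    and "full_crossed_product B \<alpha> C \<iota>"
    and "full_crossed_product B (pr_action \<alpha>) C' \<iota>'"
  shows "C \<cong> C' \<and>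
    reduced_crossed_product B \<alpha> C \<iota> \<cong> reduced_crossed_product B (pr_action \<alpha>) C' \<iota>'"
proof -
  interpret twisted_partial_action B \<alpha> by (rule assms(2))
  have full: "full_cstar A C \<iota>" and full': "full_cstar A' C' \<iota>'"
    using assms(3,4) by (simp_all add: full_crossed_product_def)
  have \<iota>: "fell_rep A C \<iota>" and \<iota>': "fell_rep A' C' \<iota>'"
    using full full' by (simp_all add: full_cstar_def)
  obtain \<Phi> \<Psi> where eqv: "star_equivalence C C' \<Phi> \<Psi>"
    and \<Phi>: "\<And>s a. a \<in> D s \<Longrightarrow> \<Phi> (\<iota> s a) = \<iota>' (pgen s) a"
    and \<Psi>: "\<And>x a. a \<in> prdom x \<Longrightarrow> \<Psi> (\<iota>' x a) = \<iota> (pr_deg x) a"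
    using full_equivalence[OF full full'] by blast
  interpret S: star_equivalence C C' \<Phi> \<Psi> by (rule eqv)
  interpret S': star_equivalence C' C \<Psi> \<Phi> by (rule S.symmetric)
  have \<Phi>': "\<Phi> (\<iota> (pr_deg x) a) = \<iota>' x a" if "a \<in> prdom x" for x a
    using \<Phi>[of a "pr_deg x"] fell_rep_pgen_deg[OF \<iota>' that] prdom_deg[of x] that by auto
  let ?E = "idem_cstar A C \<iota>" and ?E' = "idem_cstar A' C' \<iota>'"
  define G where "G = (\<Union>e\<in>idem. \<iota> e ` D e)"
  define G' where "G' = (\<Union>e\<in>idem. \<iota>' e ` prdom e)"
  have gen: "?E = generated_cstar C G" "?E' = generated_cstar C' G'"
    by (simp_all add: idem_cstar_def G_def G'_def fcar_A)
  have "G \<subseteq> car C" "G' \<subseteq> car C'"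
    using fell_repD(1)[OF \<iota>] fell_repD(1)[OF \<iota>'] by (auto simp: G_def G'_def fcar_A)
  moreover have "\<Phi> ` G \<subseteq> G'"
    using pgen_in_idem by (fastforce simp: G_def G'_def \<Phi> prdom_pgen)
  moreover have "\<Psi> ` G' \<subseteq> G"
    using pr_deg_idem prdom_deg by (fastforce simp: G_def G'_def \<Psi>)
  ultimately have eqvE: "star_equivalence ?E ?E' \<Phi> \<Psi>"
    unfolding gen by (rule S.generated_equivalence)
  \<comment> \<open>The ideals that are divided out in the two reduced crossed products.\<close>
  define J where "J = {x \<in> car C. \<forall>\<phi> \<psi>. pure_state ?E \<phi> \<and> tilde_state A C \<iota> \<phi> \<psi> \<longrightarrow> x \<in> gns_kernel C \<psi>}"
  define J' where "J' = {x \<in> car C'. \<forall>\<phi> \<psi>. pure_state ?E' \<phi> \<and> tilde_state A' C' \<iota>' \<phi> \<psi> \<longrightarrow> x \<in> gns_kernel C' \<psi>}"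
  have 1: "\<Phi> x \<in> J'" if x: "x \<in> J" for x
    unfolding J'_def
  proof (intro CollectI conjI allI impI)
    show "\<Phi> x \<in> car C'" using x S.\<Phi>(1) by (simp add: J_def)
    fix \<phi> \<psi> assume \<phi>: "pure_state ?E' \<phi> \<and> tilde_state A' C' \<iota>' \<phi> \<psi>"
    have "pure_state ?E (\<lambda>x. \<phi> (\<Phi> x))"
      using star_equivalence.pure_state_pullback[OF eqvE] \<phi> by blast
    moreover have "tilde_state A' C (\<lambda>x. \<iota> (pr_deg x)) (\<lambda>x. \<phi> (\<Phi> x)) (\<lambda>x. \<psi> (\<Phi> x))"
      by (rule tilde_state_transport[OF \<Phi>' S.state_pullback conjunct2[OF \<phi>]])
        (use \<phi> in \<open>simp_all add: tilde_state_def\<close>)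
    ultimately have "x \<in> gns_kernel C (\<lambda>x. \<psi> (\<Phi> x))"
      using x tilde_state_descend unfolding J_def by blast
    thus "\<Phi> x \<in> gns_kernel C' \<psi>" by (rule S.gns_kernel_pullback)
  qed
  have 2: "\<Psi> y \<in> J" if y: "y \<in> J'" for y
    unfolding J_def
  proof (intro CollectI conjI allI impI)
    show "\<Psi> y \<in> car C" using y S.\<Psi>(1) by (simp add: J'_def)
    fix \<phi> \<psi> assume \<phi>: "pure_state ?E \<phi> \<and> tilde_state A C \<iota> \<phi> \<psi>"
    have "pure_state ?E' (\<lambda>y. \<phi> (\<Psi> y))"
      using star_equivalence.pure_state_pullback[OF star_equivalence.symmetric[OF eqvE]] \<phi> by blast
    moreover have "tilde_state A' C (\<lambda>x. \<iota> (pr_deg x)) \<phi> \<psi>"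
      by (rule tilde_state_extend[OF S.C.cstar_algebra_axioms \<iota> conjunct1[OF \<phi>] conjunct2[OF \<phi>]])
    moreover have "state C' (\<lambda>y. \<psi> (\<Psi> y))"
      using \<phi> by (intro S'.state_pullback) (simp add: tilde_state_def)
    ultimately have "pure_state ?E' (\<lambda>y. \<phi> (\<Psi> y)) \<and> tilde_state A' C' \<iota>' (\<lambda>y. \<phi> (\<Psi> y)) (\<lambda>y. \<psi> (\<Psi> y))"
      using tilde_state_transport[where f = \<Psi> and \<kappa> = \<iota>' and \<kappa>' = "\<lambda>x. \<iota> (pr_deg x)"] \<Psi> by blast
    hence "y \<in> gns_kernel C' (\<lambda>y. \<psi> (\<Psi> y))"
      using y unfolding J'_def by blast
    thus "\<Psi> y \<in> gns_kernel C \<psi>" by (rule S'.gns_kernel_pullback)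
  qed
  have "J \<subseteq> car C" by (auto simp: J_def)
  moreover have "\<Phi> ` J = J'"
  proof
    show "\<Phi> ` J \<subseteq> J'" using 1 by blast
    show "J' \<subseteq> \<Phi> ` J"
    proof
      fix y assume y: "y \<in> J'"
      hence "y = \<Phi> (\<Psi> y)" by (simp add: J'_def S.inverse)
      thus "y \<in> \<Phi> ` J" using 2[OF y] by blast
    qed
  qed
  ultimately have "cstar_quotient C J \<cong> cstar_quotient C' J'"
    by (intro S.quotient_isomorphic)
  moreover have "C \<cong> C'"
    using S.hom(1) S.\<Phi>_bij by (auto simp: star_isomorphic_def star_iso_def)
  ultimately show ?thesis
    by (simp add: reduced_crossed_product_def reduced_cstar_def J_def J'_def)
qed

end
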